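(* Let $S$ be a finitely generated subsemigroup of a finitely presented semigroup $H$. Then the corresponding length function $g\mapsto |g|_H$ on $S$ satisfies conditions (D1)–(D3). Conversely, for every finitely generated semigroup $S$ and every function $l:S\rightarrow\mathbb{N}$ satisfying conditions (D1)–(D3), there exists an embedding of $S$ into a finitely presented semigroup $H$ such that the length function $g\mapsto|g|_H$ on $S$ is equivalent to $l$.
   Context: Semigroups are not assumed to have an identity element. $\mathbb{N}=\{1,2,3,\dots\}$. $F_k$ denotes the (absolutely) free semigroup of rank $k$, whose elements are the nonempty words in $k$ letters; $||u||$ denotes the number of letters of a word $u$. For a semigroup $H$ with a finite generating set, $|g|_H$ denotes the length of a shortest word in the generators representing $g\in H$. An embedding is an injective semigroup homomorphism; $S$ is identified with its image. Let $S$ be a semigroup generated by $m$ elements, $\pi:F_m\to S$ the natural projection, and $l:S\to\mathbb{N}$ a function. Its natural lift is $l^*:F_m\to\mathbb{N}$, $l^*(v)=l(\pi(v))$. The conditions are: (D1) $l(gh)\leq l(g)+l(h)$ for all $g,h\in S$. (D2) There exists a positive number $a$ such that $\mathrm{card}\{g\in S : l(g)\leq r\}\leq a^r$ for any $r\in\mathbb{N}$. (D3) There exist a natural number $n$ and a recursively enumerable set $T\subset F_m\times F_n$ such that: (1) if $(v_1,u),(v_2,u)\in T$ for some words $v_1,v_2,u$, then $v_1$ and $v_2$ represent the same element in $S$; (2) if $v_1$ and $v_2$ represent the same element in $S$, then there exists an element $u$ such that $(v_1,u),(v_2,u)\in T$; (3) $l^*(v)=\min\{||u|| : (v,u)\in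 T\}$ for every $v\in F_m$. Two functions $l_1,l_2:S\to\mathbb{N}$ are equivalent if there exist constants $c_1,c_2>0$ such that $c_1l_1(g)\leq l_2(g)\leq c_2l_1(g)$ for all $g\in S$. *)

theory Defs
  imports Complex_Main "HOL-Library.FuncSet" "HOL-Library.Nat_Bijection" "HOL-Algebra.Congruence"
begin

section \<open>Semigroups with explicit carrier\<close>

text \<open>Records of HOL-Algebra do not cover semigroups without identity, so the record
  \<^typ>\<open>'a partial_object\<close> is extended by a multiplication only. As there, a subset \<open>A\<close> of
  the carrier is regarded as a structure by \<open>S\<lparr>carrier := A\<rparr>\<close>.\<close>

record 'a sgrp = "'a partial_object" +
  sg_mult :: "'a \<Rightarrow> 'a \<Rightarrow> 'a"  (infixl "\<cdot>\<index>" 70)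

locale sgrp =
  fixes S :: "'a sgrp" (structure)
  assumes nonempty: "carrier S \<noteq> {}"
    and closed: "\<lbrakk>x \<in> carrier S; y \<in> carrier S\<rbrakk> \<Longrightarrow> x \<cdot> y \<in> carrier S"
    and assoc: "\<lbrakk>x \<in> carrier S; y \<in> carrier S; z \<in> carrier S\<rbrakk> \<Longrightarrow> (x \<cdot> y) \<cdot> z = x \<cdot> (y \<cdot> z)"

definition subsemigroup :: "'a set \<Rightarrow> 'a sgrp \<Rightarrow> bool" where
  "subsemigroup A H \<longleftrightarrow> A \<subseteq> carrier H \<and> sgrp (H\<lparr>carrier := A\<rparr>)"

definition sg_hom :: "'a sgrp \<Rightarrow> 'b sgrp \<Rightarrow> ('a \<Rightarrow> 'b) set" where
  "sg_hom S H = {\<phi>. \<phi> \<in> carrier S \<rightarrow> carrier H \<and>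
     (\<forall>x\<in>carrier S. \<forall>y\<in>carrier S. \<phi> (x \<cdot>\<^bsub>S\<^esub> y) = \<phi> x \<cdot>\<^bsub>H\<^esub> \<phi> y)}"

definition sg_embedding :: "('a \<Rightarrow> 'b) \<Rightarrow> 'a sgrp \<Rightarrow> 'b sgrp \<Rightarrow> bool" where
  "sg_embedding \<phi> S H \<longleftrightarrow> \<phi> \<in> sg_hom S H \<and> inj_on \<phi> (carrier S)"

definition sg_isomorphic :: "'a sgrp \<Rightarrow> 'b sgrp \<Rightarrow> bool" where
  "sg_isomorphic S H \<longleftrightarrow> (\<exists>\<phi>\<in>sg_hom S H. bij_betw \<phi> (carrier S) (carrier H))"


section \<open>Words, generators and word length\<close>

definition words :: "'a set \<Rightarrow> 'a list set" where
  "words X = lists X - {[]}"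

text \<open>The free semigroup of rank \<open>k\<close>, with letters \<open>0, \<dots>, k - 1\<close> and multiplication \<open>@\<close>.\<close>

abbreviation free_sg :: "nat \<Rightarrow> nat list set" where
  "free_sg k \<equiv> words {..<k}"

text \<open>The value of a word; it is meaningful for nonempty words only.\<close>

definition word_prod :: "'a sgrp \<Rightarrow> 'a list \<Rightarrow> 'a" where
  "word_prod S w = foldl (sg_mult S) (hd w) (tl w)"

definition generating_set :: "'a sgrp \<Rightarrow> 'a set \<Rightarrow> bool" where
  "generating_set S X \<longleftrightarrow> X \<subseteq> carrier S \<and> carrier S = word_prod S ` words X"

text \<open>The natural projection of the free semigroup of rank \<open>m\<close> given by elements
  \<open>x 0, \<dots>, x (m - 1)\<close> (not necessarily distinct).\<close>

definition proj :: "'a sgrp \<Rightarrow> (nat \<Rightarrow> 'a) \<Rightarrow> nat list \<Rightarrow> 'a" where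
  "proj S x v = word_prod S (map x v)"

definition generated_by :: "'a sgrp \<Rightarrow> nat \<Rightarrow> (nat \<Rightarrow> 'a) \<Rightarrow> bool" where
  "generated_by S m x \<longleftrightarrow>
     1 \<le> m \<and> x \<in> {..<m} \<rightarrow> carrier S \<and> carrier S = proj S x ` free_sg m"

definition word_length :: "'a sgrp \<Rightarrow> 'a set \<Rightarrow> 'a \<Rightarrow> nat" where
  "word_length H X g = (LEAST k. \<exists>w\<in>words X. word_prod H w = g \<and> length w = k)"


section \<open>Finitely presented semigroups\<close>

text \<open>The congruence on the free semigroup of rank \<open>k\<close> generated by \<open>R\<close>.\<close>

inductive_set sg_cong :: "nat \<Rightarrow> (nat list \<times> nat list) set \<Rightarrow> (nat list \<times> nat list) set"
  for k :: nat and R :: "(nat list \<times> nat list) set"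
where
  base: "(u, v) \<in> R \<Longrightarrow> (u, v) \<in> sg_cong k R"
| refl: "u \<in> free_sg k \<Longrightarrow> (u, u) \<in> sg_cong k R"
| sym: "(u, v) \<in> sg_cong k R \<Longrightarrow> (v, u) \<in> sg_cong k R"
| trans: "\<lbrakk>(u, v) \<in> sg_cong k R; (v, w) \<in> sg_cong k R\<rbrakk> \<Longrightarrow> (u, w) \<in> sg_cong k R"
| mult: "\<lbrakk>(u, v) \<in> sg_cong k R; (u', v') \<in> sg_cong k R\<rbrakk> \<Longrightarrow> (u @ u', v @ v') \<in> sg_cong k R"

definition presented_sg :: "nat \<Rightarrow> (nat list \<times> nat list) set \<Rightarrow> nat list set sgrp" where
  "presented_sg k R =
     \<lparr>carrier = free_sg k // sg_cong k R,
      sg_mult = (\<lambda>A B. \<Union>u\<in>A. \<Union>v\<in>B. sg_cong k R `` {u @ v})\<rparr>"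

definition finitely_presented :: "'a sgrp \<Rightarrow> bool" where
  "finitely_presented H \<longleftrightarrow>
     (\<exists>k R. 1 \<le> k \<and> finite R \<and> R \<subseteq> free_sg k \<times> free_sg k \<and> sg_isomorphic H (presented_sg k R))"


section \<open>Recursively enumerable sets of pairs of words\<close>

text \<open>Partial recursive functions of arbitrary arity: \<open>rec_eval f xs y\<close> means that the function
  denoted by \<open>f\<close> is defined on \<open>xs\<close> with value \<open>y\<close>. Applied to an argument list of
  the wrong length, \<open>f\<close> may be undefined or ignore arguments; this does not affect the class of
  functions of a given arity that are denoted.\<close>

datatype recf = Zero | Succ | Proj nat | Comp recf "recf list" | PrimRec recf recf | Mu recf

inductive rec_eval :: "recf \<Rightarrow> nat list \<Rightarrow> nat \<Rightarrow> bool" where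
  "rec_eval Zero xs 0"
| "rec_eval Succ [x] (Suc x)"
| "i < length xs \<Longrightarrow> rec_eval (Proj i) xs (xs ! i)"
| "\<lbrakk>list_all2 (\<lambda>g y. rec_eval g xs y) gs ys; rec_eval f ys z\<rbrakk> \<Longrightarrow> rec_eval (Comp f gs) xs z"
| "rec_eval f xs y \<Longrightarrow> rec_eval (PrimRec f g) (0 # xs) y"
| "\<lbrakk>rec_eval (PrimRec f g) (n # xs) r; rec_eval g (n # r # xs) y\<rbrakk>
     \<Longrightarrow> rec_eval (PrimRec f g) (Suc n # xs) y"
| "\<lbrakk>rec_eval f (n # xs) 0; \<forall>i<n. \<exists>y. rec_eval f (i # xs) (Suc y)\<rbrakk> \<Longrightarrow> rec_eval (Mu f) xs n"

text \<open>A set is recursively enumerable if it is the domain of a partial recursive function; words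
  are numbered by the bijection \<^const>\<open>list_encode\<close>.\<close>

definition rec_enumerable :: "(nat list \<times> nat list) set \<Rightarrow> bool" where
  "rec_enumerable T \<longleftrightarrow>
     (\<exists>f. T = {(v, u). \<exists>y. rec_eval f [list_encode v, list_encode u] y})"


section \<open>Conditions on length functions\<close>

definition D1 :: "'a sgrp \<Rightarrow> ('a \<Rightarrow> nat) \<Rightarrow> bool" where
  "D1 S l \<longleftrightarrow> (\<forall>g\<in>carrier S. \<forall>h\<in>carrier S. l (g \<cdot>\<^bsub>S\<^esub> h) \<le> l g + l h)"

definition D2 :: "'a sgrp \<Rightarrow> ('a \<Rightarrow> nat) \<Rightarrow> bool" where
  "D2 S l \<longleftrightarrow> (\<exists>a::real. a > 0 \<and> (\<forall>r::nat. 1 \<le> r \<longrightarrow>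
     finite {g \<in> carrier S. l g \<le> r} \<and> real (card {g \<in> carrier S. l g \<le> r}) \<le> a ^ r))"

text \<open>In the third clause, the set of lengths is nonempty by the second clause (with
  \<open>v1 = v2 = v\<close>), so \<open>LEAST\<close> is the minimum.\<close>

definition D3 :: "'a sgrp \<Rightarrow> nat \<Rightarrow> (nat \<Rightarrow> 'a) \<Rightarrow> ('a \<Rightarrow> nat) \<Rightarrow> bool" where
  "D3 S m x l \<longleftrightarrow> (\<exists>n T. 1 \<le> n \<and> T \<subseteq> free_sg m \<times> free_sg n \<and> rec_enumerable T \<and>
     (\<forall>v1 v2 u. (v1, u) \<in> T \<and> (v2, u) \<in> T \<longrightarrow> proj S x v1 = proj S x v2) \<and>
     (\<forall>v1\<in>free_sg m. \<forall>v2\<in>free_sg m. proj S x v1 = proj S x v2 \<longrightarrow>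
        (\<exists>u. (v1, u) \<in> T \<and> (v2, u) \<in> T)) \<and>
     (\<forall>v\<in>free_sg m. l (proj S x v) = (LEAST k. \<exists>u. (v, u) \<in> T \<and> length u = k)))"

definition equivalent_on :: "'a set \<Rightarrow> ('a \<Rightarrow> nat) \<Rightarrow> ('a \<Rightarrow> nat) \<Rightarrow> bool" where
  "equivalent_on A l1 l2 \<longleftrightarrow> (\<exists>c1 c2 :: real. c1 > 0 \<and> c2 > 0 \<and>
     (\<forall>g\<in>A. c1 * real (l1 g) \<le> real (l2 g) \<and> real (l2 g) \<le> c2 * real (l1 g)))"

end

theory Submission
  imports Defs
begin

text \<open>The first half rests on the fact that the word problem of a finitely presented semigroup is
  recursively enumerable. For the converse, view the words \<open>u\<close> with \<open>(v, u) \<in> T\<close> as codes of the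
  element represented by \<open>v\<close>, and take a deterministic machine that halts on \<open>(v, u)\<close> iff
  \<open>(v, u) \<in> T\<close>. Besides the generators of \<open>S\<close>, the semigroup \<open>H\<close> has letters for blocks that carry a
  configuration of this machine, with \<open>v\<close> and \<open>u\<close> written on its tape. The relations let a word
  \<open>v\<close> be replaced by a block with tape \<open>v\<close>, let the block guess \<open>u\<close> and run the machine, and, once
  it has halted, erase \<open>v\<close>. What remains is a block of length \<open>|u| + const\<close> that depends on \<open>u\<close>
  alone, so the word equals all words with the code \<open>u\<close>.

  Relations can be applied in both directions, and to configurations that never arise in an honest
  run. Soundness comes from an invariant: a block has as value the element coded by \<open>u\<close> if the machine
  halts from the present configuration, and the element represented by \<open>v\<close> otherwise. Because the
  machine is deterministic, every relation preserves values. Hence \<open>S\<close> embeds; and since \<open>v\<close>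
  and \<open>u\<close> stay on the tape throughout, no block is much shorter than the length of its value.\<close>

section \<open>Word products and presented semigroups\<close>

text \<open>A length in \<open>H\<close> depends only on the endpoints of derivations, so the run
  may take any time and space: huge intermediate blocks are harmless, and unary registers cost
  nothing once they have been cleared. The real danger is a short detour, a small block with a long
  value. For this reason the machine shifts its cursor but never writes on its tape, and
  \<open>v\<close> is erased only in the halted state, where the value is read off \<open>u\<close>
  and clause (3) of (D3) bounds its length by \<open>|u|\<close>.

  The other danger is a wrong guess of \<open>u\<close>. It leads to a run that never halts, whose
  configurations keep the value of \<open>v\<close>; a right guess leads to one that halts, and then
  clause (1) makes both candidates for the value equal. Semi-decidability of \<open>T\<close> thus
  suffices: no relation has to know whether a configuration halts, the answer only has to be the
  same on both of its sides.\<close>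

lemma words_iff: "w \<in> words X \<longleftrightarrow> w \<noteq> [] \<and> set w \<subseteq> X"
  by (auto simp: words_def)

lemma words_append: "u \<in> words X \<Longrightarrow> v \<in> words X \<Longrightarrow> u @ v \<in> words X"
  by (simp add: words_iff)

lemma concat_in_words: "ws \<noteq> [] \<Longrightarrow> set ws \<subseteq> words X \<Longrightarrow> concat ws \<in> words X"
  by (induction ws) (fastforce simp: words_iff)+

lemma words_mono: "X \<subseteq> Y \<Longrightarrow> words X \<subseteq> words Y"
  by (auto simp: words_def lists_mono[THEN subsetD])

lemma word_prod_singleton [simp]: "word_prod S [x] = x"
  by (simp add: word_prod_def)

lemma proj_singleton [simp]: "proj S x [i] = x i"
  by (simp add: proj_def)

lemma word_prod_carrier_update [simp]: "word_prod (S\<lparr>carrier := A\<rparr>) = word_prod S"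
  by (simp add: word_prod_def fun_eq_iff)

lemma proj_carrier_update [simp]: "proj (S\<lparr>carrier := A\<rparr>) = proj S"
  by (simp add: proj_def fun_eq_iff)

context sgrp
begin

text \<open>\<open>word_prod\<close> folds from the left, so splitting off the first letter takes
  associativity; afterwards inductions can run over \<open>Cons\<close>.\<close>

lemma foldl_mult_left:
  "\<lbrakk>x \<in> carrier S; y \<in> carrier S; set w \<subseteq> carrier S\<rbrakk>
    \<Longrightarrow> foldl (\<cdot>) (x \<cdot> y) w = x \<cdot> foldl (\<cdot>) y w"
  by (induction w arbitrary: y) (auto simp: assoc closed)

lemma word_prod_Cons:
  assumes "x \<in> carrier S" "w \<in> words (carrier S)"
  shows "word_prod S (x # w) = x \<cdot> word_prod S w"
proof (cases w)
  case (Cons y w')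
  then show ?thesis
    using assms foldl_mult_left[of x y w'] by (simp add: word_prod_def words_iff)
qed (use assms in \<open>simp add: words_iff\<close>)

lemma word_prod_closed: "w \<in> words (carrier S) \<Longrightarrow> word_prod S w \<in> carrier S"
proof (induction w)
  case (Cons x w)
  then show ?case
    by (cases "w = []") (auto simp: word_prod_Cons words_iff closed)
qed (simp add: words_iff)

lemma word_prod_append:
  "\<lbrakk>u \<in> words (carrier S); v \<in> words (carrier S)\<rbrakk>
    \<Longrightarrow> word_prod S (u @ v) = word_prod S u \<cdot> word_prod S v"
proof (induction u)
  case (Cons x u)
  show ?case
  proof (cases "u = []")
    case True
    then show ?thesis using Cons.prems by (simp add: word_prod_Cons words_iff)
  next
    case False
    then have "u \<in> words (carrier S)" "x \<in> carrier S" "u @ v \<in> words (carrier S)"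
      using Cons.prems by (auto simp: words_iff)
    then show ?thesis
      using Cons by (simp add: word_prod_Cons assoc word_prod_closed)
  qed
qed (simp add: words_iff)

lemma word_prod_concat:
  assumes "ws \<noteq> []" "set ws \<subseteq> words (carrier S)"
  shows "word_prod S (concat ws) = word_prod S (map (word_prod S) ws)"
  using assms
proof (induction ws)
  case (Cons w ws)
  show ?case
  proof (cases "ws = []")
    case False
    then have "concat ws \<in> words (carrier S)"
      using Cons.prems by (intro concat_in_words) auto
    moreover have "map (word_prod S) ws \<in> words (carrier S)"
      using Cons.prems False word_prod_closed by (auto simp: words_iff[of "map (word_prod S) ws"])
    ultimately show ?thesis
      using Cons False by (simp add: word_prod_append word_prod_Cons word_prod_closed)
  qed simp
qed simp

lemma map_in_words: "x \<in> {..<m} \<rightarrow> carrier S \<Longrightarrow> v \<in> free_sg m \<Longrightarrow> map x v \<in> words (carrier S)"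
  by (auto simp: words_iff)

lemma proj_closed: "x \<in> {..<m} \<rightarrow> carrier S \<Longrightarrow> v \<in> free_sg m \<Longrightarrow> proj S x v \<in> carrier S"
  unfolding proj_def by (intro word_prod_closed map_in_words)

lemma proj_append:
  "\<lbrakk>x \<in> {..<m} \<rightarrow> carrier S; u \<in> free_sg m; v \<in> free_sg m\<rbrakk>
    \<Longrightarrow> proj S x (u @ v) = proj S x u \<cdot> proj S x v"
  unfolding proj_def by (simp add: word_prod_append map_in_words)

end

lemma hom_word_prod:
  assumes "sgrp S" "sgrp H" "\<phi> \<in> sg_hom S H" "w \<in> words (carrier S)"
  shows "\<phi> (word_prod S w) = word_prod H (map \<phi> w)"
  using assms(4)
proof (induction w)
  case (Cons x w)
  show ?case
  proof (cases "w = []")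
    case False
    then have w: "w \<in> words (carrier S)" "x \<in> carrier S" "map \<phi> w \<in> words (carrier H)" "\<phi> x \<in> carrier H"
      using Cons.prems assms(3) by (auto simp: words_iff sg_hom_def)
    then show ?thesis
      using assms(3) Cons.IH
      by (simp add: sgrp.word_prod_Cons[OF assms(1)] sgrp.word_prod_Cons[OF assms(2)]
          sgrp.word_prod_closed[OF assms(1)] sg_hom_def)
  qed simp
qed (simp add: words_iff)

lemma generating_set_cases:
  assumes "generating_set H X" "g \<in> carrier H"
  obtains w where "w \<in> words X" "word_prod H w = g" "length w = word_length H X g"
proof -
  obtain w where w: "w \<in> words X" "word_prod H w = g"
    using assms by (auto simp: generating_set_def)
  then have "\<exists>w'\<in>words X. word_prod H w' = g \<and> length w' = word_length H X g"
    unfolding word_length_def 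
    by (intro LeastI[of "\<lambda>k. \<exists>w'\<in>words X. word_prod H w' = g \<and> length w' = k" "length w"]) blast
  then show thesis using that by blast
qed

lemma word_length_le:
  "w \<in> words X \<Longrightarrow> word_length H X (word_prod H w) \<le> length w"
  unfolding word_length_def by (rule Least_le) blast

text \<open>Every letter is spelled by a shortest word over \<open>X\<close>. In this way lengths
  over two finite generating sets are compared up to a constant factor.\<close>

lemma word_length_word_prod_le:
  assumes "sgrp H" "generating_set H X" "w \<in> words (carrier H)"
    and "\<And>y. y \<in> set w \<Longrightarrow> word_length H X y \<le> M"
  shows "word_length H X (word_prod H w) \<le> M * length w"
proof -
  have "\<exists>u\<in>words X. word_prod H u = y \<and> length u = word_length H X y" if "y \<in> set w" for y
    using generating_set_cases[OF assms(2), of y] that assms(3) by (metis subsetD words_iff)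
  then obtain f where f: "\<And>y. y \<in> set w \<Longrightarrow> f y \<in> words X \<and> word_prod H (f y) = y \<and>
      length (f y) = word_length H X y"
    by metis
  have X: "words X \<subseteq> words (carrier H)"
    using assms(2) unfolding generating_set_def by (metis words_mono)
  have "word_prod H (concat (map f w)) = word_prod H (map (word_prod H) (map f w))"
    using assms(3) f X by (intro sgrp.word_prod_concat assms) (auto simp: words_iff[of w])
  also have "map (word_prod H) (map f w) = w"
    using f by (simp add: map_idI)
  finally have 1: "word_prod H (concat (map f w)) = word_prod H w" .
  have "w \<noteq> []" using assms(3) by (simp add: words_iff)
  then have "concat (map f w) \<in> words X"
    using f by (intro concat_in_words) auto
  from word_length_le[OF this, of H] 
  have "word_length H X (word_prod H w) \<le> length (concat (map f w))"
    by (simp add: 1)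
  also have "\<dots> = (\<Sum>y\<leftarrow>w. length (f y))"
    by (simp add: length_concat comp_def)
  also have "\<dots> \<le> (\<Sum>y\<leftarrow>w. M)"
    using f assms(4) by (intro sum_list_mono) metis
  finally show ?thesis by (simp add: sum_list_triv mult.commute)
qed

context
  fixes k :: nat and R :: "(nat list \<times> nat list) set"
  assumes R: "R \<subseteq> free_sg k \<times> free_sg k"
begin

lemma sg_cong_subset: "sg_cong k R \<subseteq> free_sg k \<times> free_sg k"
proof -
  have "u \<in> free_sg k \<and> v \<in> free_sg k" if "(u, v) \<in> sg_cong k R" for u v
    using that by induction (use R in \<open>auto simp: words_append\<close>)
  then show ?thesis by auto
qed

lemma equiv_sg_cong: "equiv (free_sg k) (sg_cong k R)"
  by (rule equivI)
    (use sg_cong_subset in \<open>auto intro!: refl_onI symI transI intro: sg_cong.intros\<close>)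

lemma presented_mult:
  assumes "u \<in> free_sg k" "v \<in> free_sg k"
  shows "sg_cong k R `` {u} \<cdot>\<^bsub>presented_sg k R\<^esub> sg_cong k R `` {v} = sg_cong k R `` {u @ v}"
proof -
  have "sg_cong k R `` {u' @ v'} = sg_cong k R `` {u @ v}"
    if "(u, u') \<in> sg_cong k R" "(v, v') \<in> sg_cong k R" for u' v'
    using equiv_class_eq[OF equiv_sg_cong sg_cong.mult[OF that]] by simp
  then show ?thesis
    using assms by (auto simp: presented_sg_def intro: sg_cong.refl)
qed

lemma carrier_presentedE:
  assumes "g \<in> carrier (presented_sg k R)"
  obtains u where "u \<in> free_sg k" "g = sg_cong k R `` {u}"
  using assms by (auto simp: presented_sg_def elim: quotientE)

lemma class_in_presented: "u \<in> free_sg k \<Longrightarrow> sg_cong k R `` {u} \<in> carrier (presented_sg k R)"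
  by (auto simp: presented_sg_def intro: quotientI)

lemma class_eq_iff:
  "\<lbrakk>u \<in> free_sg k; v \<in> free_sg k\<rbrakk> \<Longrightarrow> sg_cong k R `` {u} = sg_cong k R `` {v} \<longleftrightarrow> (u, v) \<in> sg_cong k R"
  using eq_equiv_class_iff[OF equiv_sg_cong] by simp

lemma sgrp_presented: "1 \<le> k \<Longrightarrow> sgrp (presented_sg k R)"
proof
  assume "1 \<le> k"
  then have "[0] \<in> free_sg k" by (simp add: words_iff)
  then show "carrier (presented_sg k R) \<noteq> {}"
    using class_in_presented by blast
qed (auto elim!: carrier_presentedE simp: presented_mult words_append class_in_presented)

text \<open>Stated for classes of words and not only of letters, because an arbitrary generating set
  of the presented semigroup consists of such classes.\<close>

lemma word_prod_classes:
  assumes "1 \<le> k" "ws \<noteq> []" "set ws \<subseteq> free_sg k"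
  shows "word_prod (presented_sg k R) (map (\<lambda>w. sg_cong k R `` {w}) ws) = sg_cong k R `` {concat ws}"
  using assms(2,3)
proof (induction ws)
  case (Cons w ws)
  show ?case
  proof (cases "ws = []")
    case False
    have "concat ws \<in> free_sg k"
      using False Cons.prems by (intro concat_in_words) auto
    moreover have "map (\<lambda>w. sg_cong k R `` {w}) ws \<in> words (carrier (presented_sg k R))"
      using Cons.prems False class_in_presented by (auto simp: words_iff[of "map _ _"])
    ultimately show ?thesis
      using Cons False
      by (simp add: sgrp.word_prod_Cons[OF sgrp_presented[OF assms(1)]] class_in_presented presented_mult)
  qed simp
qed simp

lemma word_prod_class_letters:
  assumes "1 \<le> k" "w \<in> free_sg k"
  shows "word_prod (presented_sg k R) (map (\<lambda>i. sg_cong k R `` {[i]}) w) = sg_cong k R `` {w}"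
proof -
  have "set (map (\<lambda>i. [i]) w) \<subseteq> free_sg k" "concat (map (\<lambda>i. [i]) w) = w"
    using assms(2) by (auto simp: words_iff)
  with word_prod_classes[OF assms(1), of "map (\<lambda>i. [i]) w"] assms(2) show ?thesis
    by (simp add: comp_def words_iff[of w])
qed

lemma finitely_presented_presented:
  "1 \<le> k \<Longrightarrow> finite R \<Longrightarrow> finitely_presented (presented_sg k R)"
proof -
  assume k: "1 \<le> k" and "finite R"
  have "(\<lambda>x. x) \<in> sg_hom (presented_sg k R) (presented_sg k R)"
    by (simp add: sg_hom_def)
  moreover have "bij_betw (\<lambda>x. x) (carrier (presented_sg k R)) (carrier (presented_sg k R))"
    by (simp add: bij_betw_def)
  ultimately show ?thesis
    unfolding finitely_presented_def sg_isomorphic_def using R k \<open>finite R\<close> by blast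
qed

end

section \<open>Total recursive functions\<close>

inductive_cases rec_eval_ZeroE: "rec_eval Zero xs y"
inductive_cases rec_eval_SuccE: "rec_eval Succ xs y"
inductive_cases rec_eval_ProjE: "rec_eval (Proj i) xs y"
inductive_cases rec_eval_CompE: "rec_eval (Comp f gs) xs y"
inductive_cases rec_eval_PrimRecE: "rec_eval (PrimRec f g) xs y"
inductive_cases rec_eval_PrimRec0E: "rec_eval (PrimRec f g) (0 # xs) y"
inductive_cases rec_eval_PrimRecSucE: "rec_eval (PrimRec f g) (Suc n # xs) y"
inductive_cases rec_eval_MuE: "rec_eval (Mu f) xs y"

lemma rec_eval_det: "rec_eval f xs y \<Longrightarrow> rec_eval f xs z \<Longrightarrow> z = y"
proof (induction arbitrary: z rule: rec_eval.induct)
  case (4 xs gs ys f y)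
  from \<open>rec_eval (Comp f gs) xs z\<close> obtain zs where
    zs: "list_all2 (\<lambda>g y. rec_eval g xs y) gs zs" "rec_eval f zs z"
    by (elim rec_eval_CompE)
  have "zs = ys"
  proof (rule nth_equalityI)
    show "length zs = length ys"
      using zs(1) 4 by (auto simp: list_all2_conv_all_nth)
    show "zs ! i = ys ! i" if "i < length zs" for i
      using that zs(1) 4 by (auto simp: list_all2_conv_all_nth)
  qed
  then show ?case using zs 4 by blast
next
  case (7 f n xs)
  from \<open>rec_eval (Mu f) xs z\<close> have z: "rec_eval f (z # xs) 0" "\<forall>i<z. \<exists>y. rec_eval f (i # xs) (Suc y)"
    by (auto elim: rec_eval_MuE)
  show ?case
  proof (cases z n rule: linorder_cases)
    case less
    with 7 z(1) show ?thesis by fastforce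
  next
    case greater
    with 7 z(2) show ?thesis by (metis Zero_not_Suc)
  qed
next
  case (6 f g n xs r y)
  from \<open>rec_eval (PrimRec f g) (Suc n # xs) z\<close> obtain r' where
    "rec_eval (PrimRec f g) (n # xs) r'" "rec_eval g (n # r' # xs) z"
    by (elim rec_eval_PrimRecSucE)
  then show ?case using 6 by metis
next
  case (5 f xs y g)
  then show ?case by (metis rec_eval_PrimRec0E)
qed (auto elim!: rec_eval_ZeroE rec_eval_SuccE rec_eval_ProjE)

text \<open>With total functions only, composition and recursion carry no domain conditions, and
  recursiveness is proved by following the shape of a term with \<open>rep_intros\<close>.\<close>

definition rep :: "nat \<Rightarrow> (nat list \<Rightarrow> nat) \<Rightarrow> bool" where
  "rep n F \<longleftrightarrow> (\<exists>f. \<forall>xs. length xs = n \<longrightarrow> rec_eval f xs (F xs))"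

definition rep1 :: "(nat \<Rightarrow> nat) \<Rightarrow> bool" where
  "rep1 F \<longleftrightarrow> (\<exists>f. \<forall>x. rec_eval f [x] (F x))"

definition rep2 :: "(nat \<Rightarrow> nat \<Rightarrow> nat) \<Rightarrow> bool" where
  "rep2 F \<longleftrightarrow> (\<exists>f. \<forall>x y. rec_eval f [x, y] (F x y))"

lemma rep1_iff: "rep1 F \<longleftrightarrow> rep 1 (\<lambda>xs. F (xs ! 0))"
proof -
  have "(\<forall>xs. length xs = 1 \<longrightarrow> rec_eval f xs (F (xs ! 0))) \<longleftrightarrow> (\<forall>x. rec_eval f [x] (F x))" for f
    by (force simp: length_Suc_conv)
  then show ?thesis by (simp add: rep1_def rep_def)
qed

lemma rep2_iff: "rep2 F \<longleftrightarrow> rep 2 (\<lambda>xs. F (xs ! 0) (xs ! 1))"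
proof -
  have "(\<forall>xs. length xs = 2 \<longrightarrow> rec_eval f xs (F (xs ! 0) (xs ! 1))) \<longleftrightarrow>
      (\<forall>x y. rec_eval f [x, y] (F x y))" for f
    by (force simp: length_Suc_conv numeral_2_eq_2)
  then show ?thesis by (simp add: rep2_def rep_def)
qed

named_theorems rep_intros

lemma rep_cong: "rep n F \<Longrightarrow> (\<And>xs. length xs = n \<Longrightarrow> F xs = G xs) \<Longrightarrow> rep n G"
  by (auto simp: rep_def)

lemma rep_nth [rep_intros]: "i < n \<Longrightarrow> rep n (\<lambda>xs. xs ! i)"
  unfolding rep_def by (metis rec_eval.intros(3))

lemma rep_comp:
  assumes "rep (length Gs) F" "\<And>G. G \<in> set Gs \<Longrightarrow> rep n G"
  shows "rep n (\<lambda>xs. F (map (\<lambda>G. G xs) Gs))"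
proof -
  obtain f where f: "\<And>ys. length ys = length Gs \<Longrightarrow> rec_eval f ys (F ys)"
    using assms(1) by (auto simp: rep_def)
  obtain g where g: "\<And>G xs. G \<in> set Gs \<Longrightarrow> length xs = n \<Longrightarrow> rec_eval (g G) xs (G xs)"
    using assms(2) unfolding rep_def by metis
  have "rec_eval (Comp f (map g Gs)) xs (F (map (\<lambda>G. G xs) Gs))" if "length xs = n" for xs
    using g that by (intro rec_eval.intros(4)[where ys = "map (\<lambda>G. G xs) Gs"] f)
      (auto simp: list_all2_conv_all_nth)
  then show ?thesis by (auto simp: rep_def)
qed

lemma rep_comp1: "rep1 F \<Longrightarrow> rep n G \<Longrightarrow> rep n (\<lambda>xs. F (G xs))"
  using rep_comp[of "[G]" "\<lambda>xs. F (xs ! 0)" n] by (simp add: rep1_iff)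

lemma rep_comp2: "rep2 F \<Longrightarrow> rep n G \<Longrightarrow> rep n H \<Longrightarrow> rep n (\<lambda>xs. F (G xs) (H xs))"
  using rep_comp[of "[G, H]" "\<lambda>xs. F (xs ! 0) (xs ! 1)" n] by (auto simp: rep2_iff numeral_2_eq_2)

text \<open>Weakening: in a primitive recursion the parameters reappear behind the counter and the
  previous value.\<close>

lemma rep_drop: "rep n F \<Longrightarrow> rep (k + n) (\<lambda>xs. F (drop k xs))"
  by (rule rep_cong[OF rep_comp[of "map (\<lambda>i xs. xs ! (k + i)) [0..<n]" F]])
    (auto intro!: rep_nth arg_cong[where f = F] nth_equalityI simp: comp_def)

lemma rep1_Suc: "rep1 Suc"
  by (auto simp: rep1_def intro: rec_eval.intros)

lemmas rep_Suc [rep_intros] = rep_comp1[OF rep1_Suc]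

lemma rep_const [rep_intros]: "rep n (\<lambda>_. c)"
proof (induction c)
  case 0
  then show ?case by (auto simp: rep_def intro: rec_eval.intros)
next
  case (Suc c)
  then show ?case by (rule rep_Suc)
qed

lemma rep_rec:
  assumes "rep n H" "rep n F" "rep (2 + n) (\<lambda>ys. G (ys ! 0) (ys ! 1) (drop 2 ys))"
  shows "rep n (\<lambda>xs. rec_nat (F xs) (\<lambda>i r. G i r xs) (H xs))"
proof -
  obtain f where f: "\<And>xs. length xs = n \<Longrightarrow> rec_eval f xs (F xs)"
    using assms(2) by (auto simp: rep_def)
  obtain g where g: "\<And>ys. length ys = 2 + n \<Longrightarrow> rec_eval g ys (G (ys ! 0) (ys ! 1) (drop 2 ys))"
    using assms(3) by (auto simp: rep_def)
  have "rec_eval (PrimRec f g) (h # xs) (rec_nat (F xs) (\<lambda>i r. G i r xs) h)" if "length xs = n" for h xs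
  proof (induction h)
    case (Suc h)
    show ?case
      using g[of "h # rec_nat (F xs) (\<lambda>i r. G i r xs) h # xs"] that
      by (auto intro: rec_eval.intros(6)[OF Suc])
  qed (use f that in \<open>auto intro: rec_eval.intros\<close>)
  then have "rep (Suc n) (\<lambda>ys. rec_nat (F (tl ys)) (\<lambda>i r. G i r (tl ys)) (hd ys))"
    unfolding rep_def by (intro exI[of _ "PrimRec f g"]) (auto simp: length_Suc_conv)
  then have "rep n (\<lambda>xs. (\<lambda>ys. rec_nat (F (tl ys)) (\<lambda>i r. G i r (tl ys)) (hd ys))
       (map (\<lambda>G. G xs) (H # map (\<lambda>i xs. xs ! i) [0..<n])))"
    using assms(1) by (intro rep_comp) (auto intro: rep_nth)
  moreover have "map (\<lambda>i. xs ! i) [0..<n] = xs" if "length xs = n" for xs :: "nat list"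
    using that map_nth by blast
  ultimately show ?thesis
    by (elim rep_cong) (simp add: comp_def)
qed

lemma rep2_rec1:
  assumes "rep n H" "rep n F" "rep2 G"
  shows "rep n (\<lambda>xs. rec_nat (F xs) G (H xs))"
  by (rule rep_rec[OF assms(1,2)]) (intro rep_comp2[OF assms(3)] rep_nth; simp)

lemma rep1_pred: "rep1 (\<lambda>x. x - 1)"
proof -
  have "rep1 (\<lambda>x. rec_nat 0 (\<lambda>i r. i) x)"
    unfolding rep1_iff rep2_iff by (intro rep2_rec1) (auto simp: rep2_iff intro!: rep_intros)
  moreover have "rec_nat 0 (\<lambda>i r. i) x = x - 1" for x :: nat
    by (cases x) auto
  ultimately show ?thesis by simp
qed

lemma rep2_add: "rep2 (\<lambda>x y. x + y)"
proof -
  have "rep2 (\<lambda>x y. rec_nat y (\<lambda>i r. Suc r) x)"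
    unfolding rep2_iff by (intro rep2_rec1) (auto simp: rep2_iff intro!: rep_intros)
  moreover have "rec_nat y (\<lambda>i r. Suc r) x = x + y" for x y :: nat
    by (induction x) auto
  ultimately show ?thesis by simp
qed

lemma rep2_diff: "rep2 (\<lambda>x y. x - y)"
proof -
  have "rep2 (\<lambda>x y. rec_nat x (\<lambda>i r. r - 1) y)"
    unfolding rep2_iff by (intro rep2_rec1)
      (auto simp: rep2_iff simp del: One_nat_def intro!: rep_intros rep_comp1[OF rep1_pred])
  moreover have "rec_nat x (\<lambda>i r. r - 1) y = x - y" for x y :: nat
    by (induction y) auto
  ultimately show ?thesis by simp
qed

lemmas [rep_intros] = rep_comp2[OF rep2_add] rep_comp2[OF rep2_diff]

text \<open>With truncated subtraction, \<open>(F - G) + (G - F)\<close> vanishes exactly for equal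
  arguments, and a recursion whose step ignores the counter and the previous value tells zero from a
  successor.\<close>

lemma rep_if_eq [rep_intros]:
  assumes "rep n F" "rep n G" "rep n A" "rep n B"
  shows "rep n (\<lambda>xs. if F xs = G xs then A xs else B xs)"
proof -
  have "rep n (\<lambda>xs. rec_nat (A xs) (\<lambda>i r. B xs) ((F xs - G xs) + (G xs - F xs)))"
    using rep_drop[OF assms(4), of 2] by (intro rep_rec[where G = "\<lambda>_ _. B"] rep_intros assms)
  moreover have "rec_nat (A xs) (\<lambda>i r. B xs) ((F xs - G xs) + (G xs - F xs)) =
      (if F xs = G xs then A xs else B xs)" for xs
  proof (cases "F xs = G xs")
    case False
    then obtain k where "(F xs - G xs) + (G xs - F xs) = Suc k"
      by (metis add_is_0 diffs0_imp_equal not0_implies_Suc)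
    with False show ?thesis by simp
  qed simp
  ultimately show ?thesis by simp
qed

lemma rep1_triangle: "rep1 triangle"
proof -
  have "rep1 (\<lambda>x. rec_nat 0 (\<lambda>i r. r + Suc i) x)"
    unfolding rep1_iff by (intro rep2_rec1) (auto simp: rep2_iff simp del: add_Suc_right intro!: rep_intros)
  moreover have "rec_nat 0 (\<lambda>i r. r + Suc i) x = triangle x" for x :: nat
    by (induction x) auto
  ultimately show ?thesis by simp
qed

lemma rep_Least:
  assumes "rep (Suc n) F" "\<And>xs. length xs = n \<Longrightarrow> \<exists>k. F (k # xs) = 0"
  shows "rep n (\<lambda>xs. LEAST k. F (k # xs) = 0)"
proof -
  obtain f where f: "\<And>ys. length ys = Suc n \<Longrightarrow> rec_eval f ys (F ys)"
    using assms(1) by (auto simp: rep_def)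
  have "rec_eval (Mu f) xs (LEAST k. F (k # xs) = 0)" if "length xs = n" for xs
  proof (rule rec_eval.intros(7))
    show "rec_eval f ((LEAST k. F (k # xs) = 0) # xs) 0"
      using f[of "(LEAST k. F (k # xs) = 0) # xs"] LeastI_ex[OF assms(2)[OF that]] that by simp
    show "\<forall>i<LEAST k. F (k # xs) = 0. \<exists>y. rec_eval f (i # xs) (Suc y)"
    proof (intro allI impI)
      fix i assume "i < (LEAST k. F (k # xs) = 0)"
      then have "F (i # xs) \<noteq> 0" by (rule not_less_Least)
      with f[of "i # xs"] that show "\<exists>y. rec_eval f (i # xs) (Suc y)"
        by (metis length_Cons not0_implies_Suc)
    qed
  qed
  then show ?thesis by (auto simp: rep_def)
qed

lemma rep2_prod_encode: "rep2 (\<lambda>x y. prod_encode (x, y))"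
  unfolding rep2_iff prod_encode_def by (auto intro!: rep_intros rep_comp1[OF rep1_triangle])

lemmas [rep_intros] = rep_comp1[OF rep1_triangle] rep_comp2[OF rep2_prod_encode]

lemma triangle_mono: "i \<le> j \<Longrightarrow> triangle i \<le> triangle j"
  by (induction rule: dec_induct) auto

text \<open>\<open>prod_encode (x, y)\<close> is \<open>triangle (x + y) + x\<close> and lies below
  \<open>triangle (x + y + 1)\<close>, so a search for the next triangular number finds the diagonal
  \<open>x + y\<close>. This is what inverts the pairing.\<close>

lemma prod_encode_sum_eq_Least:
  "(LEAST k. Suc (prod_encode (x, y)) - triangle (Suc k) = 0) = x + y"
proof (rule Least_equality)
  fix k assume k: "Suc (prod_encode (x, y)) - triangle (Suc k) = 0"
  show "x + y \<le> k"
  proof (rule ccontr)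
    assume "\<not> x + y \<le> k"
    then have "triangle (Suc k) \<le> triangle (x + y)" by (intro triangle_mono) simp
    with k show False by (simp add: prod_encode_def)
  qed
qed (simp add: prod_encode_def)

lemma rep1_sum_prod_decode: "rep1 (\<lambda>z. fst (prod_decode z) + snd (prod_decode z))"
proof -
  have eq: "(LEAST k. Suc z - triangle (Suc k) = 0) = fst (prod_decode z) + snd (prod_decode z)" for z
    using prod_encode_sum_eq_Least[of "fst (prod_decode z)" "snd (prod_decode z)"] by simp
  have "rep 1 (\<lambda>xs. LEAST k. (\<lambda>ys. Suc (ys ! 1) - triangle (Suc (ys ! 0))) (k # xs) = 0)"
  proof (rule rep_Least)
    show "\<exists>k. Suc ((k # xs) ! 1) - triangle (Suc ((k # xs) ! 0)) = 0" for xs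
      by (rule exI[of _ "xs ! 0"]) simp
  qed (auto simp del: diff_Suc_Suc triangle_Suc intro!: rep_intros)
  then show ?thesis unfolding rep1_iff using eq by simp
qed

lemma rep1_fst_prod_decode: "rep1 (\<lambda>z. fst (prod_decode z))"
proof -
  have "rep1 (\<lambda>z. z - triangle (fst (prod_decode z) + snd (prod_decode z)))"
    unfolding rep1_iff by (intro rep_intros rep_comp1[OF rep1_sum_prod_decode]) auto
  moreover have "z - triangle (fst (prod_decode z) + snd (prod_decode z)) = fst (prod_decode z)" for z
    using fun_cong[OF prod_encode_def, of "prod_decode z"] by (simp add: case_prod_beta)
  ultimately show ?thesis by simp
qed

lemma rep1_snd_prod_decode: "rep1 (\<lambda>z. snd (prod_decode z))"
proof -
  have "rep1 (\<lambda>z. fst (prod_decode z) + snd (prod_decode z) - fst (prod_decode z))"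
    unfolding rep1_iff 
    by (intro rep_comp2[OF rep2_diff] rep_intros rep_comp1[OF rep1_sum_prod_decode] rep_comp1[OF rep1_fst_prod_decode]) auto
  then show ?thesis by simp
qed

lemmas [rep_intros] = rep_comp1[OF rep1_fst_prod_decode] rep_comp1[OF rep1_snd_prod_decode]

lemma rep2_funpow:
  assumes "rep1 h"
  shows "rep2 (\<lambda>n x. (h ^^ n) x)"
proof -
  have "rep2 (\<lambda>n x. rec_nat x (\<lambda>i r. h r) n)"
    unfolding rep2_iff by (intro rep2_rec1) (auto simp: rep2_iff intro!: rep_intros rep_comp1[OF assms])
  moreover have "rec_nat x (\<lambda>i r. h r) n = (h ^^ n) x" for n x
    by (induction n) auto
  ultimately show ?thesis by simp
qed

section \<open>Recursion over coded lists\<close>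

lemma length_le_list_encode: "length xs \<le> list_encode xs"
proof (induction xs)
  case (Cons x xs)
  then show ?case using le_prod_encode_2[of "list_encode xs" x] by simp
qed simp

text \<open>The list is traversed by iterating a function on pairs consisting of the accumulator and
  the remaining list; the code of a list bounds its length.\<close>

lemma rep2_foldl:
  assumes "rep2 g"
  shows "rep2 (\<lambda>a c. foldl g a (list_decode c))"
proof -
  define h where "h p = (if snd (prod_decode p) = 0 then p else
     prod_encode (g (fst (prod_decode p)) (fst (prod_decode (snd (prod_decode p) - 1))),
       snd (prod_decode (snd (prod_decode p) - 1))))" for p
  have "rep1 h"
    unfolding rep1_iff h_def by (intro rep_intros rep_comp2[OF assms]) auto
  then have "rep2 (\<lambda>a c. fst (prod_decode ((h ^^ c) (prod_encode (a, c)))))"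
    unfolding rep2_iff by (intro rep_intros rep_comp2[OF rep2_funpow]) auto
  moreover have "(h ^^ n) (prod_encode (a, list_encode xs)) = prod_encode (foldl g a xs, 0)"
    if "length xs \<le> n" for n a xs
    using that
  proof (induction n arbitrary: a xs)
    case (Suc n)
    have "(h ^^ Suc n) (prod_encode (a, list_encode xs)) =
        (h ^^ n) (h (prod_encode (a, list_encode xs)))"
      by (simp add: funpow_swap1)
    also have "\<dots> = prod_encode (foldl g a xs, 0)"
    proof (cases xs)
      case Nil
      moreover have "h (prod_encode (a, 0)) = prod_encode (a, 0)" by (simp add: h_def)
      ultimately show ?thesis using Suc.IH[of "[]" a] by simp
    next
      case (Cons x ys)
      then have "h (prod_encode (a, list_encode xs)) = prod_encode (g a x, list_encode ys)"
        by (simp add: h_def)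
      then show ?thesis using Suc.prems Suc.IH[of ys "g a x"] Cons by simp
    qed
    finally show ?case .
  qed simp
  then have "(h ^^ c) (prod_encode (a, c)) = prod_encode (foldl g a (list_decode c), 0)" for a c
    using length_le_list_encode[of "list_decode c"] by (metis list_decode_inverse)
  ultimately show ?thesis by simp
qed

text \<open>The finitely many values may be arbitrary; they will be the words chosen for generators
  and the sides of the relators.\<close>

lemma rep1_finite_table: "rep1 (\<lambda>i. if i < N then f i else c)"
proof (induction N)
  case 0
  then show ?case unfolding rep1_iff by (auto intro: rep_intros)
next
  case (Suc N)
  have "rep1 (\<lambda>i. if i = N then f N else if i < N then f i else c)"
    unfolding rep1_iff by (intro rep_intros rep_comp1[OF Suc]) auto
  moreover have "(if i = N then f N else if i < N then f i else c) = (if i < Suc N then f i else c)" for i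
    by auto
  ultimately show ?case by simp
qed

text \<open>Prepending letters while folding from the left reverses a list; \<open>app_code\<close>
  therefore reverses its first argument beforehand.\<close>

definition rev_code :: "nat \<Rightarrow> nat" where
  "rev_code c = foldl (\<lambda>a x. Suc (prod_encode (x, a))) 0 (list_decode c)"

definition app_code :: "nat \<Rightarrow> nat \<Rightarrow> nat" where
  "app_code c d = foldl (\<lambda>a x. Suc (prod_encode (x, a))) d (list_decode (rev_code c))"

definition concat_code :: "(nat \<Rightarrow> nat) \<Rightarrow> nat \<Rightarrow> nat" where
  "concat_code f c = foldl (\<lambda>a x. app_code a (f x)) 0 (list_decode c)"

lemma foldl_Cons_code: 
  "foldl (\<lambda>a x. Suc (prod_encode (x, a))) (list_encode ys) xs = list_encode (rev xs @ ys)"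
  by (induction xs arbitrary: ys) (simp_all flip: list_encode.simps(2))

lemma rev_code: "rev_code (list_encode xs) = list_encode (rev xs)"
  using foldl_Cons_code[of "[]" xs] by (simp add: rev_code_def)

lemma app_code [simp]: "app_code (list_encode xs) (list_encode ys) = list_encode (xs @ ys)"
  by (simp add: app_code_def rev_code foldl_Cons_code)

lemma concat_code:
  "(\<And>x. x \<in> set xs \<Longrightarrow> f x = list_encode (g x)) \<Longrightarrow>
    concat_code f (list_encode xs) = list_encode (concat (map g xs))"
proof -
  have "foldl (\<lambda>a x. app_code a (f x)) (list_encode ys) xs = list_encode (ys @ concat (map g xs))"
    if "\<And>x. x \<in> set xs \<Longrightarrow> f x = list_encode (g x)" for ys
    using that by (induction xs arbitrary: ys) auto
  from this[of "[]"] show "(\<And>x. x \<in> set xs \<Longrightarrow> f x = list_encode (g x)) \<Longrightarrow>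
    concat_code f (list_encode xs) = list_encode (concat (map g xs))"
    by (simp add: concat_code_def)
qed

lemma rep2_Cons_code: "rep2 (\<lambda>a x. Suc (prod_encode (x, a)))"
  unfolding rep2_iff by (intro rep_intros) auto

lemma rep1_rev_code: "rep1 rev_code"
  unfolding rep1_iff rev_code_def by (intro rep_intros rep_comp2[OF rep2_foldl[OF rep2_Cons_code]]) auto

lemma rep2_app_code: "rep2 app_code"
  unfolding rep2_iff app_code_def
  by (intro rep_intros rep_comp2[OF rep2_foldl[OF rep2_Cons_code]] rep_comp1[OF rep1_rev_code]) auto

lemmas [rep_intros] = rep_comp2[OF rep2_app_code]

lemma rep1_concat_code:
  assumes "rep1 f"
  shows "rep1 (concat_code f)"
proof -
  have "rep2 (\<lambda>a x. app_code a (f x))"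
    unfolding rep2_iff by (intro rep_intros rep_comp1[OF assms]) auto
  then show ?thesis
    unfolding rep1_iff concat_code_def by (intro rep_intros rep_comp2[OF rep2_foldl]) auto
qed

text \<open>The start value \<open>1 - c\<close> is positive only for 0, the code of the empty word,
  and \<open>Suc x - m\<close> only for letters outside the alphabet.\<close>

definition bad_letters :: "nat \<Rightarrow> nat \<Rightarrow> nat" where
  "bad_letters m c = foldl (\<lambda>a x. a + (Suc x - m)) (1 - c) (list_decode c)"

lemma bad_letters: "bad_letters m (list_encode w) = 0 \<longleftrightarrow> w \<in> words {..<m}"
proof -
  have "foldl (\<lambda>a x. a + (Suc x - m)) a w = 0 \<longleftrightarrow> a = 0 \<and> set w \<subseteq> {..<m}" for a
    by (induction w arbitrary: a) auto
  then have "bad_letters m (list_encode w) = 0 \<longleftrightarrow> 1 - list_encode w = 0 \<and> set w \<subseteq> {..<m}"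
    unfolding bad_letters_def list_encode_inverse by blast
  also have "1 - list_encode w = 0 \<longleftrightarrow> w \<noteq> []" by (cases w) auto
  finally show ?thesis unfolding words_iff .
qed

lemma rep1_bad_letters: "rep1 (bad_letters m)"
proof -
  have "rep2 (\<lambda>a x. a + (Suc x - m))"
    unfolding rep2_iff by (intro rep_intros) auto
  then show ?thesis
    unfolding rep1_iff bad_letters_def by (intro rep_intros rep_comp2[OF rep2_foldl]) auto
qed

text \<open>Unbounded search turns the existential quantifier into a domain of definition. As
  \<open>F\<close> is total, the search cannot get stuck before the first zero.\<close>

lemma rec_enumerable_projection:
  assumes "rep 3 (\<lambda>xs. F (xs ! 0) (xs ! 1) (xs ! 2))"
  shows "rec_enumerable {(v, u). \<exists>d. F d (list_encode v) (list_encode u) = 0}"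
proof -
  obtain f where f: "\<And>xs. length xs = 3 \<Longrightarrow> rec_eval f xs (F (xs ! 0) (xs ! 1) (xs ! 2))"
    using assms by (auto simp: rep_def)
  have f': "rec_eval f [d, a, b] y \<longleftrightarrow> y = F d a b" for d a b y
    using f[of "[d, a, b]"] rec_eval_det[of f "[d, a, b]"] by fastforce
  have "(\<exists>y. rec_eval (Mu f) [a, b] y) \<longleftrightarrow> (\<exists>d. F d a b = 0)" for a b
  proof
    assume "\<exists>d. F d a b = 0"
    then have "F (LEAST d. F d a b = 0) a b = 0" by (rule LeastI_ex)
    moreover have "\<exists>y. Suc y = F i a b" if "i < (LEAST d. F d a b = 0)" for i
      using not_less_Least[OF that] by (metis not0_implies_Suc)
    ultimately have "rec_eval (Mu f) [a, b] (LEAST d. F d a b = 0)"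
      by (intro rec_eval.intros(7)) (auto simp: f')
    then show "\<exists>y. rec_eval (Mu f) [a, b] y" ..
  next
    assume "\<exists>y. rec_eval (Mu f) [a, b] y"
    then obtain y where "rec_eval f [y, a, b] 0" by (auto elim: rec_eval_MuE)
    then show "\<exists>d. F d a b = 0" unfolding f' by metis
  qed
  then show ?thesis
    unfolding rec_enumerable_def by (intro exI[of _ "Mu f"]) auto
qed

section \<open>A machine for partial recursive functions\<close>

text \<open>A while language over counters. The only action on the tape is \<open>Rd\<close>, which
  shifts a letter across the cursor; nothing is ever written.\<close>

datatype ins = Inc nat | Dec nat | Rd nat | Loop nat "ins list"

type_synonym store = "(nat list \<times> nat list) \<times> (nat \<Rightarrow> nat)"

text \<open>\<open>Rd\<close> queues increments instead of adding the letter at once, so that a step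
  changes a configuration in one place only and can become a relation between short words. The empty
  program is a fixed point, which allows runs of different length to be compared.\<close>

fun step :: "ins list \<times> store \<Rightarrow> ins list \<times> store" where
  "step ([], s) = ([], s)"
| "step (Inc i # k, t, r) = (k, t, r(i := Suc (r i)))"
| "step (Dec i # k, t, r) = (k, t, r(i := r i - 1))"
| "step (Rd i # k, (t1, t2), r) =
     (if t1 = [] then (k, (t1, t2), r)
      else (replicate (last t1) (Inc i) @ k, (butlast t1, last t1 # t2), r))"
| "step (Loop i b # k, t, r) = (if r i = 0 then k else b @ Loop i b # k, t, r)"

definition exec :: "ins list \<Rightarrow> store \<Rightarrow> store \<Rightarrow> bool" where
  "exec p s s' \<longleftrightarrow> (\<exists>n. (step ^^ n) (p, s) = ([], s'))"

definition halts :: "ins list \<times> store \<Rightarrow> bool" where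
  "halts c \<longleftrightarrow> (\<exists>s'. exec (fst c) (snd c) s')"

lemma funpow_step_Nil [simp]: "(step ^^ n) ([], s) = ([], s)"
  by (induction n) auto

lemma exec_Nil [simp]: "exec [] s s' \<longleftrightarrow> s' = s"
  by (auto simp: exec_def)

lemma exec_step: "exec p s s' \<longleftrightarrow> exec (fst (step (p, s))) (snd (step (p, s))) s'"
proof -
  have *: "(step ^^ n) (step c) = step ((step ^^ n) c)" for n c
    by (simp add: funpow_swap1)
  show ?thesis
  proof
    assume "exec p s s'"
    then obtain n where "(step ^^ n) (p, s) = ([], s')" by (auto simp: exec_def)
    then have "(step ^^ n) (step (p, s)) = ([], s')" by (simp add: *)
    then show "exec (fst (step (p, s))) (snd (step (p, s))) s'"
      unfolding exec_def prod.collapse ..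
  next
    assume "exec (fst (step (p, s))) (snd (step (p, s))) s'"
    then obtain n where "(step ^^ n) (step (p, s)) = ([], s')"
      unfolding exec_def prod.collapse ..
    then have "(step ^^ Suc n) (p, s) = ([], s')" by (simp add: *)
    then show "exec p s s'" unfolding exec_def ..
  qed
qed

lemma exec_det: "exec p s s1 \<Longrightarrow> exec p s s2 \<Longrightarrow> s1 = s2"
proof -
  assume "exec p s s1" "exec p s s2"
  then obtain m n where "(step ^^ m) (p, s) = ([], s1)" "(step ^^ n) (p, s) = ([], s2)"
    by (auto simp: exec_def)
  then have "(step ^^ (n + m)) (p, s) = ([], s1)" "(step ^^ (m + n)) (p, s) = ([], s2)"
    by (simp_all add: funpow_add)
  then show ?thesis by (simp add: add.commute)
qed

lemma halts_step: "halts (step c) = halts c"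
  unfolding halts_def using exec_step[of "fst c" "snd c"] by simp

lemma step_append: "p \<noteq> [] \<Longrightarrow> step (p @ q, s) = (fst (step (p, s)) @ q, snd (step (p, s)))"
  by (cases "(p, s)" rule: step.cases) auto

lemma funpow_step_appendI:
  "(step ^^ n) (p, s) = ([], s1) \<Longrightarrow> \<exists>m. (step ^^ m) (p @ q, s) = (q, s1)"
proof (induction n arbitrary: p s)
  case 0
  then show ?case by (auto intro: exI[of _ 0])
next
  case (Suc n)
  show ?case
  proof (cases "p = []")
    case True
    then show ?thesis using Suc.prems by (auto intro: exI[of _ 0])
  next
    case False
    obtain p' s' where p': "step (p, s) = (p', s')" by (metis surj_pair)
    with Suc.prems have "(step ^^ n) (p', s') = ([], s1)" by (simp add: funpow_swap1)
    from Suc.IH[OF this] obtain m where "(step ^^ m) (p' @ q, s') = (q, s1)" by blast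
    then have "(step ^^ Suc m) (p @ q, s) = (q, s1)"
      using False p' by (simp add: funpow_swap1 step_append)
    then show ?thesis by blast
  qed
qed

text \<open>The bound on the step counts feeds the strong induction over loop iterations in
  \<open>exec_Loop_invariant\<close>.\<close>

lemma funpow_step_appendD:
  "(step ^^ n) (p @ q, s) = ([], s') \<Longrightarrow>
    \<exists>m m' s1. (step ^^ m) (p, s) = ([], s1) \<and> (step ^^ m') (q, s1) = ([], s') \<and> m + m' \<le> n"
proof (induction n arbitrary: p s)
  case 0
  then show ?case by (auto intro: exI[of _ 0])
next
  case (Suc n)
  show ?case
  proof (cases "p = []")
    case True
    then show ?thesis using Suc.prems
      by (intro exI[of _ 0] exI[of _ "Suc n"] exI[of _ s]) auto
  next
    case False
    obtain p' s'' where p': "step (p, s) = (p', s'')" by (metis surj_pair)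
    with Suc.prems False have "(step ^^ n) (p' @ q, s'') = ([], s')"
      by (simp add: funpow_swap1 step_append)
    from Suc.IH[OF this] obtain m m' s1 where
      "(step ^^ m) (p', s'') = ([], s1)" "(step ^^ m') (q, s1) = ([], s')" "m + m' \<le> n" by blast
    then show ?thesis using p'
      by (intro exI[of _ "Suc m"] exI[of _ m'] exI[of _ s1]) (simp add: funpow_swap1)
  qed
qed

lemma exec_append: "exec (p @ q) s s' \<longleftrightarrow> (\<exists>s1. exec p s s1 \<and> exec q s1 s')"
proof
  assume "exec (p @ q) s s'"
  then show "\<exists>s1. exec p s s1 \<and> exec q s1 s'"
    unfolding exec_def using funpow_step_appendD by blast
next
  assume "\<exists>s1. exec p s s1 \<and> exec q s1 s'"
  then obtain s1 n m where "(step ^^ n) (p, s) = ([], s1)" and m: "(step ^^ m) (q, s1) = ([], s')"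
    by (auto simp: exec_def)
  from funpow_step_appendI[OF this(1)] obtain n' where "(step ^^ n') (p @ q, s) = (q, s1)"
    by blast
  with m have "(step ^^ (m + n')) (p @ q, s) = ([], s')" by (simp add: funpow_add)
  then show "exec (p @ q) s s'" by (auto simp: exec_def)
qed

declare split_paired_Ex [simp del]

lemma exec_Inc [simp]: "exec (Inc i # q) (t, r) s' \<longleftrightarrow> exec q (t, r(i := Suc (r i))) s'"
  by (subst exec_step) simp

lemma exec_Dec [simp]: "exec (Dec i # q) (t, r) s' \<longleftrightarrow> exec q (t, r(i := r i - 1)) s'"
  by (subst exec_step) simp

lemma exec_Loop: "exec [Loop i b] (t, r) s' \<longleftrightarrow>
    (if r i = 0 then s' = (t, r) else \<exists>s1. exec b (t, r) s1 \<and> exec [Loop i b] s1 s')"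
  by (subst exec_step) (simp add: exec_append)

lemma exec_replicate_Inc: "exec (replicate n (Inc i)) (t, r) s' \<longleftrightarrow> s' = (t, r(i := r i + n))"
proof (induction n arbitrary: r)
  case (Suc n)
  have *: "(r(i := Suc (r i)))(i := (r(i := Suc (r i))) i + n) = r(i := r i + Suc n)"
    by (rule ext) simp
  show ?case unfolding replicate_Suc exec_Inc Suc * ..
qed simp

lemma exec_Rd: "exec [Rd i] ((t1, t2), r) s' \<longleftrightarrow>
    s' = (if t1 = [] then ((t1, t2), r) else ((butlast t1, last t1 # t2), r(i := r i + last t1)))"
  by (subst exec_step) (simp add: exec_replicate_Inc)

lemma exec_Loop_invariant:
  assumes "exec [Loop i b] s s'" "P s"
    and step: "\<And>t r s1. P (t, r) \<Longrightarrow> r i \<noteq> 0 \<Longrightarrow> exec b (t, r) s1 \<Longrightarrow> P s1"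
  shows "P s' \<and> snd s' i = 0"
proof -
  have "P s' \<and> snd s' i = 0" if "(step ^^ n) ([Loop i b], s) = ([], s')" "P s" for n
    using that
  proof (induction n arbitrary: s rule: less_induct)
    case (less n)
    obtain t r where s: "s = (t, r)" by fastforce
    obtain n' where n: "n = Suc n'" using less.prems by (cases n) auto
    show ?case
    proof (cases "r i = 0")
      case True
      then have "(step ^^ n') ([], s) = ([], s')"
        using less.prems(1) n s by (simp add: funpow_swap1)
      then have "s' = s" by simp
      then show ?thesis using True s less.prems(2) by simp
    next
      case False
      then have "(step ^^ n') (b @ [Loop i b], s) = ([], s')"
        using less.prems(1) n s by (simp add: funpow_swap1)
      from funpow_step_appendD[OF this] obtain m m' s1 where
        "(step ^^ m) (b, s) = ([], s1)" and m': "(step ^^ m') ([Loop i b], s1) = ([], s')" "m + m' \<le> n'"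
        by blast
      then have "exec b (t, r) s1" by (auto simp: exec_def s)
      then have "P s1" using step less.prems(2) False s by simp
      then show ?thesis using less.IH[OF _ m'(1)] m'(2) n by simp
    qed
  qed
  then show ?thesis using assms(1,2) by (auto simp: exec_def)
qed

text \<open>An equivalence, so that it yields termination together with the only possible
  result.\<close>

lemma exec_Loop_countdown:
  assumes "\<And>r s'. r i \<noteq> 0 \<Longrightarrow> exec b (t, r) s' \<longleftrightarrow> s' = (t, g r)"
    and "\<And>r. r i \<noteq> 0 \<Longrightarrow> g r i = r i - 1"
  shows "exec [Loop i b] (t, r) s' \<longleftrightarrow> s' = (t, (g ^^ (r i)) r)"
proof (induction "r i" arbitrary: r)
  case 0
  then show ?case by (simp add: exec_Loop[of _ _ _ r])
next
  case (Suc n)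
  then have "exec [Loop i b] (t, r) s' \<longleftrightarrow> exec [Loop i b] (t, g r) s'"
    by (subst exec_Loop) (simp add: assms(1))
  also have "\<dots> \<longleftrightarrow> s' = (t, (g ^^ n) (g r))"
    using Suc(1)[of "g r"] Suc(2)[symmetric] assms(2)[of r] by simp
  finally show ?case using Suc(2)[symmetric] by (simp add: funpow_swap1)
qed

section \<open>Compiling recursive functions into counter programs\<close>

definition clear :: "nat \<Rightarrow> ins list" where
  "clear i = [Loop i [Dec i]]"

lemma exec_clear [simp]: "exec (clear i) (t, r) s' \<longleftrightarrow> s' = (t, r(i := 0))"
proof -
  have "((\<lambda>r. r(i := r i - 1)) ^^ n) r = r(i := r i - n)" for n and r :: "nat \<Rightarrow> nat"
    by (induction n arbitrary: r) auto
  then show ?thesis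
    unfolding clear_def by (subst exec_Loop_countdown[where g = "\<lambda>r. r(i := r i - 1)"]) auto
qed

text \<open>Reading a counter empties it: \<open>a\<close> is drained into \<open>o'\<close> and the
  scratch register \<open>c\<close>, and then restored from \<open>c\<close>.\<close>

definition copy :: "nat \<Rightarrow> nat \<Rightarrow> nat \<Rightarrow> ins list" where
  "copy a c o' = clear c @ clear o' @ [Loop a [Dec a, Inc o', Inc c]] @ [Loop c [Dec c, Inc a]]"

lemma exec_copy [simp]:
  assumes "a \<noteq> c" "a \<noteq> o'" "c \<noteq> o'"
  shows "exec (copy a c o') (t, r) s' \<longleftrightarrow> s' = (t, r(c := 0, o' := r a))"
proof -
  let ?g = "\<lambda>r::nat \<Rightarrow> nat. r(a := r a - 1, o' := Suc (r o'), c := Suc (r c))"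
  let ?h = "\<lambda>r::nat \<Rightarrow> nat. r(c := r c - 1, a := Suc (r a))"
  have g: "(?g ^^ n) r = r(a := r a - n, o' := r o' + n, c := r c + n)" for n r
    using assms by (induction n) (auto simp: fun_eq_iff)
  have h: "(?h ^^ n) r = r(c := r c - n, a := r a + n)" for n r
    using assms by (induction n) (auto simp: fun_eq_iff)
  have 1: "exec [Loop a [Dec a, Inc o', Inc c]] (t, r) s' \<longleftrightarrow>
      s' = (t, r(a := 0, o' := r o' + r a, c := r c + r a))" for r s'
  proof -
    have "exec [Loop a [Dec a, Inc o', Inc c]] (t, r) s' \<longleftrightarrow> s' = (t, (?g ^^ (r a)) r)"
      using assms by (intro exec_Loop_countdown) simp_all
    then show ?thesis unfolding g by simp
  qed
  have 2: "exec [Loop c [Dec c, Inc a]] (t, r) s' \<longleftrightarrow> s' = (t, r(c := 0, a := r a + r c))" for r s'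
  proof -
    have "exec [Loop c [Dec c, Inc a]] (t, r) s' \<longleftrightarrow> s' = (t, (?h ^^ (r c)) r)"
      using assms by (intro exec_Loop_countdown) simp_all
    then show ?thesis unfolding h by simp
  qed
  have "r(c := 0, o' := 0, a := 0, o' := r a, c := r a, c := 0, a := r a) = r(c := 0, o' := r a)"
    using assms by (simp add: fun_eq_iff)
  then show ?thesis
    unfolding copy_def exec_append using assms by (simp add: 1 2)
qed

text \<open>Partial correctness forces divergence where \<open>f\<close> is undefined; the frame condition, which protects
  all registers below \<open>b\<close> except the output \<open>o'\<close>, makes these programs composable.\<close>

definition computes :: "ins list \<Rightarrow> recf \<Rightarrow> nat list \<Rightarrow> nat \<Rightarrow> nat \<Rightarrow> bool" where
  "computes p f args o' b \<longleftrightarrow>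
     (\<forall>t r s'. exec p (t, r) s' \<longrightarrow> (\<exists>r'. s' = (t, r') \<and> rec_eval f (map r args) (r' o') \<and>
        (\<forall>j<b. j \<noteq> o' \<longrightarrow> r' j = r j))) \<and>
     (\<forall>t r y. rec_eval f (map r args) y \<longrightarrow> (\<exists>s'. exec p (t, r) s'))"

lemma computesD:
  assumes "computes p f args o' b" "exec p (t, r) s'"
  obtains r' where "s' = (t, r')" "rec_eval f (map r args) (r' o')" "\<And>j. j < b \<Longrightarrow> j \<noteq> o' \<Longrightarrow> r' j = r j"
  using assms unfolding computes_def by blast

lemma computesE:
  assumes "computes p f args o' b" "rec_eval f (map r args) y"
  obtains r' where "exec p (t, r) (t, r')" "r' o' = y" "\<And>j. j < b \<Longrightarrow> j \<noteq> o' \<Longrightarrow> r' j = r j"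
  using assms rec_eval_det unfolding computes_def by metis

text \<open>Serves argument lists of a length on which the function is nowhere defined.\<close>

definition diverge :: "nat \<Rightarrow> ins list" where
  "diverge i = [Inc i, Loop i []]"

lemma not_exec_diverge: "\<not> exec (diverge i) (t, r) s'"
proof
  assume "exec (diverge i) (t, r) s'"
  then have "exec [Loop i []] (t, r(i := Suc (r i))) s'"
    unfolding diverge_def by simp
  from exec_Loop_invariant[OF this, where P = "\<lambda>s. snd s i \<noteq> 0"] show False by auto
qed

lemma computes_diverge: "(\<And>r y. \<not> rec_eval f (map r args) y) \<Longrightarrow> computes (diverge i) f args o' b"
  by (simp add: computes_def not_exec_diverge)

text \<open>Induction over \<open>f\<close>: register \<open>b\<close> and those above it are free
  for local use, and subprograms are compiled with a larger bound so that the local registers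
  survive them.\<close>

lemma ex_computes:
  assumes "set args \<subseteq> {..<b}" "o' < b" "o' \<notin> set args"
  shows "\<exists>p. computes p f args o' b"
  using assms
proof (induction f arbitrary: args o' b)
  case Zero
  have "computes (clear o') Zero args o' b"
    by (auto simp: computes_def intro: rec_eval.intros)
  then show ?case ..
next
  case Succ
  show ?case
  proof (cases "length args = 1")
    case True
    then obtain a where a: "args = [a]" by (auto simp: length_Suc_conv)
    then have "computes (copy a b o' @ [Inc o']) Succ args o' b"
      using Succ by (auto simp: computes_def exec_append intro: rec_eval.intros)
    then show ?thesis ..
  next
    case False
    then have "\<not> rec_eval Succ (map r args) y" for r :: "nat \<Rightarrow> nat" and y
      by (auto elim!: rec_eval_SuccE simp: map_eq_Cons_conv)
    from computes_diverge[OF this] show ?thesis by blast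
  qed
next
  case (Proj i)
  show ?case
  proof (cases "i < length args")
    case True
    then have i: "args ! i \<in> set args" by simp
    have "rec_eval (Proj i) (map r args) (r (args ! i))" for r
      using rec_eval.intros(3)[of i "map r args"] True by simp
    moreover have "args ! i \<noteq> b" "args ! i \<noteq> o'" "b \<noteq> o'" using i Proj by auto
    ultimately have "computes (copy (args ! i) b o') (Proj i) args o' b"
      by (auto simp: computes_def)
    then show ?thesis ..
  next
    case False
    then have "\<not> rec_eval (Proj i) (map r args) y" for r :: "nat \<Rightarrow> nat" and y
      by (auto elim!: rec_eval_ProjE)
    from computes_diverge[OF this] show ?thesis by blast
  qed
next
  case (Comp f gs)
  let ?l = "length gs"
  \<comment> \<open>Inner induction on the number of arguments computed so far; the value of
    \<open>gs ! i\<close> is kept in register \<open>b + i\<close>.\<close>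
  have "\<exists>p. (\<forall>t r s'. exec p (t, r) s' \<longrightarrow> (\<exists>r'. s' = (t, r') \<and>
        (\<forall>i<n. rec_eval (gs ! i) (map r args) (r' (b + i))) \<and> (\<forall>j<b. r' j = r j))) \<and>
     (\<forall>t r. (\<forall>i<n. \<exists>y. rec_eval (gs ! i) (map r args) y) \<longrightarrow> (\<exists>s'. exec p (t, r) s'))"
    if "n \<le> ?l" for n
    using that
  proof (induction n)
    case 0
    show ?case by (intro exI[of _ "[]"]) simp
  next
    case (Suc n)
    then obtain p where
      p1: "\<And>t r s'. exec p (t, r) s' \<Longrightarrow> \<exists>r'. s' = (t, r') \<and>
        (\<forall>i<n. rec_eval (gs ! i) (map r args) (r' (b + i))) \<and> (\<forall>j<b. r' j = r j)" and
      p2: "\<And>t r. (\<And>i. i < n \<Longrightarrow> \<exists>y. rec_eval (gs ! i) (map r args) y) \<Longrightarrow> \<exists>s'. exec p (t, r) s'"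
      by fastforce
    have "set args \<subseteq> {..<b + ?l}" "b + n < b + ?l" "b + n \<notin> set args" "gs ! n \<in> set gs"
      using Comp.prems Suc.prems by auto
    from Comp.IH(2)[OF this(4) this(1-3)]
    obtain q where q: "computes q (gs ! n) args (b + n) (b + ?l)" ..
    have args: "map r' args = map r args" if "\<forall>j<b. r' j = r j" for r r' :: "nat \<Rightarrow> nat"
      using Comp.prems(1) that by auto
    show ?case
    proof (intro exI[of _ "p @ q"] conjI allI impI)
      fix t r s'
      assume "exec (p @ q) (t, r) s'"
      then obtain s1 where s1: "exec p (t, r) s1" "exec q s1 s'" by (auto simp: exec_append)
      from p1[OF s1(1)] obtain r1 where r1: "s1 = (t, r1)"
        "\<forall>i<n. rec_eval (gs ! i) (map r args) (r1 (b + i))" "\<forall>j<b. r1 j = r j" by blast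
      from computesD[OF q, of t r1 s'] s1(2) r1(1) obtain r' where r': "s' = (t, r')"
        "rec_eval (gs ! n) (map r1 args) (r' (b + n))" "\<And>j. j < b + ?l \<Longrightarrow> j \<noteq> b + n \<Longrightarrow> r' j = r1 j"
        by blast
      show "\<exists>r'. s' = (t, r') \<and> (\<forall>i<Suc n. rec_eval (gs ! i) (map r args) (r' (b + i))) \<and>
          (\<forall>j<b. r' j = r j)"
        using r1 r' args[OF r1(3)] Suc.prems by (intro exI[of _ r']) (auto simp: less_Suc_eq)
    next
      fix t r
      assume y: "\<forall>i<Suc n. \<exists>y. rec_eval (gs ! i) (map r args) y"
      with p2[of r t] obtain s1 where s1: "exec p (t, r) s1" by auto
      from p1[OF s1] obtain r1 where r1: "s1 = (t, r1)" "\<forall>j<b. r1 j = r j" by blast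
      from y obtain z where "rec_eval (gs ! n) (map r1 args) z" using args[OF r1(2)] by auto
      from computesE[OF q this] obtain r' where "exec q (t, r1) (t, r')" by metis
      then show "\<exists>s'. exec (p @ q) (t, r) s'" using s1 r1(1) by (auto simp: exec_append)
    qed
  qed
  from this[of ?l] obtain p where
    p1: "\<And>t r s'. exec p (t, r) s' \<Longrightarrow> \<exists>r'. s' = (t, r') \<and>
        (\<forall>i<?l. rec_eval (gs ! i) (map r args) (r' (b + i))) \<and> (\<forall>j<b. r' j = r j)" and
    p2: "\<And>t r. (\<And>i. i < ?l \<Longrightarrow> \<exists>y. rec_eval (gs ! i) (map r args) y) \<Longrightarrow> \<exists>s'. exec p (t, r) s'"
    by fastforce
  let ?bs = "map (\<lambda>i. b + i) [0..<?l]"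
  have "set ?bs \<subseteq> {..<b + ?l}" "o' < b + ?l" "o' \<notin> set ?bs"
    using Comp.prems by auto
  from Comp.IH(1)[OF this] obtain q where q: "computes q f ?bs o' (b + ?l)" ..
  have all2: "list_all2 (\<lambda>g y. rec_eval g (map r args) y) gs (map r1 ?bs)"
    if "\<forall>i<?l. rec_eval (gs ! i) (map r args) (r1 (b + i))" for r r1
    using that by (simp add: list_all2_conv_all_nth)
  have "computes (p @ q) (Comp f gs) args o' b"
    unfolding computes_def
  proof (intro conjI allI impI)
    fix t r s'
    assume "exec (p @ q) (t, r) s'"
    then obtain s1 where s1: "exec p (t, r) s1" "exec q s1 s'" by (auto simp: exec_append)
    from p1[OF s1(1)] obtain r1 where r1: "s1 = (t, r1)"
      "\<forall>i<?l. rec_eval (gs ! i) (map r args) (r1 (b + i))" "\<forall>j<b. r1 j = r j" by blast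
    from computesD[OF q, of t r1 s'] s1(2) r1(1) obtain r' where r': "s' = (t, r')"
      "rec_eval f (map r1 ?bs) (r' o')" "\<And>j. j < b + ?l \<Longrightarrow> j \<noteq> o' \<Longrightarrow> r' j = r1 j" by blast
    have "rec_eval (Comp f gs) (map r args) (r' o')"
      by (rule rec_eval.intros(4)[OF all2[OF r1(2)] r'(2)])
    then show "\<exists>r'. s' = (t, r') \<and> rec_eval (Comp f gs) (map r args) (r' o') \<and>
        (\<forall>j<b. j \<noteq> o' \<longrightarrow> r' j = r j)"
      using r' r1(3) by auto
  next
    fix t r y
    assume "rec_eval (Comp f gs) (map r args) y"
    then obtain ys where ys: "list_all2 (\<lambda>g y. rec_eval g (map r args) y) gs ys" "rec_eval f ys y"
      by (elim rec_eval_CompE)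
    then have "\<exists>y. rec_eval (gs ! i) (map r args) y" if "i < ?l" for i
      using that by (auto simp: list_all2_conv_all_nth)
    from p2[OF this, of t] obtain s1 where s1: "exec p (t, r) s1" by blast
    from p1[OF s1] obtain r1 where r1: "s1 = (t, r1)"
      "\<forall>i<?l. rec_eval (gs ! i) (map r args) (r1 (b + i))" by blast
    have "ys = map r1 ?bs"
    proof (rule nth_equalityI)
      show "length ys = length (map r1 ?bs)" using ys(1) by (simp add: list_all2_lengthD)
      then show "ys ! i = map r1 ?bs ! i" if "i < length ys" for i
        using that ys(1) r1(2) by (auto simp: list_all2_conv_all_nth intro: rec_eval_det)
    qed
    with ys(2) have "rec_eval f (map r1 ?bs) y" by simp
    from computesE[OF q this] obtain r' where "exec q (t, r1) (t, r')" by metis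
    then show "\<exists>s'. exec (p @ q) (t, r) s'" using s1 r1(1) by (auto simp: exec_append)
  qed
  then show ?case ..
next
  case (PrimRec f g)
  show ?case
  proof (cases args)
    case Nil
    then have "\<not> rec_eval (PrimRec f g) (map r args) y" for r :: "nat \<Rightarrow> nat" and y
      by (auto elim!: rec_eval_PrimRecE)
    from computes_diverge[OF this] show ?thesis by blast
  next
    case (Cons a xs)
    have "set xs \<subseteq> {..<b + 5}" "b + 2 < b + 5" "b + 2 \<notin> set xs"
      using PrimRec.prems Cons by auto
    from PrimRec.IH(1)[OF this] obtain pf where pf: "computes pf f xs (b + 2) (b + 5)" ..
    have "set ((b + 1) # (b + 2) # xs) \<subseteq> {..<b + 5}" "b + 3 < b + 5"
      "b + 3 \<notin> set ((b + 1) # (b + 2) # xs)"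
      using PrimRec.prems Cons by auto
    from PrimRec.IH(2)[OF this] obtain pg where
      pg: "computes pg g ((b + 1) # (b + 2) # xs) (b + 3) (b + 5)" ..
    \<comment> \<open>Register \<open>b\<close> counts down, \<open>b + 1\<close> counts up,
      \<open>b + 2\<close> holds the current value, \<open>b + 3\<close> receives the next one, and
      \<open>b + 4\<close> is scratch for copying.\<close>
    define body where "body = pg @ copy (b + 3) (b + 4) (b + 2) @ [Inc (b + 1), Dec b]"
    define p where "p = pf @ copy a (b + 4) b @ clear (b + 1) @ [Loop b body] @ copy (b + 2) (b + 4) o'"
    have neq: "a \<noteq> b + 4" "a \<noteq> b" "b + 2 \<noteq> o'" "b + 4 \<noteq> o'" and a: "a < b"
      using PrimRec.prems Cons by auto
    have xs: "map r' xs = map r xs" if "\<And>j. j < b \<Longrightarrow> r' j = r j" for r r' :: "nat \<Rightarrow> nat"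
      using PrimRec.prems Cons that by auto
    define inv where "inv r t s \<longleftrightarrow> fst s = t \<and> snd s b + snd s (b + 1) = r a \<and>
      (\<forall>j<b. snd s j = r j) \<and>
      rec_eval (PrimRec f g) (snd s (b + 1) # map r xs) (snd s (b + 2))" for r t and s :: store
    have body1: "inv r t s1 \<and> snd s1 b = r1 b - 1" 
      if "inv r t (t1, r1)" "r1 b \<noteq> 0" "exec body (t1, r1) s1" for r t t1 r1 s1
    proof -
      from that(3) obtain s2 where s2: "exec pg (t1, r1) s2"
        "exec (copy (b + 3) (b + 4) (b + 2) @ [Inc (b + 1), Dec b]) s2 s1"
        unfolding body_def exec_append[of pg] by blast
      from computesD[OF pg s2(1)] obtain r2 where r2: "s2 = (t1, r2)"
        "rec_eval g (map r1 ((b + 1) # (b + 2) # xs)) (r2 (b + 3))"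
        "\<And>j. j < b + 5 \<Longrightarrow> j \<noteq> b + 3 \<Longrightarrow> r2 j = r1 j" by blast
      have s1: "s1 = (t1, r2(b + 4 := 0, b + 2 := r2 (b + 3), b + 1 := Suc (r2 (b + 1)), b := r2 b - 1))"
        using s2(2) r2(1) by (simp add: exec_append)
      from that(1) have "\<And>j. j < b \<Longrightarrow> r1 j = r j" by (simp add: inv_def)
      from xs[OF this] have "map r1 xs = map r xs" .
      with r2(2) that(1) have "rec_eval (PrimRec f g) (Suc (r1 (b + 1)) # map r xs) (r2 (b + 3))"
        by (intro rec_eval.intros(6)[of f g "r1 (b + 1)" _ "r1 (b + 2)"]) (auto simp: inv_def)
      then show ?thesis using that(1,2) r2(3) by (auto simp: inv_def s1)
    qed
    have body2: "\<exists>s1. exec body (t1, r1) s1"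
      if "inv r t (t1, r1)" "r1 b \<noteq> 0" "rec_eval (PrimRec f g) (r a # map r xs) y" for r t t1 r1 y
    proof -
      \<comment> \<open>A recursion defined at \<open>r a\<close> is defined at every smaller
        argument, which is seen by going down; so no call of \<open>pg\<close> can diverge.\<close>
      have "\<exists>y. rec_eval (PrimRec f g) (n # map r xs) y" if "n \<le> r a" for n
        using that by (induction n rule: inc_induct)
          (use \<open>rec_eval (PrimRec f g) (r a # map r xs) y\<close> in \<open>auto elim: rec_eval_PrimRecSucE\<close>)
      from this[of "Suc (r1 (b + 1))"] that(1,2) 
      obtain z where "rec_eval (PrimRec f g) (Suc (r1 (b + 1)) # map r xs) z"
        by (auto simp: inv_def)
      then obtain w where w: "rec_eval (PrimRec f g) (r1 (b + 1) # map r xs) w"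
        "rec_eval g (r1 (b + 1) # w # map r xs) z" by (elim rec_eval_PrimRecSucE)
      from that(1) have "\<And>j. j < b \<Longrightarrow> r1 j = r j" by (simp add: inv_def)
      from xs[OF this] have "map r1 xs = map r xs" .
      moreover have "w = r1 (b + 2)" using that(1) w(1) by (auto simp: inv_def intro: rec_eval_det)
      ultimately have "rec_eval g (map r1 ((b + 1) # (b + 2) # xs)) z"
        using w(2) by (simp only: list.map)
      from computesE[OF pg this] obtain r2 where "exec pg (t1, r1) (t1, r2)" by metis
      moreover have "\<exists>s1. exec (copy (b + 3) (b + 4) (b + 2) @ [Inc (b + 1), Dec b]) (t1, r2) s1"
        by (simp add: exec_append)
      ultimately show ?thesis
        unfolding body_def exec_append[of pg] by blast
    qed
    have start: "inv r t (t, r1(b + 4 := 0, b := r1 a, b + 1 := 0))"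
      if "rec_eval f (map r xs) (r1 (b + 2))" "\<And>j. j < b + 5 \<Longrightarrow> j \<noteq> b + 2 \<Longrightarrow> r1 j = r j" for r r1 t
      using that a by (auto simp: inv_def intro: rec_eval.intros)
    have "computes p (PrimRec f g) args o' b"
      unfolding computes_def
    proof (intro conjI allI impI)
      fix t r s'
      assume "exec p (t, r) s'"
      then obtain s1 where s1: "exec pf (t, r) s1"
        "exec (copy a (b + 4) b @ clear (b + 1) @ [Loop b body] @ copy (b + 2) (b + 4) o') s1 s'"
        unfolding p_def exec_append[of pf] by blast
      from computesD[OF pf s1(1)] obtain r1 where r1: "s1 = (t, r1)" "rec_eval f (map r xs) (r1 (b + 2))"
        "\<And>j. j < b + 5 \<Longrightarrow> j \<noteq> b + 2 \<Longrightarrow> r1 j = r j" by blast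
      from s1(2) have "exec ([Loop b body] @ copy (b + 2) (b + 4) o')
          (t, r1(b + 4 := 0, b := r1 a, b + 1 := 0)) s'"
        using neq r1(1) by (simp add: exec_append[of "copy a (b + 4) b"] exec_append[of "clear _"])
      then obtain s2 where s2: "exec [Loop b body] (t, r1(b + 4 := 0, b := r1 a, b + 1 := 0)) s2"
        "exec (copy (b + 2) (b + 4) o') s2 s'"
        unfolding exec_append by blast
      have "inv r t s2 \<and> snd s2 b = 0"
        using body1 by (intro exec_Loop_invariant[OF s2(1)] start r1) blast+
      moreover obtain t2 r2 where "s2 = (t2, r2)" by fastforce
      ultimately show "\<exists>r'. s' = (t, r') \<and> rec_eval (PrimRec f g) (map r args) (r' o') \<and>
          (\<forall>j<b. j \<noteq> o' \<longrightarrow> r' j = r j)"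
        using s2(2) neq Cons by (auto simp: inv_def)
    next
      fix t r y
      assume "rec_eval (PrimRec f g) (map r args) y"
      then have y: "rec_eval (PrimRec f g) (r a # map r xs) y" using Cons by simp
      have "\<exists>y. rec_eval f (map r xs) y"
      proof -
        have "\<exists>y. rec_eval f (map r xs) y" if "rec_eval (PrimRec f g) (n # map r xs) z" for n z
          using that by (induction n arbitrary: z) 
            (auto elim: rec_eval_PrimRec0E rec_eval_PrimRecSucE)
        with y show ?thesis by blast
      qed
      then obtain z where "rec_eval f (map r xs) z" ..
      from computesE[OF pf this] obtain r1 where r1: "exec pf (t, r) (t, r1)" "r1 (b + 2) = z"
        "\<And>j. j < b + 5 \<Longrightarrow> j \<noteq> b + 2 \<Longrightarrow> r1 j = r j" by metis
      with \<open>rec_eval f (map r xs) z\<close> start have "inv r t (t, r1(b + 4 := 0, b := r1 a, b + 1 := 0))"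
        by blast
      moreover have "\<exists>s'. exec [Loop b body] s s'" if "inv r t s" for s
        using that
      proof (induction "snd s b" arbitrary: s)
        case 0
        then show ?case by (cases s) (auto simp: exec_Loop)
      next
        case (Suc n)
        obtain t1 r1 where s: "s = (t1, r1)" by fastforce
        with body2[of r t t1 r1 y] Suc y obtain s1 where s1: "exec body (t1, r1) s1" by auto
        with body1[of r t t1 r1 s1] Suc s have "inv r t s1" "snd s1 b = n" by auto
        with Suc(1)[of s1] obtain s' where "exec [Loop b body] s1 s'" by auto
        then have "exec [Loop b body] (t1, r1) s'" using s1 s Suc(2) by (subst exec_Loop) auto
        then show ?case using s by blast
      qed
      ultimately obtain s2 where "exec [Loop b body] (t, r1(b + 4 := 0, b := r1 a, b + 1 := 0)) s2"
        by blast
      moreover obtain t2 r2 where "s2 = (t2, r2)" by fastforce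
      moreover from this have "exec (copy (b + 2) (b + 4) o') s2 (t2, r2(b + 4 := 0, o' := r2 (b + 2)))"
        using neq by simp
      ultimately obtain s' where "exec ([Loop b body] @ copy (b + 2) (b + 4) o')
          (t, r1(b + 4 := 0, b := r1 a, b + 1 := 0)) s'"
        unfolding exec_append by blast
      then have "exec (copy a (b + 4) b @ clear (b + 1) @ [Loop b body] @ copy (b + 2) (b + 4) o') (t, r1) s'"
        using neq by (simp add: exec_append[of "copy a (b + 4) b"] exec_append[of "clear _"])
      then show "\<exists>s'. exec p (t, r) s'"
        unfolding p_def exec_append[of pf] using r1(1) by blast
    qed
    then show ?thesis ..
  qed
next
  case (Mu f)
  have "set (b # args) \<subseteq> {..<b + 3}" "b + 1 < b + 3" "b + 1 \<notin> set (b # args)"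
    using Mu.prems by auto
  from Mu.IH[OF this] obtain q where q: "computes q f (b # args) (b + 1) (b + 3)" ..
  \<comment> \<open>Register \<open>b\<close> holds the candidate and \<open>b + 1\<close> the value
    of \<open>f\<close> there. One evaluation precedes the loop because the loop tests before it
    runs its body.\<close>
  define p where "p = clear b @ q @ [Loop (b + 1) (Inc b # q)] @ copy b (b + 2) o'"
  have neq: "b \<noteq> o'" "b + 2 \<noteq> o'" using Mu.prems by auto
  have args: "map r' args = map r args" if "\<And>j. j < b \<Longrightarrow> r' j = r j" for r r' :: "nat \<Rightarrow> nat"
    using Mu.prems that by auto
  define inv where "inv r t s \<longleftrightarrow> fst s = t \<and> (\<forall>j<b. snd s j = r j) \<and>
      rec_eval f (snd s b # map r args) (snd s (b + 1)) \<and>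
      (\<forall>i<snd s b. \<exists>y. rec_eval f (i # map r args) (Suc y))" for r t and s :: store
  have q1: "inv r t s1 \<and> snd s1 b = r1 b"
    if "exec q (t, r1) s1" "\<And>j. j < b \<Longrightarrow> r1 j = r j" "\<forall>i<r1 b. \<exists>y. rec_eval f (i # map r args) (Suc y)"
    for r t r1 s1
  proof -
    from computesD[OF q that(1)] obtain r2 where "s1 = (t, r2)" "rec_eval f (map r1 (b # args)) (r2 (b + 1))"
      "\<And>j. j < b + 3 \<Longrightarrow> j \<noteq> b + 1 \<Longrightarrow> r2 j = r1 j" by blast
    then show ?thesis using that args[OF that(2)] by (auto simp: inv_def)
  qed
  have body1: "inv r t s1 \<and> snd s1 b = Suc (r1 b)"
    if "inv r t (t1, r1)" "r1 (b + 1) \<noteq> 0" "exec (Inc b # q) (t1, r1) s1" for r t t1 r1 s1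
  proof -
    from that(3) have e: "exec q (t1, r1(b := Suc (r1 b))) s1" by simp
    have t: "t1 = t" using that(1) by (simp add: inv_def)
    have "\<exists>y. r1 (b + 1) = Suc y" using that(2) not0_implies_Suc by blast
    then have "\<exists>y. rec_eval f (r1 b # map r args) (Suc y)"
      using that(1) by (auto simp: inv_def)
    then have 1: "\<forall>i<(r1(b := Suc (r1 b))) b. \<exists>y. rec_eval f (i # map r args) (Suc y)"
      using that(1) by (auto simp: inv_def less_Suc_eq)
    have 2: "(r1(b := Suc (r1 b))) j = r j" if "j < b" for j
      using that \<open>inv r t (t1, r1)\<close> by (simp add: inv_def)
    show ?thesis using q1[OF e 2 1] t by simp
  qed
  have "computes p (Mu f) args o' b"
    unfolding computes_def
  proof (intro conjI allI impI)
    fix t r s'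
    assume "exec p (t, r) s'"
    then obtain s1 s2 where s: "exec q (t, r(b := 0)) s1" "exec [Loop (b + 1) (Inc b # q)] s1 s2"
      "exec (copy b (b + 2) o') s2 s'"
      unfolding p_def exec_append by auto
    have "inv r t s1" using q1[OF s(1), of r] by simp
    then have "inv r t s2 \<and> snd s2 (b + 1) = 0"
      using body1 by (intro exec_Loop_invariant[OF s(2)]) blast+
    moreover obtain t2 r2 where "s2 = (t2, r2)" by fastforce
    ultimately show "\<exists>r'. s' = (t, r') \<and> rec_eval (Mu f) (map r args) (r' o') \<and>
        (\<forall>j<b. j \<noteq> o' \<longrightarrow> r' j = r j)"
      using s(3) neq by (auto simp: inv_def intro: rec_eval.intros(7))
  next
    fix t r y
    assume "rec_eval (Mu f) (map r args) y"
    then have y: "rec_eval f (y # map r args) 0" "\<forall>i<y. \<exists>z. rec_eval f (i # map r args) (Suc z)"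
      by (auto elim: rec_eval_MuE)
    have q2: "\<exists>s1. exec q (t, r1) s1" if "r1 b \<le> y" "\<And>j. j < b \<Longrightarrow> r1 j = r j" for r1
    proof -
      have "map r1 (b # args) = r1 b # map r args"
        using args[of r1 r, OF that(2)] by (simp del: map_eq_conv)
      moreover have "\<exists>z. rec_eval f (r1 b # map r args) z"
        using y that(1) by (metis le_neq_implies_less)
      ultimately have "\<exists>z. rec_eval f (map r1 (b # args)) z" by (simp only:)
      with computesE[OF q] show ?thesis by metis
    qed
    from q2[of "r(b := 0)"] obtain s1 where s1: "exec q (t, r(b := 0)) s1" by auto
    have s1': "inv r t s1" "snd s1 b \<le> y" using q1[OF s1, of r] by auto
    \<comment> \<open>A zero is known to occur at \<open>y\<close>, and the candidate never passes
      it, so the distance to \<open>y\<close> decreases.\<close>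
    have "\<exists>s'. exec [Loop (b + 1) (Inc b # q)] s s'" if "inv r t s" "snd s b \<le> y" for s
      using that
    proof (induction "y - snd s b" arbitrary: s)
      case 0
      obtain t1 r1 where s: "s = (t1, r1)" by fastforce
      with 0 y(1) have "r1 (b + 1) = 0" by (auto simp: inv_def intro: rec_eval_det)
      then show ?case using s by (auto simp: exec_Loop)
    next
      case (Suc n)
      obtain r1 where s: "s = (t, r1)" using Suc.prems by (cases s) (auto simp: inv_def)
      show ?case
      proof (cases "r1 (b + 1) = 0")
        case True
        then show ?thesis using s by (auto simp: exec_Loop)
      next
        case False
        have le: "Suc (r1 b) \<le> y" "n = y - Suc (r1 b)" using Suc.hyps(2) s by auto
        have "\<exists>s2. exec q (t, r1(b := Suc (r1 b))) s2"
          using q2[of "r1(b := Suc (r1 b))"] le Suc.prems s by (simp add: inv_def)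
        then obtain s2 where "exec q (t, r1(b := Suc (r1 b))) s2" ..
        then have s2: "exec (Inc b # q) (t, r1) s2" by simp
        from body1[OF _ False this, of r t] Suc.prems s have "inv r t s2" "snd s2 b = Suc (r1 b)" by auto
        with Suc.hyps(1)[of s2] le obtain s' where "exec [Loop (b + 1) (Inc b # q)] s2 s'" by auto
        then have "exec [Loop (b + 1) (Inc b # q)] (t, r1) s'" using s2 False
          unfolding exec_Loop[of "b + 1" _ t] if_not_P[OF False] by blast
        then show ?thesis using s by blast
      qed
    qed
    with s1' obtain s2 where s2: "exec [Loop (b + 1) (Inc b # q)] s1 s2" by blast
    moreover obtain t2 r2 where "s2 = (t2, r2)" by fastforce
    moreover from this have "exec (copy b (b + 2) o') s2 (t2, r2(b + 2 := 0, o' := r2 b))"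
      using neq by simp
    moreover have "exec (clear b) (t, r) (t, r(b := 0))" by simp
    ultimately show "\<exists>s'. exec p (t, r) s'"
      using s1 unfolding p_def exec_append by blast
  qed
  then show ?case ..
qed


section \<open>Reading the two input words from the tape\<close>

text \<open>Letters are shifted by one on the tape, so 0 in register \<open>y\<close> means the
  separator or the left end, where \<open>Rd\<close> does nothing; both stop the loop. Reading from
  the right suits \<open>list_encode\<close>, which builds codes by prepending.\<close>

lemma exec_encoder_loop:
  assumes q: "\<And>t r. \<exists>r'. exec q (t, r) (t, r') \<and> r' b = Suc (prod_encode (r y, r e)) \<and> (\<forall>j<b. r' j = r j)"
    and y: "e < b" "y < b" "e \<noteq> y"
    and body: "body = Dec y # q @ copy b (b + 1) e @ clear y @ [Rd y]"
    and w: "w = [] \<or> last w = 0"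
  shows "r y = 0 \<Longrightarrow> r e = list_encode u2 \<Longrightarrow>
    \<exists>r'. exec ([Rd y] @ [Loop y body]) ((w @ map Suc u1, t2), r)
        ((butlast w, (if w = [] then [] else [0]) @ map Suc u1 @ t2), r') \<and>
      r' e = list_encode (u1 @ u2) \<and> (\<forall>j<b. j \<noteq> e \<longrightarrow> j \<noteq> y \<longrightarrow> r' j = r j)"
proof (induction u1 arbitrary: u2 t2 r rule: rev_induct)
  case Nil
  have "exec ([Rd y] @ [Loop y body]) ((w, t2), r)
      ((butlast w, (if w = [] then [] else [0]) @ t2), r)"
    using w Nil.prems unfolding exec_append exec_Rd by (auto simp: exec_Loop fun_upd_idem)
  then show ?case using Nil.prems by auto
next
  case (snoc a u1)
  define r1 where "r1 = r(y := a)"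
  let ?t = "(w @ map Suc u1, Suc a # t2)"
  from q[of ?t r1] obtain r2 where r2: "exec q (?t, r1) (?t, r2)"
    "r2 b = Suc (prod_encode (r1 y, r1 e))" "\<forall>j<b. r2 j = r1 j" by blast
  define r3 where "r3 = r2(b + 1 := 0, e := r2 b, y := 0)"
  have r3: "r3 e = list_encode (a # u2)" "r3 y = 0" "\<forall>j<b. j \<noteq> e \<longrightarrow> j \<noteq> y \<longrightarrow> r3 j = r j"
    using r2 snoc.prems y by (auto simp: r3_def r1_def)
  from snoc.IH[OF r3(2,1), of "Suc a # t2"] obtain r' where
    r': "exec ([Rd y] @ [Loop y body]) (?t, r3)
        ((butlast w, (if w = [] then [] else [0]) @ map Suc u1 @ Suc a # t2), r')"
      "r' e = list_encode (u1 @ a # u2)" "\<forall>j<b. j \<noteq> e \<longrightarrow> j \<noteq> y \<longrightarrow> r' j = r3 j"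
    by blast
  have "exec ([Rd y] @ [Loop y body]) ((w @ map Suc (u1 @ [a]), t2), r)
        ((butlast w, (if w = [] then [] else [0]) @ map Suc u1 @ Suc a # t2), r')" (is "exec _ _ ?s'")
  proof -
    from r'(1) obtain s1 where s1: "exec [Rd y] (?t, r3) s1" "exec [Loop y body] s1 ?s'"
      unfolding exec_append by blast
    have "exec (copy b (b + 1) e @ clear y @ [Rd y]) (?t, r2) s1"
      using s1(1) y by (simp add: exec_append r3_def)
    with r2(1) have "exec body (?t, r(y := Suc a)) s1"
      unfolding body exec_Dec exec_append[of q] by (auto simp: r1_def)
    with s1(2) have "exec [Loop y body] (?t, r(y := Suc a)) ?s'"
      by (subst exec_Loop) auto
    moreover have "exec [Rd y] ((w @ map Suc (u1 @ [a]), t2), r) (?t, r(y := Suc a))"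
      using snoc.prems(1) unfolding exec_Rd by (simp add: butlast_append)
    ultimately show ?thesis unfolding exec_append by blast
  qed
  then show ?case using r'(2,3) r3(3) by auto
qed

lemma ex_encoder:
  assumes y: "e < b" "y < b" "e \<noteq> y"
  obtains p where
    "\<And>w u t2 r. w = [] \<or> last w = 0 \<Longrightarrow> \<exists>r'. exec p ((w @ map Suc u, t2), r)
        ((butlast w, (if w = [] then [] else [0]) @ map Suc u @ t2), r') \<and>
      r' e = list_encode u \<and> (\<forall>j<b. j \<noteq> e \<longrightarrow> j \<noteq> y \<longrightarrow> r' j = r j)"
proof -
  have "rep2 (\<lambda>x a. Suc (prod_encode (x, a)))"
    unfolding rep2_iff by (intro rep_intros) auto
  then obtain f where f: "\<And>x a. rec_eval f [x, a] (Suc (prod_encode (x, a)))"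
    by (auto simp: rep2_def)
  have "set [y, e] \<subseteq> {..<b + 1}" "b < b + 1" "b \<notin> set [y, e]" using y by auto
  from ex_computes[OF this] obtain q where q: "computes q f [y, e] b (b + 1)" ..
  have q': "\<exists>r'. exec q (t, r) (t, r') \<and> r' b = Suc (prod_encode (r y, r e)) \<and> (\<forall>j<b. r' j = r j)" for t r
  proof -
    have "rec_eval f (map r [y, e]) (Suc (prod_encode (r y, r e)))" using f by simp
    from computesE[OF q this] obtain r' where "exec q (t, r) (t, r')"
      "r' b = Suc (prod_encode (r y, r e))" "\<And>j. j < b + 1 \<Longrightarrow> j \<noteq> b \<Longrightarrow> r' j = r j" by metis
    then show ?thesis by (intro exI[of _ r']) auto
  qed
  define body where "body = Dec y # q @ copy b (b + 1) e @ clear y @ [Rd y]"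
  show thesis
  proof (rule that[of "clear e @ clear y @ [Rd y] @ [Loop y body]"])
    fix w u t2 r
    assume w: "w = [] \<or> last w = (0::nat)"
    obtain r' where "exec ([Rd y] @ [Loop y body]) ((w @ map Suc u, t2), r(e := 0, y := 0))
        ((butlast w, (if w = [] then [] else [0]) @ map Suc u @ t2), r')"
      "r' e = list_encode (u @ [])" "\<forall>j<b. j \<noteq> e \<longrightarrow> j \<noteq> y \<longrightarrow> r' j = (r(e := 0, y := 0)) j"
      using exec_encoder_loop[OF q' y body_def w, of "r(e := 0, y := 0)" "[]" u t2] y(3) by auto
    then show "\<exists>r'. exec (clear e @ clear y @ [Rd y] @ [Loop y body]) ((w @ map Suc u, t2), r)
        ((butlast w, (if w = [] then [] else [0]) @ map Suc u @ t2), r') \<and>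
      r' e = list_encode u \<and> (\<forall>j<b. j \<noteq> e \<longrightarrow> j \<noteq> y \<longrightarrow> r' j = r j)"
      by (intro exI[of _ r']) (auto simp: exec_append[of "clear _"])
  qed
qed

text \<open>From the right end the encoder first meets \<open>u\<close>, stops after crossing the
  separator, and then reads \<open>v\<close> up to the left end. The codes of \<open>u\<close> and
  \<open>v\<close> go to registers 0 and 1, the current letter to 2, the result to 3.\<close>

lemma ex_domain_program:
  "\<exists>p. \<forall>v u r. halts (p, (map Suc v @ 0 # map Suc u, []), r) \<longleftrightarrow>
      (\<exists>y. rec_eval f [list_encode v, list_encode u] y)"
proof -
  obtain p0 where p0: "\<And>w u t2 r. w = [] \<or> last w = 0 \<Longrightarrow> \<exists>r'. exec p0 ((w @ map Suc u, t2), r)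
        ((butlast w, (if w = [] then [] else [0]) @ map Suc u @ t2), r') \<and>
      r' 0 = list_encode u \<and> (\<forall>j<4. j \<noteq> 0 \<longrightarrow> j \<noteq> 2 \<longrightarrow> r' j = r j)"
    using ex_encoder[of 0 4 2] by (simp del: split_paired_All) blast
  obtain p1 where p1: "\<And>w u t2 r. w = [] \<or> last w = 0 \<Longrightarrow> \<exists>r'. exec p1 ((w @ map Suc u, t2), r)
        ((butlast w, (if w = [] then [] else [0]) @ map Suc u @ t2), r') \<and>
      r' 1 = list_encode u \<and> (\<forall>j<4. j \<noteq> 1 \<longrightarrow> j \<noteq> 2 \<longrightarrow> r' j = r j)"
    using ex_encoder[of 1 4 2] by (simp del: split_paired_All) blast
  have "set [1, 0] \<subseteq> {..<4::nat}" "3 < (4::nat)" "3 \<notin> set [1, 0::nat]" by auto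
  from ex_computes[OF this, of f] obtain q where q: "computes q f [1, 0] 3 4" ..
  show ?thesis
  proof (intro exI[of _ "p0 @ p1 @ q"] allI)
    fix v u and r :: "nat \<Rightarrow> nat"
    obtain r1 where r1: "exec p0 ((map Suc v @ 0 # map Suc u, []), r) ((map Suc v, 0 # map Suc u), r1)"
      "r1 0 = list_encode u"
      using p0[of "map Suc v @ [0]" u "[]" r] by auto
    obtain r2 where r2: "exec p1 ((map Suc v, 0 # map Suc u), r1) (([], map Suc v @ 0 # map Suc u), r2)"
      "r2 1 = list_encode v" "r2 0 = list_encode u"
      using p1[of "[]" v "0 # map Suc u" r1] r1(2) by auto
    have "halts (p0 @ p1 @ q, (map Suc v @ 0 # map Suc u, []), r) \<longleftrightarrow>
      (\<exists>s'. exec q (([], map Suc v @ 0 # map Suc u), r2) s')"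
      unfolding halts_def fst_conv snd_conv exec_append using r1(1) r2(1) exec_det by metis
    also have "\<dots> \<longleftrightarrow> (\<exists>y. rec_eval f (map r2 [1, 0]) y)"
      using q unfolding computes_def by blast
    finally show "halts (p0 @ p1 @ q, (map Suc v @ 0 # map Suc u, []), r) \<longleftrightarrow>
      (\<exists>y. rec_eval f [list_encode v, list_encode u] y)"
      using r2 by simp
  qed
qed

text \<open>The control state of the machine is the program that remains to be run. Finitely many such
  programs are reachable on tapes with letters at most \<open>N\<close>, so they can serve as letters of a finite
  presentation.\<close>

fun conts :: "nat \<Rightarrow> ins list \<Rightarrow> ins list set" where
  "conts N [] = {[]}"
| "conts N (Inc i # k) = insert (Inc i # k) (conts N k)"
| "conts N (Dec i # k) = insert (Dec i # k) (conts N k)"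
| "conts N (Rd i # k) = insert (Rd i # k) ((\<lambda>j. replicate j (Inc i) @ k) ` {..N} \<union> conts N k)"
| "conts N (Loop i b # k) = insert (Loop i b # k) ((\<lambda>x. x @ Loop i b # k) ` conts N b \<union> conts N k)"

lemma finite_conts: "finite (conts N p)"
  by (induction N p rule: conts.induct) auto

lemma self_in_conts: "p \<in> conts N p"
  by (cases "(N, p)" rule: conts.cases) auto

text \<open>Unfolding a loop puts its body in front of the same loop, which is again of a form
  listed in \<open>conts\<close>; hence loops create no new continuations.\<close>

lemma step_conts:
  "set t1 \<subseteq> {..N} \<Longrightarrow> p' \<in> conts N p \<Longrightarrow> fst (step (p', (t1, t2), r)) \<in> conts N p"
proof (induction N p arbitrary: p' rule: conts.induct[case_names Nil Inc Dec Rd Loop])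
  case (Rd N i k)
  from Rd.prems(2) consider "p' = Rd i # k" | j where "j \<le> N" "p' = replicate j (Inc i) @ k" | "p' \<in> conts N k"
    by auto
  then show ?case
  proof cases
    case 1
    have "last t1 \<le> N" if "t1 \<noteq> []" using that Rd.prems(1) last_in_set by blast
    then show ?thesis using 1 by (auto simp: self_in_conts)
  next
    case (2 j)
    show ?thesis
    proof (cases j)
      case 0
      then show ?thesis using 2 Rd.IH[OF Rd.prems(1) self_in_conts] by simp
    next
      case (Suc j')
      then show ?thesis using 2 by simp
    qed
  next
    case 3
    then show ?thesis using Rd.IH[OF Rd.prems(1)] by simp
  qed
next
  case (Loop N i b k)
  from Loop.prems(2) consider "p' = Loop i b # k" | y where "y \<in> conts N b" "p' = y @ Loop i b # k" |
      "p' \<in> conts N k"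
    by auto
  then show ?case
  proof cases
    case 1
    then show ?thesis by (auto simp: self_in_conts)
  next
    case (2 y)
    show ?thesis
    proof (cases "y = []")
      case True
      then show ?thesis using 2 by (auto simp: self_in_conts)
    next
      case False
      then show ?thesis using 2 Loop.IH(1)[OF Loop.prems(1) 2(1)] by (simp add: step_append)
    qed
  next
    case 3
    then show ?thesis using Loop.IH(2) Loop.prems(1) by simp
  qed
qed (auto simp: self_in_conts)

text \<open>A block is enclosed by \<open>Lend\<close> and \<open>Rend\<close> and contains one state letter: \<open>St q\<close> with the
  remaining program \<open>q\<close>, or \<open>Guess\<close> while the input is still being written. The tape letter \<open>Tp 0\<close>
  separates \<open>v\<close> from \<open>u\<close>, and \<open>Tp (Suc j)\<close> stands for the letter \<open>j\<close> of either word. The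
  cursor \<open>Cur\<close> is followed by the rest of the tape and by the registers in unary, register \<open>i\<close> being
  introduced by \<open>Bar i\<close>.\<close>

datatype sym = Gen nat | Lend | Rend | Guess | St "ins list" | Tp nat | Cur | One | Bar nat

fun is_state :: "sym \<Rightarrow> bool" where
  "is_state Guess = True"
| "is_state (St q) = True"
| "is_state _ = False"

fun is_inner :: "sym \<Rightarrow> bool" where
  "is_inner (Gen j) = False"
| "is_inner Lend = False"
| "is_inner Rend = False"
| "is_inner _ = True"

definition states_of :: "sym list \<Rightarrow> sym list" where
  "states_of = filter is_state"

definition tape_of :: "sym list \<Rightarrow> sym list" where
  "tape_of = filter (Not \<circ> is_state)"

lemma states_of_simps [simp]:
  "states_of [] = []" "states_of (a # c) = (if is_state a then a # states_of c else states_of c)"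
  "states_of (c @ d) = states_of c @ states_of d"
  by (auto simp: states_of_def)

lemma tape_of_simps [simp]:
  "tape_of [] = []" "tape_of (a # c) = (if is_state a then tape_of c else a # tape_of c)"
  "tape_of (c @ d) = tape_of c @ tape_of d"
  by (auto simp: tape_of_def)

fun reg :: "ins \<Rightarrow> nat" where
  "reg (Inc i) = i"
| "reg (Dec i) = i"
| "reg (Rd i) = i"
| "reg (Loop i b) = i"

section \<open>Tapes\<close>

text \<open>The final \<open>Bar B\<close> puts a bar after every register, so that register
  \<open>i\<close> is empty exactly when \<open>Bar i\<close> is followed by
  \<open>Bar (Suc i)\<close>.\<close>

definition counters :: "nat \<Rightarrow> nat \<Rightarrow> (nat \<Rightarrow> nat) \<Rightarrow> sym list" where
  "counters i B r = concat (map (\<lambda>j. Bar j # replicate (r j) One) [i..<B]) @ [Bar B]"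

definition before :: "nat list \<times> nat list \<Rightarrow> nat \<Rightarrow> (nat \<Rightarrow> nat) \<Rightarrow> sym list" where
  "before t i r = map Tp (fst t) @ Cur # map Tp (snd t) @ concat (map (\<lambda>j. Bar j # replicate (r j) One) [0..<i])"

definition tape :: "nat \<Rightarrow> nat list \<times> nat list \<Rightarrow> (nat \<Rightarrow> nat) \<Rightarrow> sym list" where
  "tape B t r = map Tp (fst t) @ Cur # map Tp (snd t) @ counters 0 B r"

lemma counters_Bar: "i < B \<Longrightarrow> counters i B r = Bar i # replicate (r i) One @ counters (Suc i) B r"
  by (simp add: counters_def upt_conv_Cons)

lemma counters_cases:
  assumes "i \<le> B"
  obtains d where "counters i B r = Bar i # d"
  using assms by (cases "i = B") (auto simp: counters_def upt_conv_Cons)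

lemma tape_split: "i < B \<Longrightarrow> tape B t r = before t i r @ Bar i # replicate (r i) One @ counters (Suc i) B r"
proof -
  assume "i < B"
  then have "[0..<B] = [0..<i] @ i # [Suc i..<B]"
    by (metis le_add_same_cancel1 less_imp_add_positive less_imp_le_nat upt_add_eq_append upt_conv_Cons zero_le)
  then show ?thesis by (simp add: tape_def before_def counters_def)
qed

lemma before_upd [simp]: "before t i (r(i := a)) = before t i r"
  by (auto simp: before_def intro!: arg_cong[where f = concat])

lemma counters_upd [simp]: "counters (Suc i) B (r(i := a)) = counters (Suc i) B r"
  by (auto simp: counters_def intro!: arg_cong[where f = concat])

lemma Bar_notin_before: "Bar i \<notin> set (before t i r)"
  by (auto simp: before_def)

lemma Bar_notin_counters: "i < j \<Longrightarrow> i < B \<Longrightarrow> Bar i \<notin> set (counters j B r)"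
  by (auto simp: counters_def)

lemma Cur_notin_counters: "Cur \<notin> set (counters j B r)"
  by (auto simp: counters_def)

text \<open>Each bar occurs just once on a tape, so a relation that mentions it fits in one place
  only.\<close>

lemma tape_eq_Bar:
  assumes "i < B"
  shows "c @ Bar i # d = tape B t r \<longleftrightarrow> c = before t i r \<and> d = replicate (r i) One @ counters (Suc i) B r"
proof -
  have r: "Bar i \<notin> set (replicate (r i) One @ counters (Suc i) B r)"
    using assms Bar_notin_counters by auto
  show ?thesis
    unfolding tape_split[OF assms]
    using append_Cons_eq_iff[OF Bar_notin_before r] by metis
qed

lemma tape_eq_Cur:
  "c @ Cur # d = tape B t r \<longleftrightarrow> c = map Tp (fst t) \<and> d = map Tp (snd t) @ counters 0 B r"
proof -
  have r: "Cur \<notin> set (map Tp (snd t) @ counters 0 B r)" "Cur \<notin> set (map Tp (fst t))"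
    using Cur_notin_counters by auto
  show ?thesis
    unfolding tape_def using append_Cons_eq_iff[OF r(2,1)] by metis
qed

lemma map_Tp_append_eq: "map Tp u @ Bar i # c = map Tp v @ Bar j # d \<longleftrightarrow> u = v \<and> i = j \<and> c = d"
  by (induction u arbitrary: v; case_tac v) auto

lemma One_append_eq: "replicate a One @ Bar i # c = replicate b One @ Bar j # d \<longleftrightarrow> a = b \<and> i = j \<and> c = d"
  by (induction a arbitrary: b; case_tac b) auto

lemma counters_inj:
  assumes "counters i B r = counters i B r'" "i \<le> j" "j < B"
  shows "r j = r' j"
  using assms(2) assms(1)
proof (induction i rule: inc_induct)
  case base
  obtain d d' where "counters (Suc j) B r = Bar (Suc j) # d" "counters (Suc j) B r' = Bar (Suc j) # d'"
    using counters_cases[of "Suc j" B] assms(3) by (metis Suc_leI)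
  with base assms(3) show ?case by (simp add: counters_Bar One_append_eq)
next
  case (step i)
  then have "i < B" "Suc i \<le> B" using assms(3) by auto
  moreover obtain d d' where "counters (Suc i) B r = Bar (Suc i) # d" "counters (Suc i) B r' = Bar (Suc i) # d'"
    using counters_cases[of "Suc i" B] \<open>Suc i \<le> B\<close> by metis
  ultimately show ?case using step by (simp add: counters_Bar One_append_eq)
qed

lemma tape_inj:
  assumes "tape B t r = tape B t' r'"
  shows "t = t' \<and> (\<forall>j<B. r j = r' j)"
proof -
  have "map Tp (fst t) @ Cur # map Tp (snd t) @ counters 0 B r = tape B t' r'"
    using assms by (simp add: tape_def)
  then have 1: "map Tp (fst t) = map Tp (fst t')"
    "map Tp (snd t) @ counters 0 B r = map Tp (snd t') @ counters 0 B r'"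
    unfolding tape_eq_Cur by auto
  obtain d d' where d: "counters 0 B r = Bar 0 # d" "counters 0 B r' = Bar 0 # d'"
    using counters_cases[of 0 B] by (metis zero_le)
  with 1(2) have "snd t = snd t'" "counters 0 B r = counters 0 B r'"
    by (auto simp: map_Tp_append_eq)
  moreover have "fst t = fst t'" using 1(1) by (metis inj_def inj_map_eq_map sym.inject(3))
  ultimately show ?thesis using counters_inj by (auto simp: prod_eq_iff)
qed

section \<open>The value of a block\<close>

definition wpart :: "nat list \<Rightarrow> nat list" where
  "wpart w = map (\<lambda>a. a - 1) (takeWhile (\<lambda>a. a \<noteq> 0) w)"

definition upart :: "nat list \<Rightarrow> nat list" where
  "upart w = map (\<lambda>a. a - 1) (tl (dropWhile (\<lambda>a. a \<noteq> 0) w))"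

text \<open>Exactly one separator; a tape without this shape never carries a value.\<close>

definition proper :: "nat list \<Rightarrow> bool" where
  "proper w \<longleftrightarrow> (\<exists>v u. w = map Suc v @ 0 # map Suc u)"

lemma parts [simp]:
  "wpart (map Suc v @ 0 # map Suc u) = v" "upart (map Suc v @ 0 # map Suc u) = u"
  "proper (map Suc v @ 0 # map Suc u)"
  by (auto simp: wpart_def upart_def proper_def takeWhile_append dropWhile_append comp_def)

lemma proper_Cons_Suc: "proper (Suc j # w) \<longleftrightarrow> proper w"
proof
  assume "proper (Suc j # w)"
  then obtain v u where "Suc j # w = map Suc v @ 0 # map Suc u" by (auto simp: proper_def)
  then show "proper w" by (cases v) auto
next
  assume "proper w"
  then obtain v u where "w = map Suc v @ 0 # map Suc u" by (auto simp: proper_def)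
  then have "Suc j # w = map Suc (j # v) @ 0 # map Suc u" by simp
  then show "proper (Suc j # w)" unfolding proper_def by blast
qed

lemma parts_Cons_Suc [simp]: "wpart (Suc j # w) = j # wpart w" "upart (Suc j # w) = upart w"
  by (auto simp: wpart_def upart_def)

text \<open>\<open>None\<close> is an identity adjoined to \<open>S\<close>, the value of a block whose word \<open>v\<close> is empty.\<close>

definition omult :: "'b sgrp \<Rightarrow> 'b option \<Rightarrow> 'b option \<Rightarrow> 'b option" where
  "omult S g h = (case g of None \<Rightarrow> h | Some a \<Rightarrow> (case h of None \<Rightarrow> g | Some b \<Rightarrow> Some (a \<cdot>\<^bsub>S\<^esub> b)))"

definition ocarrier :: "'b sgrp \<Rightarrow> 'b option set" where
  "ocarrier S = insert None (Some ` carrier S)"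

definition olength :: "('b \<Rightarrow> nat) \<Rightarrow> 'b option \<Rightarrow> nat" where
  "olength l g = (case g of None \<Rightarrow> 0 | Some a \<Rightarrow> l a)"

definition oproj :: "'b sgrp \<Rightarrow> (nat \<Rightarrow> 'b) \<Rightarrow> nat list \<Rightarrow> 'b option" where
  "oproj S x v = (if v = [] then None else Some (proj S x v))"

lemma omult_simps [simp]: "omult S None h = h" "omult S g None = g"
  "omult S (Some a) (Some b) = Some (a \<cdot>\<^bsub>S\<^esub> b)"
  by (auto simp: omult_def split: option.splits)

lemma (in sgrp) omult_assoc:
  "\<lbrakk>g \<in> ocarrier S; h \<in> ocarrier S; k \<in> ocarrier S\<rbrakk>
    \<Longrightarrow> omult S (omult S g h) k = omult S g (omult S h k)"
  by (auto simp: ocarrier_def assoc)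

lemma (in sgrp) omult_closed: "\<lbrakk>g \<in> ocarrier S; h \<in> ocarrier S\<rbrakk> \<Longrightarrow> omult S g h \<in> ocarrier S"
  by (auto simp: ocarrier_def closed)

text \<open>The bound \<open>max m n\<close> is the largest letter after the shift by one. Only
  leading instructions are required to address a register below \<open>B\<close>, since a relation
  concerns just the next step.\<close>

locale length_machine = sgrp S for S :: "'b sgrp" (structure) +
  fixes m n B :: nat and x :: "nat \<Rightarrow> 'b" and l :: "'b \<Rightarrow> nat"
    and T :: "(nat list \<times> nat list) set" and p :: "ins list" and Q :: "ins list set"
  assumes m: "1 \<le> m" and x: "x \<in> {..<m} \<rightarrow> carrier S"
    and onto: "carrier S = proj S x ` free_sg m"
    and l_pos: "g \<in> carrier S \<Longrightarrow> 1 \<le> l g"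
    and l_mult: "\<lbrakk>g \<in> carrier S; h \<in> carrier S\<rbrakk> \<Longrightarrow> l (g \<cdot> h) \<le> l g + l h"
    and T_subset: "T \<subseteq> free_sg m \<times> free_sg n"
    and T_unique: "\<lbrakk>(v1, u) \<in> T; (v2, u) \<in> T\<rbrakk> \<Longrightarrow> proj S x v1 = proj S x v2"
    and T_common: "\<lbrakk>v1 \<in> free_sg m; v2 \<in> free_sg m; proj S x v1 = proj S x v2\<rbrakk>
        \<Longrightarrow> \<exists>u. (v1, u) \<in> T \<and> (v2, u) \<in> T"
    and T_least: "v \<in> free_sg m \<Longrightarrow> l (proj S x v) = (LEAST k. \<exists>u. (v, u) \<in> T \<and> length u = k)"
    and Q: "finite Q" "p \<in> Q" "[] \<in> Q"
    and Q_step: "\<lbrakk>q \<in> Q; set t1 \<subseteq> {..max m n}\<rbrakk> \<Longrightarrow> fst (step (q, (t1, t2), r)) \<in> Q"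
    and Q_reg: "i # k \<in> Q \<Longrightarrow> reg i < B"
    and halts_p: "halts (p, (map Suc v @ 0 # map Suc u, []), r) \<longleftrightarrow> (v, u) \<in> T"
begin

definition N where "N = max m n"

text \<open>Exhibits in one factor that the cursor stands at the right end and that all registers
  are empty, the condition for starting a run.\<close>

definition blank where "blank = Cur # map Bar [0..<Suc B]"

lemma blank_eq_tape: "blank = tape B ([], []) (\<lambda>_. 0)"
  by (simp add: blank_def tape_def counters_def concat_map_singleton)

text \<open>In the type \<open>'b option option\<close>, the outer \<open>None\<close> means that there is no value at all.\<close>

definition wval :: "nat list \<Rightarrow> 'b option option" where
  "wval v = (if set v \<subseteq> {..<m} then Some (oproj S x v) else None)"

text \<open>By \<open>T_unique\<close> the value does not depend on the choice of
  \<open>v\<close>.\<close>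

definition uval :: "nat list \<Rightarrow> 'b option option" where
  "uval u = (if \<exists>v. (v, u) \<in> T then Some (Some (proj S x (SOME v. (v, u) \<in> T))) else None)"

text \<open>\<open>Guess\<close> insists on an empty tape to the right of the cursor: otherwise a
  guessed letter could land left of the separator and change \<open>v\<close>.\<close>

definition cval :: "sym \<Rightarrow> nat list \<times> nat list \<Rightarrow> (nat \<Rightarrow> nat) \<Rightarrow> 'b option option" where
  "cval \<sigma> t r = (let w = fst t @ snd t in if proper w then
     (case \<sigma> of Guess \<Rightarrow> if snd t = [] then wval (wpart w) else None
      | St q \<Rightarrow> if halts (q, t, r) then uval (upart w) else wval (wpart w)
      | _ \<Rightarrow> None) else None)"

text \<open>Registers from \<open>B\<close> on do not show on the tape; fixing them at 0 makes the
  configuration unique.\<close>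

definition is_config :: "sym list \<Rightarrow> sym \<Rightarrow> nat list \<times> nat list \<Rightarrow> (nat \<Rightarrow> nat) \<Rightarrow> bool" where
  "is_config c \<sigma> t r \<longleftrightarrow> states_of c = [\<sigma>] \<and> tape_of c = tape B t r \<and> (\<forall>j\<ge>B. r j = 0)"

definition has_val :: "sym list \<Rightarrow> 'b option \<Rightarrow> bool" where
  "has_val c y \<longleftrightarrow> (\<exists>\<sigma> t r. is_config c \<sigma> t r \<and> cval \<sigma> t r = Some y)"

definition bval :: "sym list \<Rightarrow> 'b option option" where
  "bval c = (if \<exists>y. has_val c y then Some (THE y. has_val c y) else None)"

lemma is_config_unique:
  "is_config c \<sigma> t r \<Longrightarrow> is_config c \<sigma>' t' r' \<Longrightarrow> \<sigma> = \<sigma>' \<and> t = t' \<and> r = r'"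
proof -
  assume "is_config c \<sigma> t r" "is_config c \<sigma>' t' r'"
  then have *: "tape B t r = tape B t' r'" "\<sigma> = \<sigma>'" "\<And>j. j \<ge> B \<Longrightarrow> r j = r' j"
    by (auto simp: is_config_def)
  from tape_inj[OF *(1)] *(3) have "r = r'" by (metis ext not_le)
  with tape_inj[OF *(1)] *(2) show ?thesis by blast
qed

lemma has_val_unique: "has_val c y \<Longrightarrow> has_val c y' \<Longrightarrow> y = y'"
proof -
  assume "has_val c y" "has_val c y'"
  then obtain \<sigma> t r \<sigma>' t' r' where "is_config c \<sigma> t r" "cval \<sigma> t r = Some y"
    "is_config c \<sigma>' t' r'" "cval \<sigma>' t' r' = Some y'" by (auto simp: has_val_def)
  with is_config_unique[of c \<sigma> t r \<sigma>' t' r'] show ?thesis by simp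
qed

lemma bval_eq_Some: "bval c = Some y \<longleftrightarrow> has_val c y"
  unfolding bval_def using has_val_unique by (metis option.inject option.distinct(1) theI)

lemma bval_eqI: "(\<And>y. has_val c y \<longleftrightarrow> has_val d y) \<Longrightarrow> bval c = bval d"
  by (metis bval_eq_Some option.exhaust)

lemma step_tape: "fst (fst (snd (step (q, t, r)))) @ snd (fst (snd (step (q, t, r)))) = fst t @ snd t"
  by (cases "(q, t, r)" rule: step.cases) auto

text \<open>A configuration halts iff its successor does, and the cursor moves along an unchanged
  tape. The equality is symmetric, so backward applications of a relation are covered too.\<close>

lemma cval_step:
  assumes "step (q, t, r) = (q', t', r')"
  shows "cval (St q') t' r' = cval (St q) t r"
proof -
  have "fst t' @ snd t' = fst t @ snd t" using step_tape[of q t r] assms by simp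
  moreover have "halts (q', t', r') \<longleftrightarrow> halts (q, t, r)" using halts_step[of "(q, t, r)"] assms by simp
  ultimately show ?thesis by (simp only: cval_def sym.case)
qed

text \<open>The contexts \<open>c\<close> and \<open>d\<close> are words of tape letters: a state letter may be anywhere in a
  block, so it is kept apart from the tape.\<close>

definition tape_rule :: "sym \<Rightarrow> sym list \<Rightarrow> sym \<Rightarrow> sym list \<Rightarrow> bool" where
  "tape_rule \<sigma> a \<sigma>' a' \<longleftrightarrow> (\<forall>c d t r. c @ a @ d = tape B t r \<longrightarrow> (\<forall>j\<ge>B. r j = 0) \<longrightarrow>
     (\<exists>t' r'. c @ a' @ d = tape B t' r' \<and> (\<forall>j\<ge>B. r' j = 0) \<and> cval \<sigma>' t' r' = cval \<sigma> t r))"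

text \<open>A block with a value has exactly one state letter, so the context contributes tape
  letters only, and it is enough to compare tapes.\<close>

lemma has_val_rule:
  assumes "tape_rule \<sigma> (tape_of a) \<sigma>' (tape_of a')" "states_of a = [\<sigma>]" "states_of a' = [\<sigma>']"
    and "has_val (c @ a @ d) y"
  shows "has_val (c @ a' @ d) y"
proof -
  obtain \<tau> t r where *: "is_config (c @ a @ d) \<tau> t r" "cval \<tau> t r = Some y"
    using assms(4) by (auto simp: has_val_def)
  then have st: "states_of c = []" "states_of d = []" "\<tau> = \<sigma>"
    using assms(2) by (auto simp: is_config_def append_eq_Cons_conv)
  from * have "tape_of c @ tape_of a @ tape_of d = tape B t r" "\<forall>j\<ge>B. r j = 0"
    by (auto simp: is_config_def)
  with assms(1) obtain t' r' where "tape_of c @ tape_of a' @ tape_of d = tape B t' r'"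
    "\<forall>j\<ge>B. r' j = 0" "cval \<sigma>' t' r' = cval \<sigma> t r"
    unfolding tape_rule_def by blast
  then have "is_config (c @ a' @ d) \<sigma>' t' r' \<and> cval \<sigma>' t' r' = Some y"
    using st assms(3) * by (auto simp: is_config_def)
  then show ?thesis unfolding has_val_def by blast
qed

lemma bval_rule:
  assumes "tape_rule \<sigma> (tape_of a) \<sigma>' (tape_of a')" "tape_rule \<sigma>' (tape_of a') \<sigma> (tape_of a)"
    and "states_of a = [\<sigma>]" "states_of a' = [\<sigma>']"
  shows "bval (c @ a @ d) = bval (c @ a' @ d)"
  using has_val_rule[of \<sigma> a \<sigma>' a'] has_val_rule[of \<sigma>' a' \<sigma> a] assms by (intro bval_eqI) blast

lemma tape_rule_Bar:
  assumes "i < B"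
    and "\<And>t r k e. k = r i \<Longrightarrow> a @ e = replicate k One @ counters (Suc i) B r \<Longrightarrow>
      \<exists>k'. a' @ e = replicate k' One @ counters (Suc i) B r \<and> cval \<sigma>' t (r(i := k')) = cval \<sigma> t r"
  shows "tape_rule \<sigma> (Bar i # a) \<sigma>' (Bar i # a')"
  unfolding tape_rule_def
proof (intro allI impI)
  fix c d t r
  assume "c @ (Bar i # a) @ d = tape B t r" and r: "\<forall>j\<ge>B. r j = 0"
  then have c: "c = before t i r" "a @ d = replicate (r i) One @ counters (Suc i) B r"
    using tape_eq_Bar[OF assms(1), of c "a @ d" t r] by auto
  from assms(2)[OF _ c(2), of t] obtain k' where
    "a' @ d = replicate k' One @ counters (Suc i) B r" "cval \<sigma>' t (r(i := k')) = cval \<sigma> t r" by auto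
  then show "\<exists>t' r'. c @ (Bar i # a') @ d = tape B t' r' \<and> (\<forall>j\<ge>B. r' j = 0) \<and> cval \<sigma>' t' r' = cval \<sigma> t r"
    using assms(1) r c(1) by (intro exI[of _ t] exI[of _ "r(i := k')"]) (auto simp: tape_split)
qed

lemma One_Cons_eq:
  assumes "i < B"
  shows "One # e = replicate k One @ counters (Suc i) B r \<longleftrightarrow>
    (\<exists>k'. k = Suc k' \<and> e = replicate k' One @ counters (Suc i) B r)"
proof -
  obtain d where "counters (Suc i) B r = Bar (Suc i) # d"
    using counters_cases[of "Suc i" B r] assms by (metis Suc_leI)
  then show ?thesis by (cases k) auto
qed

lemma Bar_Cons_eq:
  assumes "i < B"
  shows "Bar j # e = replicate k One @ counters (Suc i) B r \<Longrightarrow> k = 0"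
  by (cases k) auto

text \<open>Read backwards, it also covers the decrement of a positive register and the emptying of
  registers after halting.\<close>

lemma tape_rule_push:
  assumes "i < B" "\<And>t r. cval \<sigma>' t (r(i := Suc (r i))) = cval \<sigma> t r"
  shows "tape_rule \<sigma> [Bar i] \<sigma>' [Bar i, One]" "tape_rule \<sigma>' [Bar i, One] \<sigma> [Bar i]"
proof -
  show "tape_rule \<sigma> [Bar i] \<sigma>' [Bar i, One]"
    using assms by (intro tape_rule_Bar) (auto simp: One_Cons_eq)
  have *: "cval \<sigma> t (r(i := k)) = cval \<sigma>' t r" if "r i = Suc k" for t r k
    using assms(2)[of t "r(i := k)"] that by (simp add: fun_upd_idem)
  show "tape_rule \<sigma>' [Bar i, One] \<sigma> [Bar i]"
    using assms(1) by (intro tape_rule_Bar) (auto simp: One_Cons_eq intro!: *)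
qed

lemma tape_rule_zero:
  assumes "i < B" "\<And>t r. r i = 0 \<Longrightarrow> cval \<sigma>' t r = cval \<sigma> t r"
  shows "tape_rule \<sigma> [Bar i, Bar j] \<sigma>' [Bar i, Bar j]"
proof -
  have *: "\<exists>k'. [Bar j] @ e = replicate k' One @ counters (Suc i) B r \<and> cval \<sigma>' t (r(i := k')) = cval \<sigma> t r"
    if "k = r i" "[Bar j] @ e = replicate k One @ counters (Suc i) B r" for t r k e
  proof -
    have "k = 0" using that(2) assms(1) Bar_Cons_eq by simp
    with that assms(2)[of r t] show ?thesis by (intro exI[of _ 0]) (simp add: fun_upd_idem)
  qed
  show ?thesis by (rule tape_rule_Bar[OF assms(1) *])
qed

lemma tape_rule_nonzero:
  assumes "i < B" "\<And>t r. r i \<noteq> 0 \<Longrightarrow> cval \<sigma>' t r = cval \<sigma> t r"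
  shows "tape_rule \<sigma> [Bar i, One] \<sigma>' [Bar i, One]"
proof -
  have *: "\<exists>k'. [One] @ e = replicate k' One @ counters (Suc i) B r \<and> cval \<sigma>' t (r(i := k')) = cval \<sigma> t r"
    if "k = r i" "[One] @ e = replicate k One @ counters (Suc i) B r" for t r k e
  proof -
    have "k \<noteq> 0" using that(2) assms(1) One_Cons_eq[OF assms(1), of e k r] by auto
    with that assms(2)[of r t] show ?thesis by (intro exI[of _ k]) (simp add: fun_upd_idem)
  qed
  show ?thesis by (rule tape_rule_Bar[OF assms(1) *])
qed

lemma tape_rule_cursor:
  assumes "\<And>t1 t2 r. cval \<sigma>' (t1, a # t2) r = cval \<sigma> (t1 @ [a], t2) r"
  shows "tape_rule \<sigma> [Tp a, Cur] \<sigma>' [Cur, Tp a]" "tape_rule \<sigma>' [Cur, Tp a] \<sigma> [Tp a, Cur]"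
proof -
  have 1: "c @ [Tp a, Cur] @ d = tape B t r \<longleftrightarrow>
      (\<exists>t1. fst t = t1 @ [a] \<and> c = map Tp t1 \<and> d = map Tp (snd t) @ counters 0 B r)" for c d t r
  proof -
    have "c @ [Tp a] = map Tp (fst t) \<longleftrightarrow> (\<exists>t1. fst t = t1 @ [a] \<and> c = map Tp t1)"
      by (cases "fst t" rule: rev_cases) auto
    then show ?thesis using tape_eq_Cur[of "c @ [Tp a]" d B t r] by auto
  qed
  have 2: "c @ [Cur, Tp a] @ d = tape B t r \<longleftrightarrow>
      (\<exists>t2. snd t = a # t2 \<and> c = map Tp (fst t) \<and> d = map Tp t2 @ counters 0 B r)" for c d t r
  proof -
    obtain e where "counters 0 B r = Bar 0 # e" by (rule counters_cases[of 0 B r]) simp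
    then have "Tp a # d = map Tp (snd t) @ counters 0 B r \<longleftrightarrow>
        (\<exists>t2. snd t = a # t2 \<and> d = map Tp t2 @ counters 0 B r)"
      by (cases "snd t") auto
    then show ?thesis using tape_eq_Cur[of c "Tp a # d" B t r] by auto
  qed
  show "tape_rule \<sigma> [Tp a, Cur] \<sigma>' [Cur, Tp a]"
    unfolding tape_rule_def 1 2
  proof (intro allI impI)
    fix c d t r
    assume "\<exists>t1. fst t = t1 @ [a] \<and> c = map Tp t1 \<and> d = map Tp (snd t) @ counters 0 B r"
      and r: "\<forall>j\<ge>B. r j = 0"
    then obtain t1 where "fst t = t1 @ [a]" "c = map Tp t1" "d = map Tp (snd t) @ counters 0 B r" by blast
    then show "\<exists>t' r'. (\<exists>t2. snd t' = a # t2 \<and> c = map Tp (fst t') \<and> d = map Tp t2 @ counters 0 B r') \<and>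
        (\<forall>j\<ge>B. r' j = 0) \<and> cval \<sigma>' t' r' = cval \<sigma> t r"
      using r assms[of t1 "snd t" r] by (intro exI[of _ "(t1, a # snd t)"] exI[of _ r]) (cases t, simp)
  qed
  show "tape_rule \<sigma>' [Cur, Tp a] \<sigma> [Tp a, Cur]"
    unfolding tape_rule_def 1 2
  proof (intro allI impI)
    fix c d t r
    assume "\<exists>t2. snd t = a # t2 \<and> c = map Tp (fst t) \<and> d = map Tp t2 @ counters 0 B r"
      and r: "\<forall>j\<ge>B. r j = 0"
    then obtain t2 where "snd t = a # t2" "c = map Tp (fst t)" "d = map Tp t2 @ counters 0 B r" by blast
    then show "\<exists>t' r'. (\<exists>t1. fst t' = t1 @ [a] \<and> c = map Tp t1 \<and> d = map Tp (snd t') @ counters 0 B r') \<and>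
        (\<forall>j\<ge>B. r' j = 0) \<and> cval \<sigma> t' r' = cval \<sigma>' t r"
      using r assms[of "fst t" t2 r] by (intro exI[of _ "(fst t @ [a], t2)"] exI[of _ r]) (cases t, simp)
  qed
qed

lemma tape_rule_refl: "(\<And>t r. cval \<sigma>' t r = cval \<sigma> t r) \<Longrightarrow> tape_rule \<sigma> a \<sigma>' a"
  unfolding tape_rule_def by blast

text \<open>The empty program has halted whatever the store, so only \<open>u\<close> counts:
  registers, cursor and \<open>v\<close> may change as long as one separator remains.\<close>

lemma cval_Nil_state:
  "cval (St []) t r = (if proper (fst t @ snd t) then uval (upart (fst t @ snd t)) else None)"
  by (auto simp: cval_def halts_def)

section \<open>The rewriting system\<close>

definition states where "states = insert Guess (St ` Q)"

definition tape_letters where "tape_letters = insert Cur (insert One (Tp ` {..N} \<union> Bar ` {..B}))"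

text \<open>Since state letters move freely inside a block, a machine instruction needs only a relation
  that applies when the state letter is next to the place where the tape changes.\<close>

definition commute_rules where
  "commute_rules = (\<lambda>(s, a). ([s, a], [a, s])) ` (states \<times> tape_letters)"

text \<open>A block is created with one letter of \<open>v\<close> already on its tape, because
  without an identity there is no word in the generators that a block with empty \<open>v\<close>
  could replace. Generators further to the left are absorbed one at a time.\<close>

definition input_rules where
  "input_rules = (\<lambda>j. ([Gen j], Lend # Guess # Tp (Suc j) # Tp 0 # blank @ [Rend])) ` {..<m} \<union>
     (\<lambda>j. ([Gen j, Lend, Guess], [Lend, Guess, Tp (Suc j)])) ` {..<m} \<union>
     (\<lambda>j. ([Guess, Cur], [Tp (Suc j), Guess, Cur])) ` {..<n} \<union>
     {(Guess # blank, St p # blank)}"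

text \<open>The halting state \<open>St []\<close> erases \<open>v\<close>, clears the registers and moves the cursor back, so
  that only \<open>u\<close> is left.\<close>

fun machine_rules :: "ins list \<Rightarrow> (sym list \<times> sym list) set" where
  "machine_rules (Inc i # k) = {([Bar i, St (Inc i # k)], [Bar i, St k, One])}"
| "machine_rules (Dec i # k) = {([Bar i, St (Dec i # k), One], [Bar i, St k]),
     ([Bar i, St (Dec i # k), Bar (Suc i)], [Bar i, St k, Bar (Suc i)])}"
| "machine_rules (Rd i # k) = insert ([Lend, St (Rd i # k), Cur], [Lend, St k, Cur])
     ((\<lambda>a. ([Tp a, St (Rd i # k), Cur], [St (replicate a (Inc i) @ k), Cur, Tp a])) ` {..N})"
| "machine_rules (Loop i b # k) = {([Bar i, St (Loop i b # k), One], [Bar i, St (b @ Loop i b # k), One]),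
     ([Bar i, St (Loop i b # k), Bar (Suc i)], [Bar i, St k, Bar (Suc i)])}"
| "machine_rules [] = (\<lambda>j. ([Lend, St [], Tp (Suc j)], [Lend, St []])) ` {..<N} \<union>
     (\<lambda>a. ([Tp a, St [], Cur], [St [], Cur, Tp a])) ` {..N} \<union>
     (\<lambda>i. ([Bar i, St [], One], [Bar i, St []])) ` {..<B}"

definition rules where
  "rules = commute_rules \<union> input_rules \<union> \<Union> (machine_rules ` Q)"

definition alphabet where
  "alphabet = {Lend, Rend} \<union> Gen ` {..<m} \<union> states \<union> tape_letters"

lemma finite_rules: "finite rules"
proof -
  have "finite (machine_rules q)" for q
    by (cases q rule: machine_rules.cases) auto
  then show ?thesis
    using Q(1) by (simp add: rules_def commute_rules_def input_rules_def states_def tape_letters_def)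
qed

lemma finite_alphabet: "finite alphabet"
  using Q(1) by (simp add: alphabet_def states_def tape_letters_def)

end

section \<open>Soundness of the relations inside a block\<close>

lemma proper_snoc_Suc: "proper (w @ [Suc j]) \<longleftrightarrow> proper w"
proof
  assume "proper (w @ [Suc j])"
  then obtain v u where *: "w @ [Suc j] = map Suc v @ 0 # map Suc u" by (auto simp: proper_def)
  then show "proper w" by (cases u rule: rev_cases) (auto simp: proper_def)
next
  assume "proper w"
  then obtain v u where "w = map Suc v @ 0 # map Suc u" by (auto simp: proper_def)
  then have "w @ [Suc j] = map Suc v @ 0 # map Suc (u @ [j])" by simp
  then show "proper (w @ [Suc j])" unfolding proper_def by blast
qed

lemma wpart_snoc_Suc: "proper w \<Longrightarrow> wpart (w @ [Suc j]) = wpart w"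
  by (auto simp: proper_def wpart_def takeWhile_append)

lemma blank_prefix_counters:
  "i \<le> B \<Longrightarrow> map Bar [i..<Suc B] @ d = counters i B r \<Longrightarrow> i \<le> j \<Longrightarrow> j < B \<Longrightarrow> r j = 0"
proof (induction i rule: inc_induct)
  case (step i)
  have "i < B" "map Bar [i..<Suc B] = Bar i # Bar (Suc i) # map Bar [Suc (Suc i)..<Suc B]"
    using step.hyps by (simp_all add: upt_conv_Cons del: upt_Suc)
  with step.prems(1) have i: "r i = 0"
    by (cases "r i") (auto simp: counters_Bar simp del: upt_Suc)
  have "map Bar [i..<Suc B] = Bar i # map Bar [Suc i..<Suc B]"
    using step.hyps by (simp add: upt_conv_Cons del: upt_Suc)
  with step.prems(1) i \<open>i < B\<close> have "map Bar [Suc i..<Suc B] @ d = counters (Suc i) B r"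
    by (simp add: counters_Bar del: upt_Suc)
  then show ?case using step i by (cases "j = i") auto
qed simp

context length_machine
begin

lemma tape_rule_guess:
  "tape_rule Guess [Cur] Guess [Tp (Suc j), Cur]" "tape_rule Guess [Tp (Suc j), Cur] Guess [Cur]"
proof -
  have cval: "cval Guess (t1 @ [Suc j], t2) r = cval Guess (t1, t2) r" for t1 t2 r
    using proper_snoc_Suc[of t1 j] wpart_snoc_Suc[of t1 j] by (simp add: cval_def Let_def)
  have 1: "c @ [Tp (Suc j), Cur] @ d = tape B t r \<longleftrightarrow>
      (\<exists>t1. fst t = t1 @ [Suc j] \<and> c = map Tp t1 \<and> d = map Tp (snd t) @ counters 0 B r)" for c d t r
  proof -
    have "c @ [Tp (Suc j)] = map Tp (fst t) \<longleftrightarrow> (\<exists>t1. fst t = t1 @ [Suc j] \<and> c = map Tp t1)"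
      by (cases "fst t" rule: rev_cases) auto
    then show ?thesis using tape_eq_Cur[of "c @ [Tp (Suc j)]" d B t r] by auto
  qed
  have 2: "c @ [Cur] @ d = tape B t r \<longleftrightarrow> c = map Tp (fst t) \<and> d = map Tp (snd t) @ counters 0 B r" for c d t r
    using tape_eq_Cur[of c d B t r] by simp
  show "tape_rule Guess [Cur] Guess [Tp (Suc j), Cur]"
    unfolding tape_rule_def 1 2
  proof (intro allI impI)
    fix c d t r
    assume "c = map Tp (fst t) \<and> d = map Tp (snd t) @ counters 0 B r" and r: "\<forall>j\<ge>B. r j = 0"
    then show "\<exists>t' r'. (\<exists>t1. fst t' = t1 @ [Suc j] \<and> c = map Tp t1 \<and> d = map Tp (snd t') @ counters 0 B r') \<and>
        (\<forall>j\<ge>B. r' j = 0) \<and> cval Guess t' r' = cval Guess t r"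
      using cval[of "fst t" "snd t" r] by (intro exI[of _ "(fst t @ [Suc j], snd t)"] exI[of _ r]) simp
  qed
  show "tape_rule Guess [Tp (Suc j), Cur] Guess [Cur]"
    unfolding tape_rule_def 1 2
  proof (intro allI impI)
    fix c d t r
    assume "\<exists>t1. fst t = t1 @ [Suc j] \<and> c = map Tp t1 \<and> d = map Tp (snd t) @ counters 0 B r"
      and r: "\<forall>j\<ge>B. r j = 0"
    then obtain t1 where "fst t = t1 @ [Suc j]" "c = map Tp t1" "d = map Tp (snd t) @ counters 0 B r" by blast
    then show "\<exists>t' r'. (c = map Tp (fst t') \<and> d = map Tp (snd t') @ counters 0 B r') \<and>
        (\<forall>j\<ge>B. r' j = 0) \<and> cval Guess t' r' = cval Guess t r"
      using r cval[of t1 "snd t" r] by (intro exI[of _ "(t1, snd t)"] exI[of _ r]) (cases t, simp)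
  qed
qed

lemma uval_eq: "(v, u) \<in> T \<Longrightarrow> uval u = Some (Some (proj S x v))"
proof -
  assume v: "(v, u) \<in> T"
  then have "(SOME v. (v, u) \<in> T, u) \<in> T" by (rule someI)
  from T_unique[OF this v] v show ?thesis unfolding uval_def by auto
qed

lemma tape_blank_split:
  assumes "c @ blank @ d = tape B t r"
  shows "snd t = []" "j < B \<Longrightarrow> r j = 0"
proof -
  have *: "map Bar [0..<Suc B] @ d = map Tp (snd t) @ counters 0 B r"
    using assms tape_eq_Cur[of c "map Bar [0..<Suc B] @ d" B t r] by (simp add: blank_def del: upt_Suc)
  have "map Bar [0..<Suc B] = Bar 0 # map Bar [1..<Suc B]"
    by (simp add: upt_conv_Cons del: upt_Suc)
  with * show 1: "snd t = []" by (cases "snd t") (auto simp del: upt_Suc)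
  show "r j = 0" if "j < B" using blank_prefix_counters[of 0 B d r j] * 1 that by simp
qed

text \<open>\<open>blank\<close> forces the registers and the tape right of the cursor to be empty,
  so the state \<open>St p\<close> stands in a genuine initial configuration and
  \<open>halts_p\<close> applies.\<close>

lemma tape_rule_start: "tape_rule Guess blank (St p) blank" "tape_rule (St p) blank Guess blank"
proof -
  have "cval (St p) t r = cval Guess t r"
    if "c @ blank @ d = tape B t r" "\<forall>j\<ge>B. r j = 0" for c d t r
  proof (cases "proper (fst t)")
    case True
    then obtain v u where w: "fst t = map Suc v @ 0 # map Suc u" by (auto simp: proper_def)
    have t: "t = (map Suc v @ 0 # map Suc u, [])"
      using w tape_blank_split(1)[OF that(1)] by (cases t) simp
    show ?thesis
    proof (cases "(v, u) \<in> T")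
      case True
      then have "v \<in> free_sg m" using T_subset by auto
      then have "wval v = Some (Some (proj S x v))" by (auto simp: wval_def words_iff oproj_def)
      with True show ?thesis by (simp add: cval_def Let_def t halts_p uval_eq)
    next
      case False
      then show ?thesis by (simp add: cval_def Let_def t halts_p)
    qed
  next
    case False
    then show ?thesis using tape_blank_split(1)[OF that(1)] by (simp add: cval_def Let_def)
  qed
  then show "tape_rule Guess blank (St p) blank" "tape_rule (St p) blank Guess blank"
    unfolding tape_rule_def by metis+
qed

text \<open>The analogue of \<open>tape_rule\<close> for relations whose sides start with \<open>Lend\<close>, which fit at the
  left end of a tape only.\<close>

definition head_rule :: "sym \<Rightarrow> sym list \<Rightarrow> sym \<Rightarrow> sym list \<Rightarrow> bool" where
  "head_rule \<sigma> a \<sigma>' a' \<longleftrightarrow> (\<forall>d t r. a @ d = tape B t r \<longrightarrow> (\<forall>j\<ge>B. r j = 0) \<longrightarrow>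
     (\<exists>t' r'. a' @ d = tape B t' r' \<and> (\<forall>j\<ge>B. r' j = 0) \<and> cval \<sigma>' t' r' = cval \<sigma> t r))"

lemma has_val_head_rule:
  assumes "head_rule \<sigma> (tape_of a) \<sigma>' (tape_of a')" "states_of a = [\<sigma>]" "states_of a' = [\<sigma>']"
    and "has_val (a @ d) y"
  shows "has_val (a' @ d) y"
proof -
  obtain \<tau> t r where *: "is_config (a @ d) \<tau> t r" "cval \<tau> t r = Some y"
    using assms(4) by (auto simp: has_val_def)
  then have st: "states_of d = []" "\<tau> = \<sigma>"
    using assms(2) by (auto simp: is_config_def)
  from * have "tape_of a @ tape_of d = tape B t r" "\<forall>j\<ge>B. r j = 0"
    by (auto simp: is_config_def)
  with assms(1) obtain t' r' where "tape_of a' @ tape_of d = tape B t' r'"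
    "\<forall>j\<ge>B. r' j = 0" "cval \<sigma>' t' r' = cval \<sigma> t r"
    unfolding head_rule_def by blast
  then have "is_config (a' @ d) \<sigma>' t' r' \<and> cval \<sigma>' t' r' = Some y"
    using st assms(3) * by (auto simp: is_config_def)
  then show ?thesis unfolding has_val_def by blast
qed

lemma bval_head_rule:
  assumes "head_rule \<sigma> (tape_of a) \<sigma>' (tape_of a')" "head_rule \<sigma>' (tape_of a') \<sigma> (tape_of a)"
    and "states_of a = [\<sigma>]" "states_of a' = [\<sigma>']"
  shows "bval (a @ d) = bval (a' @ d)"
  using has_val_head_rule[of \<sigma> a \<sigma>' a'] has_val_head_rule[of \<sigma>' a' \<sigma> a] assms
  by (intro bval_eqI) blast

lemma Cons_Tp_eq_tape:
  "Tp a # d = tape B t r \<longleftrightarrow> (\<exists>t1. fst t = a # t1 \<and> d = tape B (t1, snd t) r)"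
  by (cases "fst t") (auto simp: tape_def)

text \<open>At the left end of a proper tape a nonzero letter can only belong to \<open>v\<close>,
  so erasing or inserting it there keeps the separator and \<open>u\<close>.\<close>

lemma head_rule_erase:
  "head_rule (St []) [Tp (Suc j)] (St []) []" "head_rule (St []) [] (St []) [Tp (Suc j)]"
proof -
  have *: "cval (St []) (Suc j # t1, t2) r = cval (St []) (t1, t2) r'" for t1 t2 r r'
    by (simp add: cval_Nil_state proper_Cons_Suc)
  show "head_rule (St []) [Tp (Suc j)] (St []) []"
    unfolding head_rule_def
  proof (intro allI impI)
    fix d t r
    assume "[Tp (Suc j)] @ d = tape B t r" and r: "\<forall>j\<ge>B. r j = 0"
    then obtain t1 where "fst t = Suc j # t1" "d = tape B (t1, snd t) r"
      by (auto simp: Cons_Tp_eq_tape)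
    then show "\<exists>t' r'. [] @ d = tape B t' r' \<and> (\<forall>j\<ge>B. r' j = 0) \<and> cval (St []) t' r' = cval (St []) t r"
      using r *[of t1 "snd t" r] by (intro exI[of _ "(t1, snd t)"] exI[of _ r]) (cases t, simp)
  qed
  show "head_rule (St []) [] (St []) [Tp (Suc j)]"
    unfolding head_rule_def
  proof (intro allI impI)
    fix d t r
    assume "[] @ d = tape B t r" and r: "\<forall>j\<ge>B. r j = 0"
    then show "\<exists>t' r'. [Tp (Suc j)] @ d = tape B t' r' \<and> (\<forall>j\<ge>B. r' j = 0) \<and>
        cval (St []) t' r' = cval (St []) t r"
      using *[of "fst t" "snd t" r r]
      by (intro exI[of _ "(Suc j # fst t, snd t)"] exI[of _ r]) (simp add: Cons_Tp_eq_tape)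
  qed
qed

lemma head_rule_Cur:
  assumes "\<And>t2 r. cval \<sigma>' ([], t2) r = cval \<sigma> ([], t2) r"
  shows "head_rule \<sigma> [Cur] \<sigma>' [Cur]"
  unfolding head_rule_def
proof (intro allI impI)
  fix d t r
  assume d: "[Cur] @ d = tape B t r" and r: "\<forall>j\<ge>B. r j = 0"
  then have "fst t = []" using tape_eq_Cur[of "[]" d B t r] by simp
  then have "cval \<sigma>' t r = cval \<sigma> t r" using assms[of "snd t" r] by (cases t) simp
  then show "\<exists>t' r'. [Cur] @ d = tape B t' r' \<and> (\<forall>j\<ge>B. r' j = 0) \<and> cval \<sigma>' t' r' = cval \<sigma> t r"
    using d r by blast
qed

text \<open>Nonempty sides matter outside a block, where the first inner letter of either side makes
  the reading fail.\<close>

definition block_rule :: "sym list \<Rightarrow> sym list \<Rightarrow> bool" where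
  "block_rule a a' \<longleftrightarrow> a \<noteq> [] \<and> a' \<noteq> [] \<and> (\<forall>s\<in>set a \<union> set a'. is_inner s) \<and>
     (\<forall>c d. bval (c @ a @ d) = bval (c @ a' @ d))"

definition start_rule :: "sym list \<Rightarrow> sym list \<Rightarrow> bool" where
  "start_rule a a' \<longleftrightarrow> (\<forall>s\<in>set a \<union> set a'. is_inner s) \<and> (\<forall>d. bval (a @ d) = bval (a' @ d))"

lemma block_ruleI:
  assumes "tape_rule \<sigma> (tape_of a) \<sigma>' (tape_of a')" "tape_rule \<sigma>' (tape_of a') \<sigma> (tape_of a)"
    and "states_of a = [\<sigma>]" "states_of a' = [\<sigma>']" "\<forall>s\<in>set a \<union> set a'. is_inner s"
  shows "block_rule a a'"
  unfolding block_rule_def using bval_rule[OF assms(1-4)] assms(3-5) by auto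

lemma start_ruleI:
  assumes "head_rule \<sigma> (tape_of a) \<sigma>' (tape_of a')" "head_rule \<sigma>' (tape_of a') \<sigma> (tape_of a)"
    and "states_of a = [\<sigma>]" "states_of a' = [\<sigma>']" "\<forall>s\<in>set a \<union> set a'. is_inner s"
  shows "start_rule a a'"
  unfolding start_rule_def using bval_head_rule[OF assms(1-4)] assms(5) by auto

lemma states_of_blank [simp]: "states_of blank = []" and tape_of_blank [simp]: "tape_of blank = blank"
  and inner_blank: "s \<in> set blank \<Longrightarrow> is_inner s"
  by (auto simp: blank_def states_of_def tape_of_def filter_empty_conv filter_id_conv)

lemma block_rule_commute:
  assumes "is_state s" "is_inner s" "\<not> is_state a" "is_inner a"
  shows "block_rule [s, a] [a, s]"
  using assms by (intro block_ruleI[where \<sigma> = s and \<sigma>' = s] tape_rule_refl) (auto intro: tape_rule_refl)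

lemma block_rule_guess: "block_rule [Guess, Cur] [Tp (Suc j), Guess, Cur]"
  using tape_rule_guess[of j] by (intro block_ruleI[where \<sigma> = Guess and \<sigma>' = Guess]) auto

lemma block_rule_start: "block_rule (Guess # blank) (St p # blank)"
  using tape_rule_start by (intro block_ruleI[where \<sigma> = Guess and \<sigma>' = "St p"]) (auto intro: inner_blank)

text \<open>An instruction splits into relations according to the outcome of its test, and under
  that outcome \<open>cval_step\<close> equates the values. The halted state needs
  \<open>cval_Nil_state\<close> instead, since its relations are no machine steps.\<close>

lemma machine_rules_cases:
  assumes "q \<in> Q" "(a, a') \<in> machine_rules q"
  shows "block_rule a a' \<or> (\<exists>c c'. a = Lend # c \<and> a' = Lend # c' \<and> start_rule c c')"
  using assms(2)
proof (cases q rule: machine_rules.cases)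
  case (1 i k)
  have i: "i < B" using Q_reg assms(1) 1 by force
  have "cval (St k) t (r(i := Suc (r i))) = cval (St q) t r" for t r
    using 1 by (intro cval_step) simp
  from tape_rule_push[OF i this] show ?thesis
    using assms(2) 1 by (auto intro!: block_ruleI)
next
  case (2 i k)
  have i: "i < B" using Q_reg assms(1) 2 by force
  have "cval (St q) t (r(i := Suc (r i))) = cval (St k) t r" for t r
    using 2 by (intro cval_step[symmetric]) simp
  note push = tape_rule_push[OF i this]
  have *: "cval (St k) t r = cval (St q) t r" if "r i = 0" for t r
    using 2 that by (intro cval_step) (simp add: fun_upd_idem)
  note zero = tape_rule_zero[OF i *] tape_rule_zero[OF i *[symmetric]]
  from push zero show ?thesis
    using assms(2) 2 by (auto intro!: block_ruleI)
next
  case (3 i k)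
  have "cval (St (replicate a (Inc i) @ k)) (t1, a # t2) r = cval (St q) (t1 @ [a], t2) r" for a t1 t2 r
    using 3 by (intro cval_step) simp
  note cursor = tape_rule_cursor[OF this]
  have *: "cval (St k) ([], t2) r = cval (St q) ([], t2) r" for t2 r
    using 3 by (intro cval_step) simp
  note head = head_rule_Cur[OF *] head_rule_Cur[OF *[symmetric]]
  have "start_rule [St q, Cur] [St k, Cur]"
    using head by (intro start_ruleI) auto
  moreover have "block_rule [Tp b, St q, Cur] [St (replicate b (Inc i) @ k), Cur, Tp b]" for b
    using cursor by (intro block_ruleI) auto
  ultimately show ?thesis using assms(2) 3 by auto
next
  case (4 i b k)
  have i: "i < B" using Q_reg assms(1) 4 by force
  have *: "cval (St k) t r = cval (St q) t r" if "r i = 0" for t r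
    using 4 that by (intro cval_step) simp
  note zero = tape_rule_zero[OF i *] tape_rule_zero[OF i *[symmetric]]
  have *: "cval (St (b @ Loop i b # k)) t r = cval (St q) t r" if "r i \<noteq> 0" for t r
    using 4 that by (intro cval_step) simp
  note nonzero = tape_rule_nonzero[OF i *] tape_rule_nonzero[OF i *[symmetric]]
  from zero nonzero show ?thesis
    using assms(2) 4 by (auto intro!: block_ruleI)
next
  case 5
  have "start_rule [St [], Tp (Suc j)] [St []]" for j
    using head_rule_erase by (intro start_ruleI) auto
  moreover have "block_rule [Tp b, St [], Cur] [St [], Cur, Tp b]" for b
  proof -
    have "cval (St []) (t1, b # t2) r = cval (St []) (t1 @ [b], t2) r" for t1 t2 r
      by (simp add: cval_Nil_state)
    from tape_rule_cursor[OF this] show ?thesis by (intro block_ruleI) auto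
  qed
  moreover have "block_rule [Bar i, St [], One] [Bar i, St []]" if "i < B" for i
  proof -
    have "cval (St []) t (r(i := Suc (r i))) = cval (St []) t r" for t r
      by (simp add: cval_Nil_state)
    from tape_rule_push[OF that this] show ?thesis by (intro block_ruleI) auto
  qed
  ultimately show ?thesis using assms(2) 5 by auto
qed

lemma oproj_Cons: 
  assumes "j < m" "set v \<subseteq> {..<m}"
  shows "oproj S x (j # v) = omult S (Some (x j)) (oproj S x v)"
proof (cases "v = []")
  case False
  then have "map x v \<in> words (carrier S)" using map_in_words[OF x] assms by (simp add: words_iff)
  moreover have "x j \<in> carrier S" using x assms by auto
  ultimately show ?thesis using False by (simp add: oproj_def proj_def word_prod_Cons)
qed (simp add: oproj_def)

lemma oproj_closed: "set v \<subseteq> {..<m} \<Longrightarrow> oproj S x v \<in> ocarrier S"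
  using proj_closed[OF x, of v] by (auto simp: oproj_def ocarrier_def words_iff)

text \<open>A generator to the left of the block becomes a factor inside it. In state
  \<open>Guess\<close> the value comes from \<open>v\<close> alone, where prepending a letter is
  multiplication from the left.\<close>

lemma bval_input:
  assumes "j < m"
  shows "bval (Guess # Tp (Suc j) # d) = map_option (omult S (Some (x j))) (bval (Guess # d))"
proof -
  have wval: "wval (j # v) = map_option (omult S (Some (x j))) (wval v)" for v
    using assms oproj_Cons[of j v] by (simp add: wval_def)
  have cval: "cval Guess (Suc j # t1, t2) r = map_option (omult S (Some (x j))) (cval Guess (t1, t2) r)" for t1 t2 r
    by (simp add: cval_def Let_def proper_Cons_Suc wval)
  have "is_config (Guess # Tp (Suc j) # d) \<sigma> t r \<longleftrightarrow>
      (\<exists>t1. fst t = Suc j # t1 \<and> is_config (Guess # d) \<sigma> (t1, snd t) r)" for \<sigma> t r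
    by (auto simp: is_config_def Cons_Tp_eq_tape)
  moreover have "\<sigma> = Guess" if "is_config (Guess # d) \<sigma> t r" for \<sigma> t r
    using that by (auto simp: is_config_def)
  ultimately have config: "is_config (Guess # Tp (Suc j) # d) \<sigma> t r \<longleftrightarrow>
      \<sigma> = Guess \<and> (\<exists>t1. fst t = Suc j # t1 \<and> is_config (Guess # d) Guess (t1, snd t) r)" for \<sigma> t r
    by metis
  have *: "has_val (Guess # Tp (Suc j) # d) y \<longleftrightarrow>
      (\<exists>y'. has_val (Guess # d) y' \<and> y = omult S (Some (x j)) y')" for y
  proof
    assume "has_val (Guess # Tp (Suc j) # d) y"
    then obtain t r t1 where t: "cval Guess t r = Some y" "fst t = Suc j # t1" "is_config (Guess # d) Guess (t1, snd t) r"
      unfolding has_val_def config by blast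
    then have "map_option (omult S (Some (x j))) (cval Guess (t1, snd t) r) = Some y"
      using cval[of t1 "snd t" r] by (cases t) simp
    then show "\<exists>y'. has_val (Guess # d) y' \<and> y = omult S (Some (x j)) y'"
      using t(3) unfolding has_val_def by auto
  next
    assume "\<exists>y'. has_val (Guess # d) y' \<and> y = omult S (Some (x j)) y'"
    then obtain y' \<sigma> t r where y: "y = omult S (Some (x j)) y'" and
      t: "is_config (Guess # d) \<sigma> t r" "cval \<sigma> t r = Some y'"
      unfolding has_val_def by blast
    from t(1) have "\<sigma> = Guess" by (auto simp: is_config_def)
    with t y have "is_config (Guess # Tp (Suc j) # d) Guess (Suc j # fst t, snd t) r"
        "cval Guess (Suc j # fst t, snd t) r = Some y"
      unfolding config cval by auto
    then show "has_val (Guess # Tp (Suc j) # d) y" unfolding has_val_def by blast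
  qed
  show ?thesis
  proof (cases "bval (Guess # d)")
    case None
    then have "bval (Guess # Tp (Suc j) # d) \<noteq> Some y" for y
      unfolding bval_eq_Some * by (metis bval_eq_Some option.distinct(1))
    with None show ?thesis by (cases "bval (Guess # Tp (Suc j) # d)") auto
  next
    case (Some y)
    then have "has_val (Guess # Tp (Suc j) # d) (omult S (Some (x j)) y)"
      unfolding * using bval_eq_Some by blast
    with Some show ?thesis by (simp add: bval_eq_Some[symmetric])
  qed
qed

lemma bval_create:
  assumes "j < m"
  shows "bval (Guess # Tp (Suc j) # Tp 0 # blank) = Some (Some (x j))"
proof -
  have "tape B ([Suc j, 0], []) (\<lambda>_. 0) = Tp (Suc j) # Tp 0 # blank"
    by (simp add: blank_eq_tape tape_def)
  then have "is_config (Guess # Tp (Suc j) # Tp 0 # blank) Guess ([Suc j, 0], []) (\<lambda>_. 0)"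
    by (simp add: is_config_def)
  moreover have "cval Guess ([Suc j, 0], []) (\<lambda>_. 0) = Some (Some (x j))"
    using parts[of "[j]" "[]"] assms by (simp add: cval_def Let_def wval_def oproj_def)
  ultimately show ?thesis unfolding bval_eq_Some has_val_def by blast
qed

section \<open>The length of a block and the length of its value\<close>

text \<open>Registers and the cursor only lengthen a block, so the two words on its tape together
  fit into it, whichever of them gives the value.\<close>

lemma has_val_cases:
  assumes "has_val c y"
  obtains v u where "length v + length u \<le> length c" "uval u = Some y \<or> wval v = Some y"
proof -
  obtain \<sigma> t r where *: "is_config c \<sigma> t r" "cval \<sigma> t r = Some y"
    using assms by (auto simp: has_val_def)
  then obtain v u where w: "fst t @ snd t = map Suc v @ 0 # map Suc u"
    by (auto simp: cval_def proper_def Let_def split: if_splits)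
  have "length v + length u \<le> length (fst t @ snd t)" unfolding w by simp
  also have "\<dots> \<le> length (tape_of c)" using *(1) by (simp add: is_config_def tape_def)
  also have "\<dots> \<le> length c" by (simp add: tape_of_def)
  finally have 1: "length v + length u \<le> length c" .
  have "uval u = Some y \<or> wval v = Some y"
    using *(2) unfolding cval_def w Let_def parts by (cases \<sigma>) (auto split: if_splits)
  with 1 show thesis by (rule that)
qed

lemma bval_closed: "bval c = Some y \<Longrightarrow> y \<in> ocarrier S"
proof -
  assume "bval c = Some y"
  then have "has_val c y" by (simp add: bval_eq_Some)
  then obtain v u where "uval u = Some y \<or> wval v = Some y" by (rule has_val_cases)
  then show ?thesis
  proof
    assume "uval u = Some y"
    then obtain v where v: "(v, u) \<in> T" by (auto simp: uval_def split: if_splits)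
    with \<open>uval u = Some y\<close> have "y = Some (proj S x v)" by (simp add: uval_eq)
    then show ?thesis using v T_subset proj_closed[OF x, of v] by (auto simp: ocarrier_def)
  next
    assume "wval v = Some y"
    then show ?thesis using oproj_closed[of v] by (auto simp: wval_def split: if_splits)
  qed
qed

text \<open>A letter of \<open>v\<close> adds at most the largest length of a generator, a letter of
  \<open>u\<close> at most 1 by (D3); \<open>K\<close> covers both.\<close>

definition K where "K = Max (insert 1 (l ` x ` {..<m}))"

lemma K: "1 \<le> K" "j < m \<Longrightarrow> l (x j) \<le> K"
  by (auto simp: K_def)

lemma olength_omult:
  "\<lbrakk>g \<in> ocarrier S; h \<in> ocarrier S\<rbrakk> \<Longrightarrow> olength l (omult S g h) \<le> olength l g + olength l h"
  using l_mult by (auto simp: ocarrier_def olength_def)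

lemma olength_oproj: "set v \<subseteq> {..<m} \<Longrightarrow> olength l (oproj S x v) \<le> K * length v"
proof (induction v)
  case (Cons j v)
  then have "x j \<in> carrier S" "l (x j) \<le> K" using x K by auto
  with Cons olength_omult[of "Some (x j)" "oproj S x v"] oproj_closed[of v] show ?case
    by (simp add: oproj_Cons) (auto simp: ocarrier_def olength_def)
qed (simp add: oproj_def olength_def)

lemma l_le_length: "(v, u) \<in> T \<Longrightarrow> l (proj S x v) \<le> length u"
proof -
  assume v: "(v, u) \<in> T"
  then have "l (proj S x v) = (LEAST k. \<exists>u. (v, u) \<in> T \<and> length u = k)"
    using T_subset by (intro T_least) auto
  also have "\<dots> \<le> length u" using v by (intro Least_le) blast
  finally show ?thesis .
qed

lemma olength_bval: "bval c = Some y \<Longrightarrow> olength l y \<le> K * length c"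
proof -
  assume "bval c = Some y"
  then have "has_val c y" by (simp add: bval_eq_Some)
  then obtain v u where len: "length v + length u \<le> length c" and "uval u = Some y \<or> wval v = Some y"
    by (rule has_val_cases)
  from this(2) have "olength l y \<le> K * (length v + length u)"
  proof
    assume "uval u = Some y"
    then obtain v where v: "(v, u) \<in> T" by (auto simp: uval_def split: if_splits)
    with \<open>uval u = Some y\<close> have "y = Some (proj S x v)" by (simp add: uval_eq)
    then have "olength l y \<le> length u" using l_le_length[OF v] by (simp add: olength_def)
    also have "\<dots> \<le> K * length u" using K(1) by simp
    finally show ?thesis by (simp add: add_mult_distrib2)
  next
    assume "wval v = Some y"
    then show ?thesis
      using olength_oproj[of v] by (auto simp: wval_def add_mult_distrib2 split: if_splits)
  qed
  also have "\<dots> \<le> K * length c" using len by simp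
  finally show ?thesis .
qed

end

section \<open>The value of a word\<close>

text \<open>Relations cut through blocks, as \<open>[Gen j, Lend, Guess]\<close> does, so a word
  need not have a value of its own. It acts instead on the states of an evaluation from left to
  right: outside blocks with a product, inside a block with the product before it and its contents
  so far, or failed.\<close>

datatype 'b reading = Fail | Out "'b option" | In "'b option" "sym list"

context length_machine
begin

fun read :: "'b reading \<Rightarrow> sym \<Rightarrow> 'b reading" where
  "read Fail a = Fail"
| "read (Out g) (Gen j) = (if j < m then Out (omult S g (Some (x j))) else Fail)"
| "read (Out g) Lend = In g []"
| "read (Out g) a = Fail"
| "read (In g c) (Gen j) = Fail"
| "read (In g c) Lend = Fail"
| "read (In g c) Rend = (case bval c of None \<Rightarrow> Fail | Some h \<Rightarrow> Out (omult S g h))"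
| "read (In g c) a = In g (c @ [a])"

text \<open>The readings before and after a relation has been applied inside an unfinished block differ,
  but they agree on every completion of the block.\<close>

definition similar :: "'b reading \<Rightarrow> 'b reading \<Rightarrow> bool" where
  "similar z z' \<longleftrightarrow> z = z' \<or> (\<exists>g c g' c'. z = In g c \<and> z' = In g' c' \<and>
     (\<forall>d. map_option (omult S g) (bval (c @ d)) = map_option (omult S g') (bval (c' @ d))))"

text \<open>Associativity of \<open>omult\<close> is available on \<open>ocarrier S\<close> only,
  hence this invariant of the evaluation.\<close>

fun good :: "'b reading \<Rightarrow> bool" where
  "good Fail = True"
| "good (Out g) = (g \<in> ocarrier S)"
| "good (In g c) = (g \<in> ocarrier S)"

lemma read_inner [simp]: "is_inner a \<Longrightarrow> read (In g c) a = In g (c @ [a])"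
  by (cases a) auto

lemma read_Out_inner [simp]: "is_inner a \<Longrightarrow> read (Out g) a = Fail"
  by (cases a) auto

lemma foldl_read_Fail [simp]: "foldl read Fail w = Fail"
  by (induction w) auto

lemma foldl_read_inner: "\<forall>s\<in>set a. is_inner s \<Longrightarrow> foldl read (In g c) a = In g (c @ a)"
  by (induction a arbitrary: c) auto

lemma good_read: "good z \<Longrightarrow> good (read z a)"
proof (cases z)
  case (Out g)
  assume "good z"
  moreover have "Some (x j) \<in> ocarrier S" if "j < m" for j
    using x that by (auto simp: ocarrier_def)
  ultimately show ?thesis using Out by (cases a) (auto intro: omult_closed)
next
  case (In g c)
  assume "good z"
  with In show ?thesis by (cases a) (auto intro: omult_closed bval_closed split: option.splits)
qed simp

lemma good_foldl: "good z \<Longrightarrow> good (foldl read z w)"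
  by (induction w arbitrary: z) (auto intro: good_read)

lemma similar_sym: "similar z z' \<Longrightarrow> similar z' z"
  unfolding similar_def by metis

lemma similar_trans: "similar z z' \<Longrightarrow> similar z' z'' \<Longrightarrow> similar z z''"
  unfolding similar_def by (elim disjE exE conjE) auto

lemma similar_read: "similar z z' \<Longrightarrow> similar (read z a) (read z' a)"
proof (cases "z = z'")
  case False
  assume "similar z z'"
  with False obtain g c g' c' where z: "z = In g c" "z' = In g' c'"
    "\<And>d. map_option (omult S g) (bval (c @ d)) = map_option (omult S g') (bval (c' @ d))"
    by (auto simp: similar_def)
  show ?thesis
  proof (cases "a = Rend")
    case True
    then show ?thesis using z(3)[of "[]"] unfolding z(1,2)
      by (cases "bval c"; cases "bval c'") (auto simp: similar_def)
  next
    case False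
    then consider "is_inner a" | "\<And>g c. read (In g c) a = Fail" by (cases a) auto
    then show ?thesis
    proof cases
      case 1
      have "map_option (omult S g) (bval (c @ [a] @ d)) = map_option (omult S g') (bval (c' @ [a] @ d))" for d
        by (rule z(3))
      with 1 z show ?thesis by (auto simp: similar_def)
    qed (simp add: z similar_def)
  qed
qed (simp add: similar_def)

lemma similar_foldl: "similar z z' \<Longrightarrow> similar (foldl read z w) (foldl read z' w)"
  by (induction w arbitrary: z z') (auto intro: similar_read)

lemma block_rule_similar:
  assumes "block_rule a a'"
  shows "similar (foldl read z a) (foldl read z a')"
proof -
  have a: "a \<noteq> []" "a' \<noteq> []" "\<forall>s\<in>set a. is_inner s" "\<forall>s\<in>set a'. is_inner s"
    "\<And>c d. bval (c @ a @ d) = bval (c @ a' @ d)"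
    using assms by (auto simp: block_rule_def)
  have Out: "foldl read (Out g) c = Fail" if "c \<noteq> []" "\<forall>s\<in>set c. is_inner s" for g c
    using that by (cases c) auto
  show ?thesis
  proof (cases z)
    case (In g c)
    then show ?thesis using a by (auto simp: foldl_read_inner similar_def)
  qed (use a Out in \<open>auto simp: similar_def\<close>)
qed

lemma start_rule_similar:
  assumes "start_rule c c'"
  shows "similar (foldl read z (Lend # c)) (foldl read z (Lend # c'))"
  using assms by (cases z) (auto simp: start_rule_def foldl_read_inner similar_def)

lemma rule_similar:
  assumes "(a, a') \<in> rules" "good z"
  shows "similar (foldl read z a) (foldl read z a')"
proof -
  have inner: "\<forall>s\<in>set blank. is_inner s" by (simp add: inner_blank)
  have create: "similar (foldl read z [Gen j]) (foldl read z (Lend # Guess # Tp (Suc j) # Tp 0 # blank @ [Rend]))"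
    if j: "j < m" for j
    using j by (cases z) (auto simp: similar_def foldl_read_inner[OF inner] bval_create)
  have absorb: "similar (foldl read z [Gen j, Lend, Guess]) (foldl read z [Lend, Guess, Tp (Suc j)])" if j: "j < m" for j
  proof (cases z)
    case (Out g)
    \<comment> \<open>The two sides place \<open>x j\<close> in the outer product and in the block
      respectively; only the products after completion of the block agree.\<close>
    have "map_option (omult S (omult S g (Some (x j)))) (bval (Guess # d)) =
        map_option (omult S g) (bval (Guess # Tp (Suc j) # d))" for d
    proof -
      have "Some (x j) \<in> ocarrier S" "g \<in> ocarrier S"
        using x j assms(2) Out by (auto simp: ocarrier_def)
      then show ?thesis
        using bval_closed[of "Guess # d"] by (cases "bval (Guess # d)") (auto simp: bval_input[OF j] omult_assoc)
    qed
    then show ?thesis using j Out by (simp add: similar_def)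
  qed (auto simp: similar_def)
  have "block_rule a a'" if "(a, a') \<in> commute_rules"
    using that by (auto simp: commute_rules_def states_def tape_letters_def intro!: block_rule_commute)
  moreover have "block_rule a a' \<or> (\<exists>c c'. a = Lend # c \<and> a' = Lend # c' \<and> start_rule c c')"
    if "(a, a') \<in> \<Union> (machine_rules ` Q)"
    using that machine_rules_cases by blast
  moreover have "similar (foldl read z a) (foldl read z a')" if "(a, a') \<in> input_rules"
    using that create absorb block_rule_similar[OF block_rule_guess] block_rule_similar[OF block_rule_start]
    by (auto simp: input_rules_def simp del: foldl.simps)
  ultimately show ?thesis
    using assms(1) block_rule_similar start_rule_similar unfolding rules_def by blast
qed

text \<open>Every letter pays \<open>K\<close>. The payment for the contents of a block is held back
  until the block is closed and its value joins the product.\<close>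

lemma olength_read:
  "(foldl read (Out None) w = Out g \<longrightarrow> olength l g \<le> K * length w) \<and>
   (foldl read (Out None) w = In g c \<longrightarrow> olength l g + K * length c \<le> K * length w)"
proof (induction w arbitrary: g c rule: rev_induct)
  case Nil
  then show ?case by (simp add: olength_def)
next
  case (snoc a w)
  have good: "good (foldl read (Out None) w)" by (rule good_foldl) (simp add: ocarrier_def)
  show ?case
  proof (cases "foldl read (Out None) w")
    case Fail
    then show ?thesis by simp
  next
    case (Out h)
    have h: "olength l h \<le> K * length w" "h \<in> ocarrier S" using snoc.IH Out good by auto
    show ?thesis
    proof (cases a)
      case (Gen j)
      have "olength l (omult S h (Some (x j))) \<le> K * length w + K" if "j < m"
      proof -
        have "Some (x j) \<in> ocarrier S" using x that by (auto simp: ocarrier_def)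
        from olength_omult[OF h(2) this] h(1) K(2)[OF that] show ?thesis by (simp add: olength_def)
      qed
      with Gen Out show ?thesis by (auto simp: add.commute)
    qed (use Out h in auto)
  next
    case (In h d)
    have h: "olength l h + K * length d \<le> K * length w" "h \<in> ocarrier S" using snoc.IH In good by auto
    consider "a = Rend" | "is_inner a" | "read (In h d) a = Fail" by (cases a) auto
    then show ?thesis
    proof cases
      case 1
      have "olength l (omult S h y) \<le> K * length w" if "bval d = Some y" for y
        using olength_omult[OF h(2) bval_closed[OF that]] olength_bval[OF that] h(1) by linarith
      with 1 In show ?thesis by (auto split: option.splits intro: le_trans)
    qed (use In h in auto)
  qed
qed

end

section \<open>Derivations and the embedding\<close>

context length_machine
begin

text \<open>Suitable tapes and registers provoke each outcome of an instruction, so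
  \<open>Q_step\<close> yields all successors.\<close>

lemma Q_closed:
  "Inc i # q \<in> Q \<Longrightarrow> q \<in> Q" "Dec i # q \<in> Q \<Longrightarrow> q \<in> Q" "Rd i # q \<in> Q \<Longrightarrow> q \<in> Q"
  "Rd i # q \<in> Q \<Longrightarrow> a \<le> N \<Longrightarrow> replicate a (Inc i) @ q \<in> Q"
  "Loop i b # q \<in> Q \<Longrightarrow> q \<in> Q" "Loop i b # q \<in> Q \<Longrightarrow> b @ Loop i b # q \<in> Q"
proof -
  fix r :: "nat \<Rightarrow> nat"
  show "Inc i # q \<in> Q \<Longrightarrow> q \<in> Q" using Q_step[of "Inc i # q" "[]" "[]" r] by simp
  show "Dec i # q \<in> Q \<Longrightarrow> q \<in> Q" using Q_step[of "Dec i # q" "[]" "[]" r] by simp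
  show "Rd i # q \<in> Q \<Longrightarrow> q \<in> Q" using Q_step[of "Rd i # q" "[]" "[]" r] by simp
  show "Rd i # q \<in> Q \<Longrightarrow> a \<le> N \<Longrightarrow> replicate a (Inc i) @ q \<in> Q"
    using Q_step[of "Rd i # q" "[a]" "[]" r] by (simp add: N_def)
  show "Loop i b # q \<in> Q \<Longrightarrow> q \<in> Q" using Q_step[of "Loop i b # q" "[]" "[]" "\<lambda>_. 0"] by simp
  show "Loop i b # q \<in> Q \<Longrightarrow> b @ Loop i b # q \<in> Q"
    using Q_step[of "Loop i b # q" "[]" "[]" "\<lambda>_. 1"] by simp
qed

lemma blank_letters: "set blank \<subseteq> tape_letters"
  by (auto simp: blank_def tape_letters_def)

lemma letters_le_N: "j < m \<Longrightarrow> Suc j \<le> N" "j < n \<Longrightarrow> Suc j \<le> N"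
  by (auto simp: N_def)

lemma machine_rules_subset:
  assumes "q \<in> Q"
  shows "machine_rules q \<subseteq> words alphabet \<times> words alphabet"
proof (cases q rule: machine_rules.cases)
  case (1 i k)
  then show ?thesis using assms Q_reg[of "Inc i" k] Q_closed(1)[of i k]
    by (auto simp: words_iff alphabet_def states_def tape_letters_def)
next
  case (2 i k)
  then show ?thesis using assms Q_reg[of "Dec i" k] Q_closed(2)[of i k]
    by (auto simp: words_iff alphabet_def states_def tape_letters_def)
next
  case (3 i k)
  then show ?thesis using assms Q_closed(3,4)[of i k]
    by (auto simp: words_iff alphabet_def states_def tape_letters_def)
next
  case (4 i b k)
  then show ?thesis using assms Q_reg[of "Loop i b" k] Q_closed(5,6)[of i b k]
    by (auto simp: words_iff alphabet_def states_def tape_letters_def)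
next
  case 5
  then show ?thesis using assms by (auto simp: words_iff alphabet_def states_def tape_letters_def)
qed

lemma rules_subset: "rules \<subseteq> words alphabet \<times> words alphabet"
proof -
  have "commute_rules \<subseteq> words alphabet \<times> words alphabet"
    by (auto simp: commute_rules_def words_iff alphabet_def)
  moreover have "set blank \<subseteq> alphabet" using blank_letters by (auto simp: alphabet_def)
  then have "input_rules \<subseteq> words alphabet \<times> words alphabet"
    using letters_le_N Q(2) 
    by (auto simp: input_rules_def words_iff alphabet_def states_def tape_letters_def)
  ultimately show ?thesis using machine_rules_subset unfolding rules_def by blast
qed

section \<open>The presentation with numbered letters\<close>

definition rank where "rank = card alphabet"

definition code where "code = (SOME e. bij_betw e alphabet {0..<rank})"

definition decode where "decode = inv_into alphabet code"

definition relators where "relators = (\<lambda>(a, b). (map code a, map code b)) ` rules"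

lemma code: "bij_betw code alphabet {..<rank}"
  unfolding code_def rank_def atLeast0LessThan[symmetric]
  using ex_bij_betw_finite_nat[OF finite_alphabet] by (rule someI_ex)

lemma decode_code: "set a \<subseteq> alphabet \<Longrightarrow> map decode (map code a) = a"
  using code by (auto simp: decode_def bij_betw_def intro!: map_idI)

lemma map_code_words: "a \<in> words alphabet \<Longrightarrow> map code a \<in> free_sg rank"
  using code by (auto simp: words_iff bij_betw_def)

lemma rank_pos: "1 \<le> rank"
  unfolding rank_def using finite_alphabet by (auto simp: alphabet_def Suc_le_eq card_gt_0_iff)

lemma relators_subset: "relators \<subseteq> free_sg rank \<times> free_sg rank"
  using rules_subset map_code_words by (fastforce simp: relators_def)

lemma finite_relators: "finite relators"
  using finite_rules by (simp add: relators_def)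

text \<open>The initial reading is arbitrary because in a product the second factor starts from
  whatever reading the first one leaves.\<close>

lemma sg_cong_similar:
  "(a, b) \<in> sg_cong rank relators \<Longrightarrow> good z \<Longrightarrow>
    similar (foldl read z (map decode a)) (foldl read z (map decode b))"
proof (induction arbitrary: z rule: sg_cong.induct)
  case (base a b)
  then obtain a' b' where ab: "(a', b') \<in> rules" "a = map code a'" "b = map code b'"
    by (auto simp: relators_def)
  from subsetD[OF rules_subset ab(1)] have "set a' \<subseteq> alphabet" "set b' \<subseteq> alphabet"
    by (simp_all add: words_iff)
  then show ?case using ab rule_similar[OF ab(1) base.prems] decode_code by metis
next
  case (refl a)
  then show ?case by (simp add: similar_def)
next
  case (sym a b)
  then show ?case by (blast intro: similar_sym)
next
  case (trans a b c)
  then show ?case by (blast intro: similar_trans)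
next
  case (mult a b a' b')
  have "similar (foldl read (foldl read z (map decode a)) (map decode a'))
      (foldl read (foldl read z (map decode b)) (map decode a'))"
    using mult by (blast intro: similar_foldl)
  moreover have "similar (foldl read (foldl read z (map decode b)) (map decode a'))
      (foldl read (foldl read z (map decode b)) (map decode b'))"
    using mult good_foldl by blast
  ultimately show ?case by (auto intro: similar_trans)
qed

definition cong :: "sym list \<Rightarrow> sym list \<Rightarrow> bool" where
  "cong a b \<longleftrightarrow> (map code a, map code b) \<in> sg_cong rank relators"

lemma cong_rule: "(a, b) \<in> rules \<Longrightarrow> cong a b"
  unfolding cong_def by (rule sg_cong.base) (auto simp: relators_def intro: rev_image_eqI)

lemma cong_refl: "a \<in> words alphabet \<Longrightarrow> cong a a"
  unfolding cong_def by (intro sg_cong.refl map_code_words)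

lemma cong_sym: "cong a b \<Longrightarrow> cong b a"
  unfolding cong_def by (rule sg_cong.sym)

lemma cong_trans [trans]: "cong a b \<Longrightarrow> cong b c \<Longrightarrow> cong a c"
  unfolding cong_def by (rule sg_cong.trans)

lemma cong_mult: "cong a b \<Longrightarrow> cong a' b' \<Longrightarrow> cong (a @ a') (b @ b')"
  unfolding cong_def map_append by (rule sg_cong.mult)

lemma cong_context:
  assumes "cong a b" "set c \<subseteq> alphabet" "set d \<subseteq> alphabet"
  shows "cong (c @ a @ d) (c @ b @ d)"
proof -
  have "cong (a @ d) (b @ d)"
    using assms cong_mult[OF assms(1) cong_refl[of d]] by (cases "d = []") (auto simp: words_iff)
  then show ?thesis
    using assms cong_mult[OF cong_refl[of c]] by (cases "c = []") (auto simp: words_iff)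
qed

lemma cong_move:
  "\<sigma> \<in> states \<Longrightarrow> set c \<subseteq> tape_letters \<Longrightarrow> cong (\<sigma> # c) (c @ [\<sigma>])"
proof (induction c)
  case Nil
  then have "[\<sigma>] \<in> words alphabet" by (auto simp: words_iff alphabet_def)
  then show ?case by (simp add: cong_refl)
next
  case (Cons a c)
  have "([\<sigma>, a], [a, \<sigma>]) \<in> rules"
    using Cons.prems by (auto simp: rules_def commute_rules_def intro: rev_image_eqI)
  from cong_context[OF cong_rule[OF this], of "[]" c] have "cong (\<sigma> # a # c) (a # \<sigma> # c)"
    using Cons.prems by (auto simp: alphabet_def)
  also have "cong ([a] @ (\<sigma> # c) @ []) ([a] @ (c @ [\<sigma>]) @ [])"
    using Cons by (intro cong_context) (auto simp: alphabet_def)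
  then have "cong (a # \<sigma> # c) (a # c @ [\<sigma>])" by simp
  finally show ?case by simp
qed

section \<open>Derivations that simulate the machine\<close>

text \<open>Between steps the state letter is parked behind \<open>Lend\<close>, from where
  \<open>cong_move\<close> takes it to the place of the next change.\<close>

definition block :: "sym \<Rightarrow> nat list \<times> nat list \<Rightarrow> (nat \<Rightarrow> nat) \<Rightarrow> sym list" where
  "block \<sigma> t r = Lend # \<sigma> # tape B t r @ [Rend]"

lemma cong_block_state:
  assumes "tape B t r = c @ a @ b @ d" "set (tape B t r) \<subseteq> tape_letters" "\<sigma> \<in> states"
  shows "cong (block \<sigma> t r) (([Lend] @ c) @ (a @ \<sigma> # b) @ (d @ [Rend]))"
proof -
  have "cong ([Lend] @ (\<sigma> # (c @ a)) @ (b @ d @ [Rend])) ([Lend] @ ((c @ a) @ [\<sigma>]) @ (b @ d @ [Rend]))"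
    using assms by (intro cong_context cong_move) (auto simp: alphabet_def)
  then show ?thesis by (simp add: block_def assms(1))
qed

lemma cong_block:
  assumes "cong (a @ \<sigma> # b) (a' @ \<sigma>' # b')"
    and "tape B t r = c @ a @ b @ d" "set (tape B t r) \<subseteq> tape_letters" "\<sigma> \<in> states"
    and "tape B t' r' = c @ a' @ b' @ d" "set (tape B t' r') \<subseteq> tape_letters" "\<sigma>' \<in> states"
  shows "cong (block \<sigma> t r) (block \<sigma>' t' r')"
proof -
  have "cong (block \<sigma> t r) (([Lend] @ c) @ (a @ \<sigma> # b) @ (d @ [Rend]))"
    by (rule cong_block_state) fact+
  also have "cong \<dots> (([Lend] @ c) @ (a' @ \<sigma>' # b') @ (d @ [Rend]))"
    using assms by (intro cong_context) (auto simp: alphabet_def)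
  also have "cong \<dots> (block \<sigma>' t' r')"
    by (rule cong_sym, rule cong_block_state) fact+
  finally show ?thesis .
qed

definition fits :: "nat list \<times> nat list \<Rightarrow> bool" where
  "fits t \<longleftrightarrow> set (fst t @ snd t) \<subseteq> {..N}"

lemma tape_letters: "fits t \<Longrightarrow> set (tape B t r) \<subseteq> tape_letters"
  by (auto simp: fits_def tape_def counters_def tape_letters_def)

lemma states_simps [simp]: "Guess \<in> states" "q \<in> Q \<Longrightarrow> St q \<in> states"
  by (auto simp: states_def)

lemma block_refl: "fits t \<Longrightarrow> \<sigma> \<in> states \<Longrightarrow> cong (block \<sigma> t r) (block \<sigma> t r)"
  using tape_letters[of t r] by (intro cong_refl) (auto simp: block_def words_iff alphabet_def)

lemma machine_rule_cong: "(a, b) \<in> machine_rules q \<Longrightarrow> q \<in> Q \<Longrightarrow> cong a b"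
  by (intro cong_rule) (auto simp: rules_def)

lemma block_push:
  assumes "cong [Bar i, \<sigma>] [Bar i, \<sigma>', One]" "i < B" "fits t" "\<sigma> \<in> states" "\<sigma>' \<in> states"
  shows "cong (block \<sigma> t r) (block \<sigma>' t (r(i := Suc (r i))))"
proof (rule cong_block[where a = "[Bar i]" and b = "[]" and a' = "[Bar i]" and b' = "[One]" and
      c = "before t i r" and d = "replicate (r i) One @ counters (Suc i) B r"])
  show "tape B t r = before t i r @ [Bar i] @ [] @ replicate (r i) One @ counters (Suc i) B r"
    using tape_split[OF assms(2), of t r] by simp
  show "tape B t (r(i := Suc (r i))) =
      before t i r @ [Bar i] @ [One] @ replicate (r i) One @ counters (Suc i) B r"
    using tape_split[OF assms(2), of t "r(i := Suc (r i))"] by simp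
qed (use assms(1,4,5) tape_letters[OF assms(3)] in simp_all)

lemma block_pop:
  assumes "cong [Bar i, \<sigma>, One] [Bar i, \<sigma>']" "i < B" "fits t" "\<sigma> \<in> states" "\<sigma>' \<in> states" "r i \<noteq> 0"
  shows "cong (block \<sigma> t r) (block \<sigma>' t (r(i := r i - 1)))"
proof -
  have "cong (block \<sigma>' t (r(i := r i - 1))) (block \<sigma> t ((r(i := r i - 1))(i := Suc ((r(i := r i - 1)) i))))"
    by (rule block_push[OF cong_sym[OF assms(1)] assms(2,3,5,4)])
  moreover have "(r(i := r i - 1))(i := Suc ((r(i := r i - 1)) i)) = r"
    using assms(6) by (simp add: fun_eq_iff)
  ultimately show ?thesis using cong_sym by metis
qed

lemma block_zero:
  assumes "cong [Bar i, \<sigma>, Bar (Suc i)] [Bar i, \<sigma>', Bar (Suc i)]" "i < B" "fits t"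
    "\<sigma> \<in> states" "\<sigma>' \<in> states" "r i = 0"
  shows "cong (block \<sigma> t r) (block \<sigma>' t r)"
proof -
  obtain d where "counters (Suc i) B r = Bar (Suc i) # d"
    using counters_cases[of "Suc i" B r] assms(2) by (metis Suc_leI)
  then have "tape B t r = before t i r @ [Bar i] @ [Bar (Suc i)] @ d"
    using assms(2,6) by (simp add: tape_split)
  then show ?thesis
    using assms by (intro cong_block[where a = "[Bar i]" and b = "[Bar (Suc i)]" and
        a' = "[Bar i]" and b' = "[Bar (Suc i)]"] tape_letters) auto
qed

lemma block_nonzero:
  assumes "cong [Bar i, \<sigma>, One] [Bar i, \<sigma>', One]" "i < B" "fits t"
    "\<sigma> \<in> states" "\<sigma>' \<in> states" "r i \<noteq> 0"
  shows "cong (block \<sigma> t r) (block \<sigma>' t r)"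
proof -
  obtain k where "r i = Suc k" using assms(6) not0_implies_Suc by blast
  then have "tape B t r = before t i r @ [Bar i] @ [One] @ (replicate k One @ counters (Suc i) B r)"
    using assms(2) by (simp add: tape_split)
  then show ?thesis
    using assms by (intro cong_block[where a = "[Bar i]" and b = "[One]" and
        a' = "[Bar i]" and b' = "[One]"] tape_letters) auto
qed

lemma block_cursor:
  assumes "cong [Tp a, \<sigma>, Cur] [\<sigma>', Cur, Tp a]" "fits (t1 @ [a], t2)" "\<sigma> \<in> states" "\<sigma>' \<in> states"
  shows "cong (block \<sigma> (t1 @ [a], t2) r) (block \<sigma>' (t1, a # t2) r)"
proof -
  have "fits (t1, a # t2)" using assms(2) by (simp add: fits_def)
  then show ?thesis
    using assms by (intro cong_block[where a = "[Tp a]" and b = "[Cur]" and a' = "[]" and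
        b' = "[Cur, Tp a]" and c = "map Tp t1" and d = "map Tp t2 @ counters 0 B r"] tape_letters)
      (auto simp: tape_def)
qed

lemma block_head:
  assumes "cong (Lend # \<sigma> # a) (Lend # \<sigma>' # a')" "tape B t r = a @ d" "tape B t' r' = a' @ d"
    and "fits t"
  shows "cong (block \<sigma> t r) (block \<sigma>' t' r')"
proof -
  have "set d \<subseteq> tape_letters" using tape_letters[OF assms(4), of r] assms(2) by auto
  then have "cong ([] @ (Lend # \<sigma> # a) @ (d @ [Rend])) ([] @ (Lend # \<sigma>' # a') @ (d @ [Rend]))"
    using assms(1) by (intro cong_context) (auto simp: alphabet_def)
  then show ?thesis by (simp add: block_def assms(2,3))
qed

lemma block_step:
  assumes q: "q \<in> Q" and t: "fits t" and step: "step (q, t, r) = (q', t', r')" and "q \<noteq> []"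
  shows "cong (block (St q) t r) (block (St q') t' r') \<and> q' \<in> Q \<and> fits t'"
proof -
  have "fits t'" using t step_tape[of q t r] step by (simp add: fits_def del: set_append)
  moreover have q': "q' \<in> Q"
    using Q_step[OF q, of "fst t" "snd t" r] t step by (simp add: fits_def N_def)
  moreover have "cong (block (St q) t r) (block (St q') t' r')"
  proof (cases q rule: machine_rules.cases)
    case (1 i k)
    then have "i < B" using Q_reg q by force
    then show ?thesis
      using 1 step q q' t block_push[of i "St q" "St k" t r] machine_rule_cong[OF _ q] by auto
  next
    case (2 i k)
    then have "i < B" using Q_reg q by force
    moreover have "r(i := r i - 1) = r" if "r i = 0" using that by (simp add: fun_eq_iff)
    ultimately show ?thesis
      using 2 step q q' t block_pop[of i "St q" "St k" t r] block_zero[of i "St q" "St k" t r]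
        machine_rule_cong[OF _ q] by (cases "r i = 0") auto
  next
    case (3 i k)
    show ?thesis
    proof (cases "fst t" rule: rev_cases)
      case Nil
      have "cong [Lend, St q, Cur] [Lend, St k, Cur]" using 3 machine_rule_cong[OF _ q] by auto
      moreover have "step (q, t, r) = (k, t, r)" using 3 Nil by (cases t) auto
      moreover have "tape B t r = [Cur] @ map Tp (snd t) @ counters 0 B r" using Nil by (simp add: tape_def)
      ultimately show ?thesis
        using step t block_head[of "St q" "[Cur]" "St k" "[Cur]" t r] by auto
    next
      case (snoc t1 a)
      then have t_eq: "t = (t1 @ [a], snd t)" by (cases t) simp
      have "a \<le> N" using t snoc by (auto simp: fits_def)
      then have "cong [Tp a, St q, Cur] [St (replicate a (Inc i) @ k), Cur, Tp a]"
        using 3 by (intro machine_rule_cong[OF _ q]) auto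
      moreover have "(q', t', r') = (replicate a (Inc i) @ k, (t1, a # snd t), r)"
        unfolding step[symmetric] 3 by (subst t_eq) simp
      ultimately show ?thesis
        using q q' t block_cursor[of a "St q" "St q'" t1 "snd t" r] t_eq by auto
    qed
  next
    case (4 i b k)
    then have "i < B" using Q_reg q by force
    then show ?thesis
      using 4 step q q' t block_nonzero[of i "St q" "St q'" t r] block_zero[of i "St q" "St q'" t r]
        machine_rule_cong[OF _ q] by (cases "r i = 0") auto
  qed (use \<open>q \<noteq> []\<close> in simp)
  ultimately show ?thesis by blast
qed

lemma block_run:
  "(step ^^ i) (q, t, r) = ([], t', r') \<Longrightarrow> q \<in> Q \<Longrightarrow> fits t \<Longrightarrow>
    cong (block (St q) t r) (block (St []) t' r') \<and> fits t' \<and> fst t' @ snd t' = fst t @ snd t"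
proof (induction i arbitrary: q t r)
  case 0
  then show ?case by (simp add: block_refl)
next
  case (Suc i)
  show ?case
  proof (cases "q = []")
    case True
    then have "(step ^^ i) (q, t, r) = ([], t', r')" using Suc.prems(1) by simp
    then show ?thesis using Suc by blast
  next
    case False
    obtain q1 t1 r1 where 1: "step (q, t, r) = (q1, t1, r1)" by (metis surj_pair)
    from block_step[OF Suc.prems(2,3) 1 False] have *: "cong (block (St q) t r) (block (St q1) t1 r1)"
      "q1 \<in> Q" "fits t1" by auto
    have "(step ^^ i) (q1, t1, r1) = ([], t', r')"
      using Suc.prems(1) 1 by (simp add: funpow_swap1)
    from Suc.IH[OF this *(2,3)] * step_tape[of q t r] 1 show ?thesis
      by (auto intro: cong_trans)
  qed
qed

lemma cong_input_rule: "(a, b) \<in> input_rules \<Longrightarrow> cong a b"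
  by (intro cong_rule) (auto simp: rules_def)

text \<open>The last generator creates the block; the earlier ones are then absorbed from right to
  left.\<close>

lemma block_input:
  "v \<in> free_sg m \<Longrightarrow> cong (map Gen v) (block Guess (map Suc v @ [0], []) (\<lambda>_. 0))"
proof (induction v)
  case (Cons j v)
  then have j: "j < m" by (simp add: words_iff)
  have tape: "tape B (map Suc w @ [0], []) (\<lambda>_. 0) = map Tp (map Suc w) @ Tp 0 # blank" for w
    by (simp add: blank_eq_tape tape_def)
  show ?case
  proof (cases "v = []")
    case True
    have "cong [Gen j] (Lend # Guess # Tp (Suc j) # Tp 0 # blank @ [Rend])"
      using j by (intro cong_input_rule) (auto simp: input_rules_def)
    then show ?thesis using True tape[of "[j]"] by (simp add: block_def)
  next
    case False
    then have v: "v \<in> free_sg m" using Cons.prems by (simp add: words_iff)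
    let ?d = "map Tp (map Suc v) @ Tp 0 # blank @ [Rend]"
    have Gen: "Gen j \<in> alphabet" using j by (simp add: alphabet_def)
    have "set v \<subseteq> {..<m}" using v by (simp add: words_iff)
    then have d: "set ?d \<subseteq> alphabet"
      using blank_letters letters_le_N(1) by (auto simp: alphabet_def tape_letters_def subset_iff)
    have "cong ([Gen j] @ map Gen v @ []) ([Gen j] @ block Guess (map Suc v @ [0], []) (\<lambda>_. 0) @ [])"
      using Cons.IH[OF v] Gen by (intro cong_context) auto
    also have "[Gen j] @ block Guess (map Suc v @ [0], []) (\<lambda>_. 0) @ [] = [] @ [Gen j, Lend, Guess] @ ?d"
      unfolding block_def tape by simp
    also have "cong \<dots> ([] @ [Lend, Guess, Tp (Suc j)] @ ?d)"
      using j d by (intro cong_context cong_input_rule) (auto simp: input_rules_def)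
    also have "\<dots> = block Guess (map Suc (j # v) @ [0], []) (\<lambda>_. 0)"
      unfolding block_def tape by simp
    finally show ?thesis by simp
  qed
qed (simp add: words_iff)

lemma block_guess:
  "set u \<subseteq> {..<n} \<Longrightarrow> fits (w, []) \<Longrightarrow> cong (block Guess (w, []) r) (block Guess (w @ map Suc u, []) r)"
proof (induction u arbitrary: w)
  case Nil
  then show ?case by (simp add: block_refl)
next
  case (Cons j u)
  have j: "j < n" using Cons.prems by simp
  have fits: "fits (w @ [Suc j], [])" using Cons.prems letters_le_N(2)[OF j] by (simp add: fits_def)
  have "cong [Guess, Cur] [Tp (Suc j), Guess, Cur]"
    using j by (intro cong_input_rule) (auto simp: input_rules_def)
  then have "cong (block Guess (w, []) r) (block Guess (w @ [Suc j], []) r)"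
    using Cons.prems fits
    by (intro cong_block[where a = "[]" and b = "[Cur]" and a' = "[Tp (Suc j)]" and b' = "[Cur]" and
          c = "map Tp w" and d = "counters 0 B r"] tape_letters) (auto simp: tape_def)
  also have "cong \<dots> (block Guess ((w @ [Suc j]) @ map Suc u, []) r)"
    using Cons.prems fits by (intro Cons.IH) auto
  finally show ?case by simp
qed

lemma block_start:
  assumes "fits (w, [])"
  shows "cong (block Guess (w, []) (\<lambda>_. 0)) (block (St p) (w, []) (\<lambda>_. 0))"
proof -
  have "cong (Guess # blank) (St p # blank)"
    by (intro cong_input_rule) (auto simp: input_rules_def)
  then show ?thesis
    using assms Q(2) by (intro cong_block[where a = "[]" and b = blank and a' = "[]" and b' = blank and
          c = "map Tp w" and d = "[]"] tape_letters) (auto simp: tape_def blank_eq_tape)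
qed

lemma block_clear_counter:
  assumes "i < B" "fits t"
  shows "cong (block (St []) t r) (block (St []) t (r(i := 0)))"
proof -
  have "cong (block (St []) t (r(i := k))) (block (St []) t (r(i := 0)))" for k
  proof (induction k)
    case 0
    show ?case by (simp add: block_refl assms(2) Q(3))
  next
    case (Suc k)
    have "cong [Bar i, St [], One] [Bar i, St []]"
      using assms(1) Q(3) by (intro machine_rule_cong[of _ _ "[]"]) auto
    from block_pop[OF this assms, of "r(i := Suc k)"] Q(3)
    have "cong (block (St []) t (r(i := Suc k))) (block (St []) t (r(i := k)))" by simp
    then show ?case using Suc by (rule cong_trans)
  qed
  from this[of "r i"] show ?thesis by simp
qed

lemma block_clear:
  assumes "fits t"
  shows "cong (block (St []) t r) (block (St []) t (\<lambda>_. 0))"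
proof -
  have "cong (block (St []) t r) (block (St []) t (\<lambda>j. if j < i then 0 else r j))" if "i \<le> B" for i
    using that
  proof (induction i)
    case 0
    show ?case by (simp add: block_refl assms Q(3))
  next
    case (Suc i)
    have "(\<lambda>j. if j < i then 0 else r j)(i := 0) = (\<lambda>j. if j < Suc i then 0 else r j)"
      by (auto simp: fun_eq_iff)
    then show ?case
      using Suc block_clear_counter[of i t "\<lambda>j. if j < i then 0 else r j"] assms
      by (auto intro: cong_trans)
  qed
  from this[of B] have "cong (block (St []) t r) (block (St []) t (\<lambda>j. if j < B then 0 else r j))"
    by simp
  \<comment> \<open>Registers from \<open>B\<close> on leave no trace on the tape, so they may be
    taken to be 0 as well.\<close>
  moreover have "map (\<lambda>j. Bar j # replicate (if j < B then 0 else r j) One) [0..<B] =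
      map (\<lambda>j. Bar j # replicate 0 One) [0..<B]"
    by (rule map_cong) auto
  then have "tape B t (\<lambda>j. if j < B then 0 else r j) = tape B t (\<lambda>_. 0)"
    by (simp only: tape_def counters_def)
  ultimately show ?thesis by (simp add: block_def)
qed

text \<open>Applies the cursor relation of the halted state backwards.\<close>

lemma block_rewind:
  "fits (t1, t2) \<Longrightarrow> cong (block (St []) (t1, t2) r) (block (St []) (t1 @ t2, []) r)"
proof (induction t2 arbitrary: t1)
  case Nil
  then show ?case by (simp add: block_refl Q(3))
next
  case (Cons a t2)
  then have fits: "fits (t1 @ [a], t2)" and a: "a \<le> N" by (auto simp: fits_def)
  have "cong [Tp a, St [], Cur] [St [], Cur, Tp a]"
    using a Q(3) by (intro machine_rule_cong[of _ _ "[]"]) auto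
  from cong_sym[OF block_cursor[OF this fits]] Q(3)
  have "cong (block (St []) (t1, a # t2) r) (block (St []) (t1 @ [a], t2) r)" by simp
  also have "cong \<dots> (block (St []) ((t1 @ [a]) @ t2, []) r)" by (rule Cons.IH[OF fits])
  finally show ?case by simp
qed

lemma block_erase:
  "set v \<subseteq> {..<m} \<Longrightarrow> fits (w, []) \<Longrightarrow>
    cong (block (St []) (map Suc v @ w, []) r) (block (St []) (w, []) r)"
proof (induction v)
  case Nil
  then show ?case by (simp add: block_refl Q(3))
next
  case (Cons j v)
  have j: "j < N" using Cons.prems letters_le_N(1)[of j] by simp
  have "fits (Suc j # map Suc v @ w, [])"
    using Cons.prems letters_le_N(1) by (auto simp: fits_def)
  moreover have "cong [Lend, St [], Tp (Suc j)] [Lend, St []]"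
    using j Q(3) by (intro machine_rule_cong[of _ _ "[]"]) auto
  ultimately have "cong (block (St []) (Suc j # map Suc v @ w, []) r) (block (St []) (map Suc v @ w, []) r)"
    by (intro block_head[where a = "[Tp (Suc j)]" and a' = "[]"]) (auto simp: tape_def)
  with Cons show ?case by (auto intro: cong_trans)
qed

text \<open>The run leaves the concatenated tape as it was, so after clearing and rewinding
  \<open>v\<close> stands again next to \<open>Lend\<close>, where it can be erased letter by
  letter.\<close>

lemma cong_normal_form:
  assumes "(v, u) \<in> T"
  shows "cong (map Gen v) (block (St []) (0 # map Suc u, []) (\<lambda>_. 0))"
proof -
  have v: "v \<in> free_sg m" and u: "set u \<subseteq> {..<n}" using subsetD[OF T_subset assms] by (simp_all add: words_iff)
  then have "set v \<subseteq> {..<m}" by (simp add: words_iff)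
  let ?w = "map Suc v @ 0 # map Suc u"
  have fits: "fits (map Suc v @ [0], [])" "fits (?w, [])" "fits (0 # map Suc u, [])"
    using \<open>set v \<subseteq> {..<m}\<close> u letters_le_N by (auto simp: fits_def subset_iff)
  have "halts (p, (?w, []), \<lambda>_. 0)" using assms by (simp add: halts_p)
  then obtain i s where "(step ^^ i) (p, (?w, []), \<lambda>_. 0) = ([], s)" by (auto simp: halts_def exec_def)
  then obtain t1 t2 r where run: "(step ^^ i) (p, (?w, []), \<lambda>_. 0) = ([], (t1, t2), r)"
    by (cases s) (metis surj_pair)
  note run = block_run[OF this Q(2) fits(2)]
  have "cong (map Gen v) (block Guess (map Suc v @ [0], []) (\<lambda>_. 0))" by (rule block_input[OF v])
  also have "cong \<dots> (block Guess ((map Suc v @ [0]) @ map Suc u, []) (\<lambda>_. 0))"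
    by (rule block_guess[OF u fits(1)])
  also have "(map Suc v @ [0]) @ map Suc u = ?w" by simp
  also have "cong (block Guess (?w, []) (\<lambda>_. 0)) (block (St p) (?w, []) (\<lambda>_. 0))"
    by (rule block_start[OF fits(2)])
  also have "cong \<dots> (block (St []) (t1, t2) r)" using run by simp
  also have "cong \<dots> (block (St []) (t1, t2) (\<lambda>_. 0))" using run by (intro block_clear) simp
  also have "cong \<dots> (block (St []) (t1 @ t2, []) (\<lambda>_. 0))" using run by (intro block_rewind) simp
  also have "t1 @ t2 = ?w" using run by simp
  also have "cong (block (St []) (?w, []) (\<lambda>_. 0)) (block (St []) (0 # map Suc u, []) (\<lambda>_. 0))"
    by (rule block_erase[OF \<open>set v \<subseteq> {..<m}\<close> fits(3)])
  finally show ?thesis .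
qed

section \<open>The embedding and its effect on lengths\<close>

lemma foldl_read_X:
  "set v \<subseteq> {..<m} \<Longrightarrow> g \<in> ocarrier S \<Longrightarrow> foldl read (Out g) (map Gen v) = Out (omult S g (oproj S x v))"
proof (induction v arbitrary: g)
  case Nil
  then show ?case by (simp add: oproj_def)
next
  case (Cons j v)
  then have "Some (x j) \<in> ocarrier S" using x by (auto simp: ocarrier_def)
  with Cons show ?case by (simp add: oproj_Cons omult_assoc omult_closed oproj_closed)
qed

abbreviation "H \<equiv> presented_sg rank relators"

definition cls :: "nat list \<Rightarrow> nat list set" where "cls w = sg_cong rank relators `` {w}"

lemma cls_eq_iff:
  "v \<in> free_sg rank \<Longrightarrow> w \<in> free_sg rank \<Longrightarrow> cls v = cls w \<longleftrightarrow> (v, w) \<in> sg_cong rank relators"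
  unfolding cls_def by (rule class_eq_iff[OF relators_subset])

definition emb_word where "emb_word g = map code (map Gen (SOME v. v \<in> free_sg m \<and> proj S x v = g))"

definition emb where "emb g = cls (emb_word g)"

lemma map_X_words: "v \<in> free_sg m \<Longrightarrow> map Gen v \<in> words alphabet"
  by (auto simp: words_iff alphabet_def)

lemma emb_wordE:
  assumes "g \<in> carrier S"
  obtains v where "v \<in> free_sg m" "proj S x v = g" "emb_word g = map code (map Gen v)"
proof -
  have "\<exists>v. v \<in> free_sg m \<and> proj S x v = g" using assms onto by auto
  from someI_ex[OF this] show thesis using that unfolding emb_word_def by blast
qed

text \<open>Clause (2) of (D3) provides a common code of \<open>v\<close> and \<open>v'\<close>,
  hence a common normal form.\<close>

lemma cls_X_eq:
  assumes "v \<in> free_sg m" "v' \<in> free_sg m" "proj S x v = proj S x v'"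
  shows "cls (map code (map Gen v)) = cls (map code (map Gen v'))"
proof -
  obtain u where "(v, u) \<in> T" "(v', u) \<in> T" using T_common assms by blast
  then have "cong (map Gen v) (map Gen v')" using cong_normal_form cong_sym cong_trans by blast
  then show ?thesis
    using assms by (simp add: cls_eq_iff map_code_words map_X_words cong_def del: map_map)
qed

lemma emb_proj: "v \<in> free_sg m \<Longrightarrow> emb (proj S x v) = cls (map code (map Gen v))"
proof -
  assume v: "v \<in> free_sg m"
  obtain v' where "v' \<in> free_sg m" "proj S x v' = proj S x v" "emb_word (proj S x v) = map code (map Gen v')"
    using emb_wordE[OF proj_closed[OF x v]] by blast
  then show ?thesis unfolding emb_def using cls_X_eq[OF _ v] by metis
qed

text \<open>\<open>similar\<close> relates an \<open>Out\<close> only to itself, so every word for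
  \<open>emb g\<close>, whatever its letters, evaluates to \<open>g\<close>. Injectivity and the
  lower bound on lengths both follow.\<close>

lemma read_emb:
  assumes "g \<in> carrier S" "w \<in> free_sg rank" "cls w = emb g"
  shows "foldl read (Out None) (map decode w) = Out (Some g)"
proof -
  obtain v where v: "v \<in> free_sg m" "proj S x v = g" "emb_word g = map code (map Gen v)"
    using emb_wordE[OF assms(1)] .
  have "(map code (map Gen v), w) \<in> sg_cong rank relators"
    using assms(2,3) v(1) unfolding emb_def v(3) by (metis cls_eq_iff map_code_words map_X_words)
  from sg_cong_similar[OF this, of "Out None"]
  have "similar (foldl read (Out None) (map decode (map code (map Gen v)))) (foldl read (Out None) (map decode w))"
    by (simp add: ocarrier_def)
  moreover have "map decode (map code (map Gen v)) = map Gen v"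
    using map_X_words[OF v(1)] by (intro decode_code) (simp add: words_iff)
  moreover have "foldl read (Out None) (map Gen v) = Out (Some g)"
    using v(1,2) foldl_read_X[of v None] by (auto simp: words_iff ocarrier_def oproj_def)
  ultimately have "similar (Out (Some g)) (foldl read (Out None) (map decode w))"
    by (simp only:)
  then show ?thesis by (simp add: similar_def)
qed

lemma emb_lower: 
  assumes "g \<in> carrier S" "w \<in> free_sg rank" "cls w = emb g"
  shows "l g \<le> K * length w"
  using olength_read[of "map decode w" "Some g" "[]"] read_emb[OF assms] by (simp add: olength_def)

lemma emb_word_free: "g \<in> carrier S \<Longrightarrow> emb_word g \<in> free_sg rank"
  by (metis emb_wordE map_code_words map_X_words)

lemma inj_emb: "inj_on emb (carrier S)"
proof (rule inj_onI)
  fix g h assume g: "g \<in> carrier S" and h: "h \<in> carrier S" and "emb g = emb h"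
  then have "cls (emb_word g) = emb g" "cls (emb_word g) = emb h"
    by (simp_all add: emb_def)
  from read_emb[OF g emb_word_free[OF g] this(1)] read_emb[OF h emb_word_free[OF g] this(2)]
  show "g = h" by simp
qed

lemma emb_hom: "emb \<in> sg_hom S H"
proof -
  have "emb g \<in> carrier H" if "g \<in> carrier S" for g
    unfolding emb_def cls_def using emb_word_free[OF that] by (rule class_in_presented[OF relators_subset])
  moreover have "emb (g \<cdot> h) = emb g \<cdot>\<^bsub>H\<^esub> emb h" if gh: "g \<in> carrier S" "h \<in> carrier S" for g h
  proof -
    obtain v where v: "v \<in> free_sg m" "proj S x v = g" using gh(1) onto by auto
    obtain w where w: "w \<in> free_sg m" "proj S x w = h" using gh(2) onto by auto
    have "emb (g \<cdot> h) = emb (proj S x (v @ w))" using v w proj_append[OF x] by simp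
    also have "\<dots> = cls (map code (map Gen v) @ map code (map Gen w))"
      using v w by (simp add: emb_proj words_append)
    also have "\<dots> = cls (map code (map Gen v)) \<cdot>\<^bsub>H\<^esub> cls (map code (map Gen w))"
      unfolding cls_def using v w
      by (intro presented_mult[OF relators_subset, symmetric] map_code_words map_X_words)
    also have "\<dots> = emb g \<cdot>\<^bsub>H\<^esub> emb h" using v w emb_proj by metis
    finally show ?thesis .
  qed
  ultimately show ?thesis by (simp add: sg_hom_def)
qed

lemma emb_upper:
  assumes "g \<in> carrier S"
  obtains w where "w \<in> free_sg rank" "cls w = emb g" "length w \<le> (B + 7) * l g"
proof -
  obtain v where v: "v \<in> free_sg m" "proj S x v = g" using assms onto by auto
  have "\<exists>u. (v, u) \<in> T" using T_common[OF v(1) v(1)] by blast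
  then have "\<exists>k u. (v, u) \<in> T \<and> length u = k" by blast
  from LeastI_ex[OF this] obtain u where u: "(v, u) \<in> T" "length u = l g"
    using T_least[OF v(1)] v(2) by auto
  let ?b = "block (St []) (0 # map Suc u, []) (\<lambda>_. 0)"
  have "cong (map Gen v) ?b" by (rule cong_normal_form[OF u(1)])
  then have *: "(map code (map Gen v), map code ?b) \<in> sg_cong rank relators" by (simp add: cong_def)
  then have b: "map code ?b \<in> free_sg rank" using sg_cong_subset[OF relators_subset] by blast
  have "cls (map code ?b) = cls (map code (map Gen v))"
    using * b v(1) cls_eq_iff[of "map code (map Gen v)" "map code ?b"] map_code_words map_X_words by blast
  also have "\<dots> = emb g" using emb_proj[OF v(1)] v(2) by simp
  finally have 1: "cls (map code ?b) = emb g" .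
  \<comment> \<open>Besides the \<open>l g\<close> letters of \<open>u\<close> there are
    \<open>Lend\<close>, \<open>Rend\<close>, the state, the separator, the cursor and
    \<open>B + 1\<close> bars. As \<open>l g\<close> is at least 1, the factor \<open>B + 7\<close>
    absorbs the constant.\<close>
  have "length ?b = l g + B + 6"
    by (simp add: block_def tape_def counters_def concat_map_singleton u(2))
  also have "\<dots> \<le> (B + 7) * l g" using l_pos[OF assms] by (cases "l g") auto
  finally have "length (map code ?b) \<le> (B + 7) * l g" by simp
  with b 1 show thesis by (rule that)
qed

lemma emb_equivalent:
  assumes Y: "finite Y" "generating_set H Y"
  shows "equivalent_on (carrier S) (\<lambda>g. word_length H Y (emb g)) l"
proof -
  note H = sgrp_presented[OF relators_subset rank_pos]
  \<comment> \<open>\<open>M\<close> bounds the lengths over \<open>Y\<close> of the presenting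
    letters, and \<open>M'\<close> below bounds words in those letters for the elements of
    \<open>Y\<close>; both are kept at least 1 so that the constants are positive.\<close>
  define M where "M = Max (insert 1 ((\<lambda>i. word_length H Y (cls [i])) ` {..<rank}))"
  have M: "1 \<le> M" "\<And>i. i < rank \<Longrightarrow> word_length H Y (cls [i]) \<le> M" by (auto simp: M_def)
  have "\<exists>w. w \<in> free_sg rank \<and> cls w = y" if "y \<in> Y" for y
    using that Y(2) carrier_presentedE[OF relators_subset, of y]
    by (metis cls_def generating_set_def subsetD)
  then obtain f where f: "\<And>y. y \<in> Y \<Longrightarrow> f y \<in> free_sg rank \<and> cls (f y) = y" by metis
  define M' where "M' = Max (insert 1 (length ` f ` Y))"
  have M': "1 \<le> M'" "\<And>y. y \<in> Y \<Longrightarrow> length (f y) \<le> M'" using Y(1) by (auto simp: M'_def)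
  have 1: "word_length H Y (emb g) \<le> M * (B + 7) * l g" if g: "g \<in> carrier S" for g
  proof -
    obtain w where w: "w \<in> free_sg rank" "cls w = emb g" "length w \<le> (B + 7) * l g"
      using emb_upper[OF g] .
    have "word_length H Y (emb g) = word_length H Y (word_prod H (map (\<lambda>i. cls [i]) w))"
      using word_prod_class_letters[OF relators_subset rank_pos w(1)] w(2) by (simp add: cls_def)
    also have "\<dots> \<le> M * length (map (\<lambda>i. cls [i]) w)"
    proof (rule word_length_word_prod_le[OF H Y(2)])
      show "map (\<lambda>i. cls [i]) w \<in> words (carrier H)"
        using w(1) class_in_presented[OF relators_subset, folded cls_def] by (auto simp: words_iff)
      show "word_length H Y y \<le> M" if "y \<in> set (map (\<lambda>i. cls [i]) w)" for y
        using that w(1) M(2) by (auto simp: words_iff)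
    qed
    also have "\<dots> \<le> M * ((B + 7) * l g)" using w(3) by simp
    finally show ?thesis by (simp add: mult.assoc)
  qed
  have 2: "l g \<le> K * M' * word_length H Y (emb g)" if g: "g \<in> carrier S" for g
  proof -
    have "emb g \<in> carrier H" using emb_hom g by (auto simp: sg_hom_def)
    from generating_set_cases[OF Y(2) this] obtain ys where
      ys: "ys \<in> words Y" "word_prod H ys = emb g" "length ys = word_length H Y (emb g)" .
    let ?w = "concat (map f ys)"
    have fys: "map f ys \<noteq> []" "set (map f ys) \<subseteq> free_sg rank" using ys(1) f by (auto simp: words_iff)
    then have w: "?w \<in> free_sg rank" by (rule concat_in_words)
    have "map (\<lambda>w. cls w) (map f ys) = ys" using f ys(1) by (auto simp: words_iff intro!: map_idI)
    with word_prod_classes[OF relators_subset rank_pos fys] have "cls ?w = emb g"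
      using ys(2) by (simp add: cls_def del: map_map)
    from emb_lower[OF g w this] have "l g \<le> K * length ?w" .
    also have "length ?w = (\<Sum>y\<leftarrow>ys. length (f y))" by (simp add: length_concat comp_def)
    also have "\<dots> \<le> (\<Sum>y\<leftarrow>ys. M')" using M'(2) ys(1) by (intro sum_list_mono) (auto simp: words_iff)
    finally show ?thesis by (simp add: sum_list_triv ys(3) mult_ac)
  qed
  let ?C = "real (M * (B + 7))" and ?C' = "real (K * M')"
  have C: "?C > 0" "?C' > 0" using M(1) M'(1) K(1) by auto
  show ?thesis
    unfolding equivalent_on_def
  proof (intro exI conjI ballI)
    fix g assume g: "g \<in> carrier S"
    have "real (word_length H Y (emb g)) \<le> ?C * real (l g)" using 1[OF g] by (metis of_nat_le_iff of_nat_mult)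
    then show "1 / ?C * real (word_length H Y (emb g)) \<le> real (l g)"
      using C(1) by (simp add: field_simps)
    show "real (l g) \<le> ?C' * real (word_length H Y (emb g))"
      using 2[OF g] by (metis of_nat_le_iff of_nat_mult)
  qed (use C in auto)
qed

theorem embedding:
  "sgrp H \<and> finitely_presented H \<and> sg_embedding emb S H \<and>
    (\<forall>Y. finite Y \<and> generating_set H Y \<longrightarrow>
      equivalent_on (carrier S) (\<lambda>g. word_length H Y (emb g)) l)"
  using sgrp_presented[OF relators_subset rank_pos]
    finitely_presented_presented[OF relators_subset rank_pos finite_relators]
    emb_hom inj_emb emb_equivalent by (simp add: sg_embedding_def)

end

section \<open>Recursive enumerability of the word problem\<close>

text \<open>With symmetric single replacements a proof of congruence becomes a finite sequence of
  steps, which a number can code and a search can find.\<close>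

definition rewriting :: "(nat list \<times> nat list) set \<Rightarrow> (nat list \<times> nat list) set" where
  "rewriting R = {(a @ l @ b, a @ r @ b) | a b l r. (l, r) \<in> R \<union> R\<inverse>}"

lemma rewriting_context: "(u, v) \<in> (rewriting R)\<^sup>* \<Longrightarrow> (c @ u @ d, c @ v @ d) \<in> (rewriting R)\<^sup>*"
proof (induction rule: rtrancl_induct)
  case (step v w)
  then obtain a b l r where "v = a @ l @ b" "w = a @ r @ b" "(l, r) \<in> R \<union> R\<inverse>"
    by (auto simp: rewriting_def)
  then have "c @ v @ d = (c @ a) @ l @ (b @ d)" "c @ w @ d = (c @ a) @ r @ (b @ d)" by simp_all
  with \<open>(l, r) \<in> R \<union> R\<inverse>\<close> have "(c @ v @ d, c @ w @ d) \<in> rewriting R"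
    unfolding rewriting_def by blast
  with step.IH show ?case by (rule rtrancl_into_rtrancl)
qed simp

lemma sg_cong_rewriting: "(u, v) \<in> sg_cong k R \<Longrightarrow> (u, v) \<in> (rewriting R)\<^sup>*"
proof (induction rule: sg_cong.induct)
  case (base u v)
  then have "([] @ u @ [], [] @ v @ []) \<in> rewriting R" unfolding rewriting_def by blast
  then show ?case by auto
next
  case (sym u v)
  have "(rewriting R)\<inverse> = rewriting R" by (auto simp: rewriting_def)
  then show ?case using sym.IH by (metis rtrancl_converseI)
next
  case (mult u v u' v')
  then show ?case
    using rewriting_context[of u v R "[]" u'] rewriting_context[of u' v' R v "[]"] by (auto intro: rtrancl_trans)
qed (auto intro: rtrancl_trans)

lemma rewriting_sg_cong:
  assumes "R \<subseteq> free_sg k \<times> free_sg k" "(u, v) \<in> rewriting R" "u \<in> free_sg k"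
  shows "(u, v) \<in> sg_cong k R"
proof -
  obtain a b l r where u: "u = a @ l @ b" "v = a @ r @ b" and "(l, r) \<in> R \<union> R\<inverse>"
    using assms(2) by (auto simp: rewriting_def)
  then have lr: "(l, r) \<in> sg_cong k R" by (auto intro: sg_cong.intros)
  have ab: "set a \<subseteq> {..<k}" "set b \<subseteq> {..<k}" using assms(3) u(1) by (auto simp: words_iff)
  \<comment> \<open>The empty word is not in the free semigroup, so an empty context is not covered
    by \<open>sg_cong.refl\<close> and is treated apart.\<close>
  have "(l @ b, r @ b) \<in> sg_cong k R"
    using sg_cong.mult[OF lr sg_cong.refl[of b]] ab lr by (cases "b = []") (auto simp: words_iff)
  then show ?thesis
    unfolding u using sg_cong.mult[OF sg_cong.refl[of a]] ab by (cases "a = []") (auto simp: words_iff)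
qed

text \<open>A rewriting step is coded by the two contexts and the index of the relation; a step that
  does not apply leaves the word unchanged.\<close>

definition rewrite_code :: "(nat list \<times> nat list) list \<Rightarrow> nat \<Rightarrow> nat \<Rightarrow> nat" where
  "rewrite_code rs w s = (let a = fst (prod_decode s); b = fst (prod_decode (snd (prod_decode s)));
       i = snd (prod_decode (snd (prod_decode s)))
     in if w = app_code a (app_code (if i < length rs then list_encode (fst (rs ! i)) else 0) b)
        then app_code a (app_code (if i < length rs then list_encode (snd (rs ! i)) else 0) b) else w)"

lemma rep2_rewrite_code: "rep2 (rewrite_code rs)"
  unfolding rep2_iff rewrite_code_def Let_def
  by (intro rep_intros rep_comp1[OF rep1_finite_table]) auto

lemma rewrite_code_sg_cong:
  assumes R: "R \<subseteq> free_sg k \<times> free_sg k" "set rs = R \<union> R\<inverse>" and "w \<in> free_sg k"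
  shows "\<exists>w'. rewrite_code rs (list_encode w) s = list_encode w' \<and> (w, w') \<in> sg_cong k R"
proof -
  let ?a = "fst (prod_decode s)" and ?b = "fst (prod_decode (snd (prod_decode s)))"
  let ?i = "snd (prod_decode (snd (prod_decode s)))"
  obtain a b where ab: "?a = list_encode a" "?b = list_encode b" by (metis list_decode_inverse)
  have nil: "(0::nat) = list_encode []" by simp
  have refl: "(w, w) \<in> sg_cong k R" by (rule sg_cong.refl[OF assms(3)])
  show ?thesis
  proof (cases "?i < length rs \<and> w = a @ fst (rs ! ?i) @ b")
    case True
    then have "(fst (rs ! ?i), snd (rs ! ?i)) \<in> R \<union> R\<inverse>" using R(2) nth_mem by auto
    with True have "(w, a @ snd (rs ! ?i) @ b) \<in> rewriting R" unfolding rewriting_def by blast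
    from rewriting_sg_cong[OF R(1) this assms(3)] True show ?thesis
      by (intro exI[of _ "a @ snd (rs ! ?i) @ b"]) (simp add: rewrite_code_def ab)
  next
    case False
    \<comment> \<open>For an index out of range both sides default to 0, the code of the empty word,
      so even a match returns \<open>w\<close>.\<close>
    then have "rewrite_code rs (list_encode w) s = list_encode w"
      unfolding rewrite_code_def ab Let_def nil app_code if_distrib[of list_encode, symmetric]
      by (auto simp: list_encode_eq)
    with refl show ?thesis by blast
  qed
qed

text \<open>Every list of numbers codes a valid derivation, since inapplicable steps stand still;
  thus a search over all codes finds exactly the congruent words.\<close>

lemma sg_cong_iff_rewrite_code:
  assumes R: "R \<subseteq> free_sg k \<times> free_sg k" "set rs = R \<union> R\<inverse>" and u: "u \<in> free_sg k"
  shows "(u, v) \<in> sg_cong k R \<longleftrightarrow>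
    (\<exists>d. foldl (rewrite_code rs) (list_encode u) (list_decode d) = list_encode v)"
proof
  assume "(u, v) \<in> sg_cong k R"
  then have "(u, v) \<in> (rewriting R)\<^sup>*" by (rule sg_cong_rewriting)
  then have "\<exists>ss. foldl (rewrite_code rs) (list_encode u) ss = list_encode v"
  proof (induction rule: rtrancl_induct)
    case base
    show ?case by (rule exI[of _ "[]"]) simp
  next
    case (step v w)
    then obtain ss a b l r where ss: "foldl (rewrite_code rs) (list_encode u) ss = list_encode v"
      and vw: "v = a @ l @ b" "w = a @ r @ b" "(l, r) \<in> R \<union> R\<inverse>"
      by (auto simp: rewriting_def)
    then obtain i where i: "i < length rs" "rs ! i = (l, r)" using R(2) by (metis in_set_conv_nth)
    then have "rewrite_code rs (list_encode v) (prod_encode (list_encode a, prod_encode (list_encode b, i))) =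
        list_encode w"
      by (simp add: rewrite_code_def vw)
    with ss show ?case
      by (intro exI[of _ "ss @ [prod_encode (list_encode a, prod_encode (list_encode b, i))]"]) simp
  qed
  then show "\<exists>d. foldl (rewrite_code rs) (list_encode u) (list_decode d) = list_encode v"
    by (metis list_encode_inverse)
next
  assume "\<exists>d. foldl (rewrite_code rs) (list_encode u) (list_decode d) = list_encode v"
  then obtain ss where ss: "foldl (rewrite_code rs) (list_encode u) ss = list_encode v" by blast
  have "\<exists>w. foldl (rewrite_code rs) (list_encode u) ss = list_encode w \<and> (u, w) \<in> sg_cong k R"
  proof (induction ss rule: rev_induct)
    case Nil
    show ?case using sg_cong.refl[OF u] by auto
  next
    case (snoc s ss)
    then obtain w where w: "foldl (rewrite_code rs) (list_encode u) ss = list_encode w" "(u, w) \<in> sg_cong k R"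
      by blast
    then have "w \<in> free_sg k" using sg_cong_subset[OF R(1)] by blast
    from rewrite_code_sg_cong[OF R this, of s] w show ?case by (auto intro: sg_cong.trans)
  qed
  then show "(u, v) \<in> sg_cong k R" using ss by (auto simp: list_encode_eq)
qed

text \<open>The words \<open>a i\<close> and \<open>b i\<close> are there to spell two families of
  elements in the presenting letters: generators of the subsemigroup and the given generators of
  \<open>H\<close>.\<close>

lemma rec_enumerable_word_problem:
  assumes R: "finite R" "R \<subseteq> free_sg k \<times> free_sg k"
    and a: "\<And>i. i < m \<Longrightarrow> a i \<in> free_sg k"
  shows "rec_enumerable {(v, u). v \<in> free_sg m \<and> u \<in> free_sg n \<and>
    (concat (map a v), concat (map b u)) \<in> sg_cong k R}"
proof -
  obtain rs where rs: "set rs = R \<union> R\<inverse>" using R(1) finite_list[of "R \<union> R\<inverse>"] by auto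
  define a' where "a' i = (if i < m then list_encode (a i) else 0)" for i
  define b' where "b' i = (if i < n then list_encode (b i) else 0)" for i
  \<comment> \<open>A sum of natural numbers vanishes iff all its terms do, so adding expresses the
    conjunction of the three conditions.\<close>
  define F where "F d v u = bad_letters m v + (bad_letters n u +
    (if foldl (rewrite_code rs) (concat_code a' v) (list_decode d) = concat_code b' u then 0 else 1))" for d v u
  have "rep1 a'" "rep1 b'" unfolding a'_def b'_def by (rule rep1_finite_table)+
  then have "rep 3 (\<lambda>xs. F (xs ! 0) (xs ! 1) (xs ! 2))"
    unfolding F_def
    by (intro rep_intros rep_comp1[OF rep1_bad_letters] rep_comp1[OF rep1_concat_code]
        rep_comp2[OF rep2_foldl[OF rep2_rewrite_code]]) auto
  then have "rec_enumerable {(v, u). \<exists>d. F d (list_encode v) (list_encode u) = 0}"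
    by (rule rec_enumerable_projection)
  moreover have "(\<exists>d. F d (list_encode v) (list_encode u) = 0) \<longleftrightarrow> v \<in> free_sg m \<and> u \<in> free_sg n \<and>
    (concat (map a v), concat (map b u)) \<in> sg_cong k R" for v u
  proof (cases "v \<in> free_sg m \<and> u \<in> free_sg n")
    case True
    then have "concat_code a' (list_encode v) = list_encode (concat (map a v))"
      "concat_code b' (list_encode u) = list_encode (concat (map b u))"
      by (auto intro!: concat_code simp: a'_def b'_def words_iff subset_iff)
    moreover have "concat (map a v) \<in> free_sg k"
      using True a by (intro concat_in_words) (auto simp: words_iff[of v])
    moreover have "bad_letters m (list_encode v) = 0" "bad_letters n (list_encode u) = 0"
      using True by (simp_all add: bad_letters)
    ultimately show ?thesis
      using True sg_cong_iff_rewrite_code[OF R(2) rs, of "concat (map a v)" "concat (map b u)"]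
      by (auto simp: F_def)
  next
    case False
    then show ?thesis using bad_letters[of m v] bad_letters[of n u] by (auto simp: F_def)
  qed
  ultimately show ?thesis by simp
qed

section \<open>Length functions on subsemigroups\<close>

text \<open>(D2) leaves no room for a factor in front of the power, so the geometric sum is absorbed
  by enlarging the base.\<close>

lemma card_short_words:
  assumes "finite X"
  shows "card {w. set w \<subseteq> X \<and> length w \<le> r} \<le> (card X + 1) ^ r"
proof -
  have "(\<Sum>i\<le>r. c ^ i) \<le> (c + 1) ^ r" for c :: nat
  proof (induction r)
    case (Suc r)
    have "c ^ Suc r \<le> c * (c + 1) ^ r" by (simp add: power_mono del: One_nat_def)
    then have "(\<Sum>i\<le>Suc r. c ^ i) \<le> (c + 1) ^ r + c * (c + 1) ^ r"
      using Suc unfolding sum.atMost_Suc by (rule add_mono[rotated])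
    then show ?case by (simp add: algebra_simps)
  qed simp
  then show ?thesis by (simp add: card_lists_length_le[OF assms])
qed

locale sub_of_fp =
  fixes H :: "'a sgrp" and X A m x
  assumes H: "sgrp H" "finitely_presented H" and X: "finite X" "generating_set H X"
    and A: "subsemigroup A H" "generated_by (H\<lparr>carrier := A\<rparr>) m x"
begin

lemma A_subset: "A \<subseteq> carrier H"
  using A(1) by (simp add: subsemigroup_def)

lemma x: "x \<in> {..<m} \<rightarrow> carrier H"
proof -
  have "x \<in> {..<m} \<rightarrow> carrier (H\<lparr>carrier := A\<rparr>)"
    using A(2) unfolding generated_by_def by blast
  then show ?thesis using A_subset by auto
qed

lemma X_subset: "X \<subseteq> carrier H"
  using X(2) unfolding generating_set_def by (rule conjunct1)

lemma word_length_pos: "word_length H X \<in> A \<rightarrow> {1..}"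
proof
  fix g assume "g \<in> A"
  then obtain w where "w \<in> words X" "length w = word_length H X g"
    using generating_set_cases[OF X(2)] A_subset by (metis subsetD)
  then show "word_length H X g \<in> {1..}" by (cases w) (auto simp: words_iff)
qed

lemma word_length_D1: "D1 (H\<lparr>carrier := A\<rparr>) (word_length H X)"
  unfolding D1_def
proof (intro ballI)
  fix g h assume "g \<in> carrier (H\<lparr>carrier := A\<rparr>)" "h \<in> carrier (H\<lparr>carrier := A\<rparr>)"
  then have gh: "g \<in> carrier H" "h \<in> carrier H" using A_subset by auto
  obtain v where v: "v \<in> words X" "word_prod H v = g" "length v = word_length H X g"
    using generating_set_cases[OF X(2) gh(1)] .
  obtain w where w: "w \<in> words X" "word_prod H w = h" "length w = word_length H X h"
    using generating_set_cases[OF X(2) gh(2)] .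
  have "word_prod H (v @ w) = g \<cdot>\<^bsub>H\<^esub> h"
    using sgrp.word_prod_append[OF H(1), of v w] v w words_mono[OF X_subset] by auto
  then show "word_length H X (g \<cdot>\<^bsub>H\<lparr>carrier := A\<rparr>\<^esub> h) \<le> word_length H X g + word_length H X h"
    using word_length_le[OF words_append[OF v(1) w(1)], of H] v(3) w(3) by simp
qed

lemma word_length_D2: "D2 (H\<lparr>carrier := A\<rparr>) (word_length H X)"
  unfolding D2_def
proof (intro exI[of _ "real (card X + 1)"] conjI allI impI)
  fix r :: nat
  let ?W = "{w. set w \<subseteq> X \<and> length w \<le> r}"
  have sub: "{g \<in> carrier (H\<lparr>carrier := A\<rparr>). word_length H X g \<le> r} \<subseteq> word_prod H ` ?W"
  proof
    fix g assume "g \<in> {g \<in> carrier (H\<lparr>carrier := A\<rparr>). word_length H X g \<le> r}"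
    then have g: "g \<in> carrier H" "word_length H X g \<le> r" using A_subset by auto
    obtain w where "w \<in> words X" "word_prod H w = g" "length w = word_length H X g"
      using generating_set_cases[OF X(2) g(1)] .
    with g(2) show "g \<in> word_prod H ` ?W" by (auto simp: words_iff)
  qed
  have fin: "finite ?W" by (rule finite_lists_length_le[OF X(1)])
  then show "finite {g \<in> carrier (H\<lparr>carrier := A\<rparr>). word_length H X g \<le> r}"
    using sub finite_subset by blast
  have "card {g \<in> carrier (H\<lparr>carrier := A\<rparr>). word_length H X g \<le> r} \<le> card ?W"
    using surj_card_le[OF fin sub] .
  also have "\<dots> \<le> (card X + 1) ^ r" by (rule card_short_words[OF X(1)])
  finally show "real (card {g \<in> carrier (H\<lparr>carrier := A\<rparr>). word_length H X g \<le> r}) \<le> real (card X + 1) ^ r"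
    by (metis of_nat_le_iff of_nat_power)
qed simp

lemma class_words:
  assumes "R \<subseteq> free_sg k \<times> free_sg k" "\<phi> \<in> sg_hom H (presented_sg k R)"
    and "\<And>i. i < n \<Longrightarrow> y i \<in> carrier H"
  obtains a where "\<And>i. i < n \<Longrightarrow> a i \<in> free_sg k" "\<And>i. i < n \<Longrightarrow> \<phi> (y i) = sg_cong k R `` {a i}"
proof -
  have "\<exists>w. w \<in> free_sg k \<and> \<phi> (y i) = sg_cong k R `` {w}" if "i < n" for i
  proof -
    have "\<phi> (y i) \<in> carrier (presented_sg k R)" using assms(2) assms(3)[OF that] by (auto simp: sg_hom_def)
    then show ?thesis using carrier_presentedE[OF assms(1)] by metis
  qed
  then show thesis using that by metis
qed

lemma hom_proj:
  assumes R: "1 \<le> k" "R \<subseteq> free_sg k \<times> free_sg k" and \<phi>: "\<phi> \<in> sg_hom H (presented_sg k R)"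
    and y: "y \<in> {..<n} \<rightarrow> carrier H"
    and a: "\<And>i. i < n \<Longrightarrow> a i \<in> free_sg k" "\<And>i. i < n \<Longrightarrow> \<phi> (y i) = sg_cong k R `` {a i}"
    and u: "u \<in> free_sg n"
  shows "\<phi> (proj H y u) = sg_cong k R `` {concat (map a u)}"
proof -
  have "\<phi> (proj H y u) = word_prod (presented_sg k R) (map \<phi> (map y u))"
    unfolding proj_def
    by (intro hom_word_prod[OF H(1) sgrp_presented[OF R(2,1)] \<phi>] sgrp.map_in_words[OF H(1) y u])
  also have "map \<phi> (map y u) = map (\<lambda>w. sg_cong k R `` {w}) (map a u)"
    using a(2) u by (auto simp: words_iff)
  also have "word_prod (presented_sg k R) \<dots> = sg_cong k R `` {concat (map a u)}"
    using u a(1) by (intro word_prod_classes[OF R(2,1)]) (auto simp: words_iff[of u])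
  finally show ?thesis .
qed

lemma word_length_D3: "D3 (H\<lparr>carrier := A\<rparr>) m x (word_length H X)"
proof -
  obtain k R \<phi> where R: "1 \<le> k" "finite R" "R \<subseteq> free_sg k \<times> free_sg k"
    and \<phi>: "\<phi> \<in> sg_hom H (presented_sg k R)" "bij_betw \<phi> (carrier H) (carrier (presented_sg k R))"
    using H(2) by (auto simp: finitely_presented_def sg_isomorphic_def)
  define n where "n = card X"
  obtain y where "bij_betw y {0..<n} X" using ex_bij_betw_nat_finite[OF X(1)] n_def by blast
  then have y: "bij_betw y {..<n} X" by (simp add: atLeast0LessThan)
  then have y_in: "y \<in> {..<n} \<rightarrow> carrier H" using X_subset by (auto simp: bij_betw_def)
  have words_X: "words X = map y ` free_sg n"
  proof
    show "map y ` free_sg n \<subseteq> words X"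
      using bij_betw_imp_surj_on[OF y] by (fastforce simp: words_iff)
    show "words X \<subseteq> map y ` free_sg n"
    proof
      fix w assume w: "w \<in> words X"
      then have "map y (map (inv_into {..<n} y) w) = w"
        using y by (auto simp: words_iff bij_betw_def subset_iff f_inv_into_f intro!: map_idI)
      moreover have "map (inv_into {..<n} y) w \<in> free_sg n"
        using w y inv_into_into[of _ y "{..<n}"] by (auto simp: words_iff bij_betw_def subset_iff)
      ultimately show "w \<in> map y ` free_sg n" by (metis imageI)
    qed
  qed
  \<comment> \<open>(D3) asks for a positive rank; \<open>X\<close> is nonempty because
    \<open>H\<close> is.\<close>
  have n: "1 \<le> n"
  proof -
    obtain g where "g \<in> carrier H" using sgrp.nonempty[OF H(1)] by blast
    then obtain w where "w \<in> words X" using X(2) by (auto simp: generating_set_def)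
    then have "X \<noteq> {}" by (cases w) (auto simp: words_iff)
    then show ?thesis using X(1) by (simp add: n_def Suc_le_eq card_gt_0_iff)
  qed
  \<comment> \<open>The codes of an element are the words over \<open>X\<close> that represent it,
    so the least length of a code is its word length, and membership in \<open>T\<close> is an
    instance of the word problem.\<close>
  define T where "T = {(v, u). v \<in> free_sg m \<and> u \<in> free_sg n \<and> proj H x v = proj H y u}"
  have "x i \<in> carrier H" if "i < m" for i using x that by auto
  then obtain a where a: "\<And>i. i < m \<Longrightarrow> a i \<in> free_sg k" "\<And>i. i < m \<Longrightarrow> \<phi> (x i) = sg_cong k R `` {a i}"
    using class_words[OF R(3) \<phi>(1), of m x] by blast
  have "y i \<in> carrier H" if "i < n" for i using y_in that by auto
  then obtain b where b: "\<And>i. i < n \<Longrightarrow> b i \<in> free_sg k" "\<And>i. i < n \<Longrightarrow> \<phi> (y i) = sg_cong k R `` {b i}"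
    using class_words[OF R(3) \<phi>(1), of n y] by blast
  have "proj H x v = proj H y u \<longleftrightarrow> (concat (map a v), concat (map b u)) \<in> sg_cong k R"
    if v: "v \<in> free_sg m" and u: "u \<in> free_sg n" for v u
  proof -
    have "proj H x v = proj H y u \<longleftrightarrow> \<phi> (proj H x v) = \<phi> (proj H y u)"
      using \<phi>(2) sgrp.proj_closed[OF H(1) x v] sgrp.proj_closed[OF H(1) y_in u]
      by (auto simp: bij_betw_def inj_on_eq_iff)
    also have "\<dots> \<longleftrightarrow> sg_cong k R `` {concat (map a v)} = sg_cong k R `` {concat (map b u)}"
      using hom_proj[OF R(1,3) \<phi>(1) x a v] hom_proj[OF R(1,3) \<phi>(1) y_in b u] by simp
    also have "\<dots> \<longleftrightarrow> (concat (map a v), concat (map b u)) \<in> sg_cong k R"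
    proof (rule class_eq_iff[OF R(3)])
      show "concat (map a v) \<in> free_sg k"
        using v a(1) by (intro concat_in_words) (auto simp: words_iff[of v])
      show "concat (map b u) \<in> free_sg k"
        using u b(1) by (intro concat_in_words) (auto simp: words_iff[of u])
    qed
    finally show ?thesis .
  qed
  then have "T = {(v, u). v \<in> free_sg m \<and> u \<in> free_sg n \<and>
      (concat (map a v), concat (map b u)) \<in> sg_cong k R}"
    unfolding T_def by blast
  then have "rec_enumerable T" using rec_enumerable_word_problem[OF R(2,3) a(1)] by simp
  moreover have "\<exists>u. (v1, u) \<in> T \<and> (v2, u) \<in> T"
    if "v1 \<in> free_sg m" "v2 \<in> free_sg m" "proj H x v1 = proj H x v2" for v1 v2
  proof -
    have "proj H x v1 \<in> word_prod H ` words X"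
      using X(2) sgrp.proj_closed[OF H(1) x that(1)] by (simp add: generating_set_def)
    then obtain u where "u \<in> free_sg n" "proj H x v1 = proj H y u"
      unfolding words_X by (auto simp: proj_def)
    with that show ?thesis unfolding T_def by auto
  qed
  moreover have "word_length H X (proj H x v) = (LEAST k. \<exists>u. (v, u) \<in> T \<and> length u = k)"
    if "v \<in> free_sg m" for v
  proof -
    have "(\<exists>w\<in>words X. word_prod H w = proj H x v \<and> length w = k) \<longleftrightarrow> (\<exists>u. (v, u) \<in> T \<and> length u = k)" for k
      unfolding words_X T_def using that by (auto simp: proj_def)
    then show ?thesis by (simp add: word_length_def)
  qed
  ultimately show ?thesis
    unfolding D3_def proj_carrier_update using n
    by (intro exI[of _ n] exI[of _ T]) (auto simp: T_def)
qed

end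

lemma length_function_realizable:
  fixes S :: "'b sgrp"
  assumes S: "sgrp S" "generated_by S m x" and l: "l \<in> carrier S \<rightarrow> {1..}" "D1 S l" "D3 S m x l"
  shows "\<exists>(H :: nat list set sgrp) \<phi>. sgrp H \<and> finitely_presented H \<and> sg_embedding \<phi> S H \<and>
    (\<forall>X. finite X \<and> generating_set H X \<longrightarrow> equivalent_on (carrier S) (\<lambda>g. word_length H X (\<phi> g)) l)"
proof -
  obtain n T where T: "1 \<le> n" "T \<subseteq> free_sg m \<times> free_sg n" "rec_enumerable T"
    "\<forall>v1 v2 u. (v1, u) \<in> T \<and> (v2, u) \<in> T \<longrightarrow> proj S x v1 = proj S x v2"
    "\<forall>v1\<in>free_sg m. \<forall>v2\<in>free_sg m. proj S x v1 = proj S x v2 \<longrightarrow>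
        (\<exists>u. (v1, u) \<in> T \<and> (v2, u) \<in> T)"
    "\<forall>v\<in>free_sg m. l (proj S x v) = (LEAST k. \<exists>u. (v, u) \<in> T \<and> length u = k)"
    using l(3) unfolding D3_def by (elim exE conjE) (rule that)
  note T' = T(1-3) T(4)[rule_format, OF conjI] T(5,6)[rule_format]
  obtain f where f: "T = {(v, u). \<exists>y. rec_eval f [list_encode v, list_encode u] y}"
    using T(3) by (auto simp: rec_enumerable_def)
  obtain p where p: "\<forall>v u r. halts (p, (map Suc v @ 0 # map Suc u, []), r) \<longleftrightarrow>
      (\<exists>y. rec_eval f [list_encode v, list_encode u] y)"
    using ex_domain_program[of f] ..
  define Q where "Q = insert [] (conts (max m n) p)"
  \<comment> \<open>The value 0 for the empty program is a mere default, as that program has no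
    leading instruction.\<close>
  define head where "head q = (case q of [] \<Rightarrow> 0 | i # k \<Rightarrow> reg i)" for q
  define B where "B = Suc (Max (head ` Q))"
  have Q: "finite Q" "p \<in> Q" "[] \<in> Q"
    by (auto simp: Q_def finite_conts self_in_conts)
  have step: "fst (step (q, (t1, t2), r)) \<in> Q" if "q \<in> Q" "set t1 \<subseteq> {..max m n}" for q t1 t2 r
    using that step_conts[OF that(2)] by (auto simp: Q_def)
  have reg: "reg i < B" if "i # k \<in> Q" for i k
  proof -
    have "head (i # k) \<le> Max (head ` Q)" using that Q(1) by (intro Max_ge) auto
    then show ?thesis by (simp add: B_def head_def)
  qed
  interpret sgrp S by (rule S(1))
  interpret length_machine S m n B x l T p Q
  proof unfold_locales
    show "1 \<le> m" "x \<in> {..<m} \<rightarrow> carrier S" "carrier S = proj S x ` free_sg m"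
      using S(2) by (auto simp: generated_by_def)
    show "1 \<le> l g" if "g \<in> carrier S" for g using l(1) that by auto
    show "l (g \<cdot>\<^bsub>S\<^esub> h) \<le> l g + l h" if "g \<in> carrier S" "h \<in> carrier S" for g h
      using l(2) that by (auto simp: D1_def)
    show "halts (p, (map Suc v @ 0 # map Suc u, []), r) \<longleftrightarrow> (v, u) \<in> T" for v u r
      by (simp add: p f)
  qed (fact T' Q step reg)+
  show ?thesis using embedding by blast
qed

theorem theorem1p9:
  shows
    "(\<forall>(H :: 'a sgrp) X A m x.
        sgrp H \<and> finitely_presented H \<and> finite X \<and> generating_set H X \<and>
        subsemigroup A H \<and> generated_by (H\<lparr>carrier := A\<rparr>) m x \<longrightarrow>
        word_length H X \<in> A \<rightarrow> {1..} \<and>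
        D1 (H\<lparr>carrier := A\<rparr>) (word_length H X) \<and>
        D2 (H\<lparr>carrier := A\<rparr>) (word_length H X) \<and>
        D3 (H\<lparr>carrier := A\<rparr>) m x (word_length H X)) \<and>
     (\<forall>(S :: 'b sgrp) m x (l :: 'b \<Rightarrow> nat).
        sgrp S \<and> generated_by S m x \<and> l \<in> carrier S \<rightarrow> {1..} \<and>
        D1 S l \<and> D2 S l \<and> D3 S m x l \<longrightarrow>
        (\<exists>(H :: nat list set sgrp) \<phi>.
           sgrp H \<and> finitely_presented H \<and> sg_embedding \<phi> S H \<and>
           (\<forall>X. finite X \<and> generating_set H X \<longrightarrow>
              equivalent_on (carrier S) (\<lambda>g. word_length H X (\<phi> g)) l)))"
proof (intro conjI allI impI)
  fix H :: "'a sgrp" and X A m x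
  assume "sgrp H \<and> finitely_presented H \<and> finite X \<and> generating_set H X \<and>
    subsemigroup A H \<and> generated_by (H\<lparr>carrier := A\<rparr>) m x"
  then interpret sub_of_fp H X A m x by (simp add: sub_of_fp_def)
  show "word_length H X \<in> A \<rightarrow> {1..}" "D1 (H\<lparr>carrier := A\<rparr>) (word_length H X)"
    "D2 (H\<lparr>carrier := A\<rparr>) (word_length H X)" "D3 (H\<lparr>carrier := A\<rparr>) m x (word_length H X)"
    by (fact word_length_pos word_length_D1 word_length_D2 word_length_D3)+
next
  fix S :: "'b sgrp" and m x and l :: "'b \<Rightarrow> nat"
  assume "sgrp S \<and> generated_by S m x \<and> l \<in> carrier S \<rightarrow> {1..} \<and> D1 S l \<and> D2 S l \<and> D3 S m x l"
  then show "\<exists>(H :: nat list set sgrp) \<phi>.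
           sgrp H \<and> finitely_presented H \<and> sg_embedding \<phi> S H \<and>
           (\<forall>X. finite X \<and> generating_set H X \<longrightarrow>
              equivalent_on (carrier S) (\<lambda>g. word_length H X (\<phi> g)) l)"
    using length_function_realizable by blast
qed

end
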